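(* Let $\theta,\alpha$ be nonconstant inner functions and let $\Phi\colon L^\infty\to\mathcal{T}(K_\theta^\perp,K_\alpha^\perp)\subset\mathcal{B}(K_\theta^\perp,K_\alpha^\perp)$ be the map $\varphi\mapsto D^{\theta,\alpha}_\varphi$. Then: (1) $\Phi$ is a linear isometry onto $\mathcal{T}(K_\theta^\perp,K_\alpha^\perp)$; (2) $\Phi$ is continuous with respect to the weak* topologies in both spaces; (3) $\Phi_{|H^\infty}$ is a bijection onto $\mathcal{A}(K_\theta^\perp,K_\alpha^\perp)$; (4) $\mathcal{T}(K_\theta^\perp,K_\alpha^\perp)$ has property $\mathbb{A}_{1/2}(1)$; (5) any weak*-closed subspace $\mathcal{S}\subset\mathcal{T}(K_\theta^\perp,K_\alpha^\perp)$ is $2$-reflexive; (6) $\mathcal{A}(K_\theta^\perp,K_\alpha^\perp)$ is weak*-closed and $2$-reflexive.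
   Context: $L^2=L^2(\mathbb{T},m)$ with $m$ normalized Lebesgue measure on the unit circle; $H^2\subset L^2$ is the Hardy space, $H^\infty=H^2\cap L^\infty$. For an inner function $\theta$, $K_\theta=H^2\ominus\theta H^2$ and $K_\theta^\perp=L^2\ominus K_\theta=\theta H^2\oplus\overline{zH^2}$; $P_\theta^\perp$ is the orthogonal projection of $L^2$ onto $K_\theta^\perp$. For $\varphi\in L^2$, $D^{\theta,\alpha}_\varphi$ is defined on $K_\theta^\perp\cap L^\infty$ (dense in $K_\theta^\perp$) by $D^{\theta,\alpha}_\varphi f=P_\alpha^\perp(\varphi f)$. If it extends to a bounded operator $K_\theta^\perp\to K_\alpha^\perp$ (this happens if and only if $\varphi\in L^\infty$), it is called an asymmetric dual truncated Toeplitz operator; $\mathcal{T}(K_\theta^\perp,K_\alpha^\perp)$ is the set of all such bounded operators, and $\mathcal{A}(K_\theta^\perp,K_\alpha^\perp)=\{D^{\theta,\alpha}_\varphi:\varphi\in H^\infty\}$. The weak* topology on $L^\infty$ is that of the dual of $L^1$. For separable complex Hilbert spaces $\mathcal{H},\mathcal{K}$, $\mathcal{B}(\mathcal{H},\mathcal{K})$ is the space of bounded linear operators $\mathcal{H}\to\mathcal{K}$ and $\mathcal{B}_1(\mathcal{K},\mathcal{H})$ the space of trace class operators $\mathcal{K}\to\mathcal{H}$ with trace norm $\|\cdot\|_1$; $f\otimes g$ ($f\in\mathcal{H}$, $g\in\mathcal{K}$) is the operator $x\mapsto\langle x,g\rangle f$. $\mathcal{B}(\mathcal{H},\mathcal{K})$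 is the dual of $\mathcal{B}_1(\mathcal{K},\mathcal{H})$ via $<T,t>=\sum_n\langle Tf_n,g_n\rangle$ for $t=\sum_n f_n\otimes g_n$ with $\sum\|f_n\|^2<\infty$, $\sum\|g_n\|^2<\infty$; this gives the weak* topology. $\mathcal{F}_k$ is the set of operators in $\mathcal{B}_1(\mathcal{K},\mathcal{H})$ of rank at most $k$. For $\mathcal{S}\subset\mathcal{B}(\mathcal{H},\mathcal{K})$, $\mathcal{S}_\perp=\{t\in\mathcal{B}_1(\mathcal{K},\mathcal{H}):<T,t>=0\ \forall T\in\mathcal{S}\}$; for $\mathcal{M}\subset\mathcal{B}_1(\mathcal{K},\mathcal{H})$, $\mathcal{M}^\perp=\{T\in\mathcal{B}(\mathcal{H},\mathcal{K}):<T,t>=0\ \forall t\in\mathcal{M}\}$. A weak*-closed subspace $\mathcal{S}$ is $k$-reflexive ($k\ge2$) if $\mathcal{S}=(\mathcal{S}_\perp\cap\mathcal{F}_k)^\perp$. A subspace $\mathcal{S}\subset\mathcal{B}(\mathcal{H},\mathcal{K})$ has property $\mathbb{A}_{1/k}$ if it is weak*-closed and for every weak*-continuous functional $\Lambda$ on $\mathcal{S}$ there is $g\in\mathcal{F}_k$ with $\Lambda(S)=<S,g>$ for all $S\in\mathcal{S}$. For $r\ge1$, $\mathcal{S}$ has property $\mathbb{A}_{1/k}(r)$ if it has property $\mathbb{A}_{1/k}$ and, for each such $\Lambda$ and any $\varepsilon>0$, the operator $g\in\mathcal{F}_k$ can be chosen with $\|g\|_1\le(r+\varepsilon)\|\Lambda\|$.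 *)

theory Defs
  imports "HOL-Probability.Probability"
begin

section \<open>Complex inner product spaces\<close>

class complex_inner = real_normed_vector +
  fixes scaleC :: "complex \<Rightarrow> 'a \<Rightarrow> 'a"  (infixr "*\<^sub>C" 75)
    and cinner :: "'a \<Rightarrow> 'a \<Rightarrow> complex"
  assumes scaleC_add_right: "c *\<^sub>C (x + y) = c *\<^sub>C x + c *\<^sub>C y"
    and scaleC_add_left: "(c + d) *\<^sub>C x = c *\<^sub>C x + d *\<^sub>C x"
    and scaleC_scaleC: "c *\<^sub>C d *\<^sub>C x = (c * d) *\<^sub>C x"
    and scaleC_one: "1 *\<^sub>C x = x"
    and scaleR_eq_scaleC: "r *\<^sub>R x = complex_of_real r *\<^sub>C x"
    and cinner_add_left: "cinner (x + y) z = cinner x z + cinner y z"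
    and cinner_scaleC_left: "cinner (c *\<^sub>C x) y = c * cinner x y"
    and cinner_commute: "cinner y x = cnj (cinner x y)"
    and cinner_self: "cinner x x = complex_of_real ((norm x)\<^sup>2)"

global_interpretation complex_vector: vector_space "scaleC :: complex \<Rightarrow> 'a \<Rightarrow> 'a::complex_inner"
  defines csubspace = complex_vector.subspace
    and cspan = complex_vector.span
  by unfold_locales (auto simp: scaleC_add_right scaleC_add_left scaleC_scaleC scaleC_one)

definition orth_compl :: "'a::complex_inner set \<Rightarrow> 'a set" where
  "orth_compl M = {x. \<forall>y\<in>M. cinner x y = 0}"

definition orth_proj :: "'a::complex_inner set \<Rightarrow> 'a \<Rightarrow> 'a" where
  "orth_proj M x = (THE y. y \<in> M \<and> x - y \<in> orth_compl M)"

definition is_onb :: "'a::complex_inner set \<Rightarrow> 'a set \<Rightarrow> bool" where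
  "is_onb K E \<longleftrightarrow> E \<subseteq> K \<and> (\<forall>e\<in>E. \<forall>e'\<in>E. cinner e e' = (if e = e' then 1 else 0)) \<and>
     K \<inter> orth_compl E = {0}"

section \<open>Bounded operators, trace class operators and the weak* topology\<close>

text \<open>In this section \<open>H\<close> and \<open>K\<close> are closed subspaces of one ambient Hilbert space. An
operator from \<open>H\<close> to \<open>K\<close> is represented by the function on the ambient space that agrees with it
on \<open>H\<close> and vanishes outside \<open>H\<close>; so operators are equal iff the functions are equal, and the
vector space operations are pointwise.\<close>

definition bounded_ops :: "'a::complex_inner set \<Rightarrow> 'a set \<Rightarrow> ('a \<Rightarrow> 'a) set" where
  "bounded_ops H K = {T.
     (\<forall>x. x \<notin> H \<longrightarrow> T x = 0) \<and> (\<forall>x\<in>H. T x \<in> K) \<and>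
     (\<forall>x\<in>H. \<forall>y\<in>H. T (x + y) = T x + T y) \<and> (\<forall>c. \<forall>x\<in>H. T (c *\<^sub>C x) = c *\<^sub>C T x) \<and>
     (\<exists>C. \<forall>x\<in>H. norm (T x) \<le> C * norm x)}"

definition op_norm :: "'a::complex_inner set \<Rightarrow> ('a \<Rightarrow> 'a) \<Rightarrow> real" where
  "op_norm H T = (SUP x\<in>{x\<in>H. norm x \<le> 1}. norm (T x))"

definition op_subspace :: "('a::complex_inner \<Rightarrow> 'a) set \<Rightarrow> bool" where
  "op_subspace S \<longleftrightarrow> (\<lambda>x. 0) \<in> S \<and> (\<forall>T\<in>S. \<forall>U\<in>S. (\<lambda>x. T x + U x) \<in> S) \<and>
     (\<forall>c. \<forall>T\<in>S. (\<lambda>x. c *\<^sub>C T x) \<in> S)"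

text \<open>\<open>tensor_series H K t f g\<close> says that the operator \<open>t\<close> from \<open>K\<close> to \<open>H\<close> is
\<open>\<Sum>n. f n \<otimes> g n\<close>, with \<open>f\<close> and \<open>g\<close> square summable; the trace class operators are those which
have such a representation.\<close>

definition tensor_series ::
  "'a::complex_inner set \<Rightarrow> 'a set \<Rightarrow> ('a \<Rightarrow> 'a) \<Rightarrow> (nat \<Rightarrow> 'a) \<Rightarrow> (nat \<Rightarrow> 'a) \<Rightarrow> bool" where
  "tensor_series H K t f g \<longleftrightarrow> range f \<subseteq> H \<and> range g \<subseteq> K \<and>
     summable (\<lambda>n. (norm (f n))\<^sup>2) \<and> summable (\<lambda>n. (norm (g n))\<^sup>2) \<and>
     (\<forall>x\<in>K. (\<lambda>n. cinner x (g n) *\<^sub>C f n) sums t x)"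

definition trace_class :: "'a::complex_inner set \<Rightarrow> 'a set \<Rightarrow> ('a \<Rightarrow> 'a) set" where
  "trace_class K H = {t \<in> bounded_ops K H. \<exists>f g. tensor_series H K t f g}"

text \<open>The duality \<open><T, t>\<close> does not depend on the representation of \<open>t\<close>.\<close>

definition pairing ::
  "'a::complex_inner set \<Rightarrow> 'a set \<Rightarrow> ('a \<Rightarrow> 'a) \<Rightarrow> ('a \<Rightarrow> 'a) \<Rightarrow> complex" where
  "pairing H K T t =
     (THE c. \<exists>f g. tensor_series H K t f g \<and> (\<lambda>n. cinner (T (f n)) (g n)) sums c)"

text \<open>\<open>abs_op K t\<close> is \<open>|t|\<close>, the (unique) positive operator \<open>p\<close> on \<open>K\<close> with \<open>p\<^sup>2 = t\<^sup>*t\<close>, and the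
trace norm is the trace of \<open>|t|\<close> (in any orthonormal basis of \<open>K\<close>).\<close>

definition abs_op :: "'a::complex_inner set \<Rightarrow> ('a \<Rightarrow> 'a) \<Rightarrow> 'a \<Rightarrow> 'a" where
  "abs_op K t = (SOME p. p \<in> bounded_ops K K \<and> (\<forall>x\<in>K. cinner (p x) x \<in> \<real>\<^sub>\<ge>\<^sub>0) \<and>
     (\<forall>x\<in>K. \<forall>y\<in>K. cinner (p (p x)) y = cinner (t x) (t y)))"

definition trace_norm :: "'a::complex_inner set \<Rightarrow> ('a \<Rightarrow> 'a) \<Rightarrow> real" where
  "trace_norm K t = (\<Sum>\<^sub>\<infinity>e\<in>(SOME E. is_onb K E). Re (cinner (abs_op K t e) e))"

definition rank_le_ops :: "nat \<Rightarrow> 'a::complex_inner set \<Rightarrow> 'a set \<Rightarrow> ('a \<Rightarrow> 'a) set" where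
  "rank_le_ops k K H =
     {t \<in> trace_class K H. \<exists>B. finite B \<and> card B \<le> k \<and> t ` K \<subseteq> cspan B}"

definition pre_annihilator ::
  "'a::complex_inner set \<Rightarrow> 'a set \<Rightarrow> ('a \<Rightarrow> 'a) set \<Rightarrow> ('a \<Rightarrow> 'a) set" where
  "pre_annihilator H K S = {t \<in> trace_class K H. \<forall>T\<in>S. pairing H K T t = 0}"

definition annihilator ::
  "'a::complex_inner set \<Rightarrow> 'a set \<Rightarrow> ('a \<Rightarrow> 'a) set \<Rightarrow> ('a \<Rightarrow> 'a) set" where
  "annihilator H K M = {T \<in> bounded_ops H K. \<forall>t\<in>M. pairing H K T t = 0}"

text \<open>The coarsest topology on \<open>X\<close> that makes all functionals in \<open>F\<close> continuous.\<close>

definition weak_topology_on :: "'b set \<Rightarrow> ('b \<Rightarrow> complex) set \<Rightarrow> 'b topology" where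
  "weak_topology_on X F = topology_generated_by {{x\<in>X. \<phi> x \<in> U} | \<phi> U. \<phi> \<in> F \<and> open U}"

definition weak_star :: "'a::complex_inner set \<Rightarrow> 'a set \<Rightarrow> ('a \<Rightarrow> 'a) topology" where
  "weak_star H K =
     weak_topology_on (bounded_ops H K) {\<lambda>T. pairing H K T t | t. t \<in> trace_class K H}"

definition k_reflexive ::
  "nat \<Rightarrow> 'a::complex_inner set \<Rightarrow> 'a set \<Rightarrow> ('a \<Rightarrow> 'a) set \<Rightarrow> bool" where
  "k_reflexive k H K S \<longleftrightarrow> op_subspace S \<and> closedin (weak_star H K) S \<and>
     S = annihilator H K (pre_annihilator H K S \<inter> rank_le_ops k K H)"

definition weak_star_functional ::
  "'a::complex_inner set \<Rightarrow> 'a set \<Rightarrow> ('a \<Rightarrow> 'a) set \<Rightarrow> (('a \<Rightarrow> 'a) \<Rightarrow> complex) \<Rightarrow> bool" where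
  "weak_star_functional H K S \<Lambda> \<longleftrightarrow>
     (\<forall>T\<in>S. \<forall>U\<in>S. \<Lambda> (\<lambda>x. T x + U x) = \<Lambda> T + \<Lambda> U) \<and>
     (\<forall>c. \<forall>T\<in>S. \<Lambda> (\<lambda>x. c *\<^sub>C T x) = c * \<Lambda> T) \<and>
     continuous_map (subtopology (weak_star H K) S) euclidean \<Lambda>"

definition functional_norm ::
  "'a::complex_inner set \<Rightarrow> ('a \<Rightarrow> 'a) set \<Rightarrow> (('a \<Rightarrow> 'a) \<Rightarrow> complex) \<Rightarrow> real" where
  "functional_norm H S \<Lambda> = (SUP T\<in>{T\<in>S. op_norm H T \<le> 1}. cmod (\<Lambda> T))"

text \<open>The properties \<open>A\<^sub>1\<^sub>/\<^sub>k\<close> and \<open>A\<^sub>1\<^sub>/\<^sub>k(r)\<close>, the latter meant for \<open>r \<ge> 1\<close>.\<close>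

definition property_A ::
  "nat \<Rightarrow> 'a::complex_inner set \<Rightarrow> 'a set \<Rightarrow> ('a \<Rightarrow> 'a) set \<Rightarrow> bool" where
  "property_A k H K S \<longleftrightarrow> op_subspace S \<and> closedin (weak_star H K) S \<and>
     (\<forall>\<Lambda>. weak_star_functional H K S \<Lambda> \<longrightarrow>
       (\<exists>g\<in>rank_le_ops k K H. \<forall>T\<in>S. \<Lambda> T = pairing H K T g))"

definition property_A_const ::
  "nat \<Rightarrow> real \<Rightarrow> 'a::complex_inner set \<Rightarrow> 'a set \<Rightarrow> ('a \<Rightarrow> 'a) set \<Rightarrow> bool" where
  "property_A_const k r H K S \<longleftrightarrow> property_A k H K S \<and>
     (\<forall>\<Lambda> \<epsilon>. weak_star_functional H K S \<Lambda> \<and> \<epsilon> > 0 \<longrightarrow>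
       (\<exists>g\<in>rank_le_ops k K H. (\<forall>T\<in>S. \<Lambda> T = pairing H K T g) \<and>
          trace_norm K g \<le> (r + \<epsilon>) * functional_norm H S \<Lambda>))"

section \<open>The space \<open>L\<^sup>2\<close> of the unit circle\<close>

text \<open>Normalized Lebesgue measure on the unit circle, as a Borel measure on the plane that is
concentrated on the circle.\<close>

definition circle_measure :: "complex measure" where
  "circle_measure = distr (uniform_measure lborel {0..<2 * pi}) borel cis"

lemma sets_circle_measure [simp, measurable_cong]: "sets circle_measure = sets borel"
  by (simp add: circle_measure_def)

lemma space_circle_measure [simp]: "space circle_measure = UNIV"
  by (simp add: circle_measure_def)

lemma prob_space_circle_measure: "prob_space circle_measure"
  unfolding circle_measure_def
proof (rule prob_space.prob_space_distr)
  show "prob_space (uniform_measure lborel {0..<2 * pi})"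
    by (rule prob_space_uniform_measure) auto
next
  have "cis \<in> borel_measurable borel"
    by (intro borel_measurable_continuous_onI continuous_intros)
  then show "cis \<in> uniform_measure lborel {0..<2 * pi} \<rightarrow>\<^sub>M borel"
    by simp
qed

lemma AE_norm_circle_measure: "AE z in circle_measure. norm z = 1"
proof -
  have [measurable]: "cis \<in> borel_measurable borel"
    by (intro borel_measurable_continuous_onI continuous_intros)
  show ?thesis
    unfolding circle_measure_def by (subst AE_distr_iff) auto
qed

definition sq_integrable :: "(complex \<Rightarrow> complex) \<Rightarrow> bool" where
  "sq_integrable f \<longleftrightarrow> f \<in> borel_measurable circle_measure \<and>
     integrable circle_measure (\<lambda>z. (cmod (f z))\<^sup>2)"

lemma sq_integrable_meas [measurable_dest]:
  "sq_integrable f \<Longrightarrow> f \<in> borel_measurable circle_measure"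
  by (simp add: sq_integrable_def)

lemma sq_integrable_int: "sq_integrable f \<Longrightarrow> integrable circle_measure (\<lambda>z. (cmod (f z))\<^sup>2)"
  by (simp add: sq_integrable_def)

lemma sq_integrable_bounded:
  assumes [measurable]: "f \<in> borel_measurable borel" and "AE z in circle_measure. cmod (f z) \<le> C"
  shows "sq_integrable f"
proof -
  interpret prob_space circle_measure by (rule prob_space_circle_measure)
  have "AE z in circle_measure. norm ((cmod (f z))\<^sup>2) \<le> C\<^sup>2"
    using assms(2) by eventually_elim (simp add: power_mono)
  then show ?thesis
    unfolding sq_integrable_def by (auto intro!: integrable_const_bound[where B = "C\<^sup>2"])
qed

lemma sq_integrable_scale: "sq_integrable f \<Longrightarrow> sq_integrable (\<lambda>z. c * f z)"
  by (auto simp: sq_integrable_def norm_mult power_mult_distrib)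

lemma sq_integrable_add:
  assumes "sq_integrable f" "sq_integrable g"
  shows "sq_integrable (\<lambda>z. f z + g z)"
proof -
  note [measurable] = assms[THEN sq_integrable_meas]
  have *: "(cmod (f z + g z))\<^sup>2 \<le> 2 * (cmod (f z))\<^sup>2 + 2 * (cmod (g z))\<^sup>2" for z
  proof -
    have "(cmod (f z + g z))\<^sup>2 \<le> (cmod (f z) + cmod (g z))\<^sup>2"
      by (intro power_mono norm_triangle_ineq) auto
    also have "\<dots> \<le> 2 * (cmod (f z))\<^sup>2 + 2 * (cmod (g z))\<^sup>2"
      using zero_le_power2[of "cmod (f z) - cmod (g z)"]
      by (simp add: power2_eq_square algebra_simps)
    finally show ?thesis .
  qed
  have "integrable circle_measure (\<lambda>z. (cmod (f z + g z))\<^sup>2)"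
    by (rule Bochner_Integration.integrable_bound
        [where f = "\<lambda>z. 2 * (cmod (f z))\<^sup>2 + 2 * (cmod (g z))\<^sup>2"])
      (use assms[THEN sq_integrable_int] * in auto)
  then show ?thesis
    by (auto simp: sq_integrable_def)
qed

lemma sq_integrable_prod:
  assumes "sq_integrable f" "sq_integrable g"
  shows "integrable circle_measure (\<lambda>z. f z * cnj (g z))"
proof -
  note [measurable] = assms[THEN sq_integrable_meas]
  have "(\<lambda>z. cnj (g z)) \<in> borel_measurable circle_measure"
    using measurable_comp[OF sq_integrable_meas[OF assms(2)]
        borel_measurable_continuous_onI[of cnj, OF continuous_on_cnj[OF continuous_on_id]]]
    by (simp add: comp_def)
  note [measurable] = this
  have *: "cmod (f z * cnj (g z)) \<le> (cmod (f z))\<^sup>2 + (cmod (g z))\<^sup>2" for z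
    using sum_squares_bound[of "cmod (f z)" "cmod (g z)"]
      mult_nonneg_nonneg[OF norm_ge_zero norm_ge_zero, of "f z" "g z"]
    unfolding norm_mult complex_mod_cnj by linarith
  show ?thesis
    by (rule Bochner_Integration.integrable_bound
        [where f = "\<lambda>z. (cmod (f z))\<^sup>2 + (cmod (g z))\<^sup>2"])
      (use assms[THEN sq_integrable_int] * in auto)
qed

lemma integral_prod_commute:
  "(LINT z|circle_measure. g z * cnj (f z)) = cnj (LINT z|circle_measure. f z * cnj (g z))"
proof -
  have "cnj (LINT z|circle_measure. f z * cnj (g z)) =
      (LINT z|circle_measure. cnj (f z * cnj (g z)))"
    by (rule Bochner_Integration.integral_cnj[symmetric])
  then show ?thesis by (simp add: mult.commute)
qed

lemma sq_integrable_triangle: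
  assumes f: "sq_integrable f" and g: "sq_integrable g"
  shows "sqrt (LINT z|circle_measure. (cmod (f z + g z))\<^sup>2)
    \<le> sqrt (LINT z|circle_measure. (cmod (f z))\<^sup>2) + sqrt (LINT z|circle_measure. (cmod (g z))\<^sup>2)"
    (is "sqrt ?c \<le> sqrt ?a + sqrt ?b")
proof -
  note [measurable] = f[THEN sq_integrable_meas] g[THEN sq_integrable_meas]
  note int = f[THEN sq_integrable_int] g[THEN sq_integrable_int]
  have AE0: "AE z in circle_measure. h z = 0"
    if "sq_integrable h" "(LINT z|circle_measure. (cmod (h z))\<^sup>2) = 0" for h
    using integral_nonneg_eq_0_iff_AE[OF sq_integrable_int[OF that(1)]] that(2) by simp
  have [simp]: "?a \<ge> 0" "?b \<ge> 0" by simp_all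
  consider "?a = 0" | "?b = 0" | "?a > 0" "?b > 0"
    using \<open>?a \<ge> 0\<close> \<open>?b \<ge> 0\<close> by linarith
  then show ?thesis
  proof cases
    case 1
    have "?c = ?b"
      by (rule integral_cong_AE) (use AE0[OF f 1] in \<open>auto elim!: eventually_mono\<close>)
    with 1 show ?thesis by simp
  next
    case 2
    have "?c = ?a"
      by (rule integral_cong_AE) (use AE0[OF g 2] in \<open>auto elim!: eventually_mono\<close>)
    with 2 show ?thesis by simp
  next
    case 3
    define A B where "A = sqrt ?a" and "B = sqrt ?b"
    have pos: "A > 0" "B > 0" using 3 by (simp_all add: A_def B_def)
    have sq: "?a = A\<^sup>2" "?b = B\<^sup>2" by (simp_all add: A_def B_def)
    have *: "(cmod (f z + g z))\<^sup>2 \<le> (1 + B / A) * (cmod (f z))\<^sup>2 + (1 + A / B) * (cmod (g z))\<^sup>2" for z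
    proof -
      have "(cmod (f z + g z))\<^sup>2 \<le> (cmod (f z) + cmod (g z))\<^sup>2"
        by (intro power_mono norm_triangle_ineq) auto
      also have "\<dots> \<le> (1 + B / A) * (cmod (f z))\<^sup>2 + (1 + A / B) * (cmod (g z))\<^sup>2"
      proof -
        have "0 \<le> (B * cmod (f z) - A * cmod (g z))\<^sup>2 / (A * B)" using pos by simp
        also have "\<dots> = (B / A) * (cmod (f z))\<^sup>2 + (A / B) * (cmod (g z))\<^sup>2 - 2 * cmod (f z) * cmod (g z)"
          using pos by (simp add: field_simps power2_eq_square)
        finally show ?thesis by (simp add: power2_eq_square algebra_simps)
      qed
      finally show ?thesis .
    qed
    have "?c \<le> (LINT z|circle_measure. (1 + B / A) * (cmod (f z))\<^sup>2 + (1 + A / B) * (cmod (g z))\<^sup>2)"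
      by (rule integral_mono) (use int sq_integrable_int[OF sq_integrable_add[OF f g]] * in auto)
    also have "\<dots> = (1 + B / A) * A\<^sup>2 + (1 + A / B) * B\<^sup>2"
      using int by (simp add: sq)
    also have "\<dots> = (A + B)\<^sup>2"
      using pos by (simp add: field_simps power2_eq_square)
    finally have "?c \<le> (A + B)\<^sup>2" .
    then have "sqrt ?c \<le> A + B"
      using pos by (intro real_le_lsqrt) auto
    then show ?thesis by (simp add: A_def B_def)
  qed
qed

quotient_type L2 = "complex \<Rightarrow> complex" / partial:
  "\<lambda>f g. sq_integrable f \<and> sq_integrable g \<and> (AE z in circle_measure. f z = g z)"
proof (rule part_equivpI)
  show "\<exists>f. sq_integrable f \<and> sq_integrable f \<and> (AE z in circle_measure. f z = f z)"
    by (intro exI[of _ "\<lambda>z. 0"]) (simp add: sq_integrable_def)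
  show "symp (\<lambda>f g. sq_integrable f \<and> sq_integrable g \<and> (AE z in circle_measure. f z = g z))"
    by (auto simp: symp_def elim: eventually_mono)
  show "transp (\<lambda>f g. sq_integrable f \<and> sq_integrable g \<and> (AE z in circle_measure. f z = g z))"
    by (auto simp: transp_def elim: eventually_elim2)
qed

instantiation L2 :: complex_inner
begin

lift_definition zero_L2 :: L2 is "\<lambda>z. 0"
  by (simp add: sq_integrable_def)

lift_definition plus_L2 :: "L2 \<Rightarrow> L2 \<Rightarrow> L2" is "\<lambda>f g z. f z + g z"
  by (auto intro: sq_integrable_add elim: eventually_elim2)

lift_definition scaleC_L2 :: "complex \<Rightarrow> L2 \<Rightarrow> L2" is "\<lambda>c f z. c * f z"
  by (auto intro: sq_integrable_scale elim: eventually_mono)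

lift_definition cinner_L2 :: "L2 \<Rightarrow> L2 \<Rightarrow> complex" is
  "\<lambda>f g. LINT z|circle_measure. f z * cnj (g z)"
  subgoal for f f' g g'
    using borel_measurable_integrable[OF sq_integrable_prod[of f g]]
      borel_measurable_integrable[OF sq_integrable_prod[of f' g']]
    by (intro integral_cong_AE) (auto elim: eventually_elim2)
  done

definition uminus_L2 :: "L2 \<Rightarrow> L2" where "- f = (- 1) *\<^sub>C (f::L2)"
definition minus_L2 :: "L2 \<Rightarrow> L2 \<Rightarrow> L2" where "f - g = f + - (g::L2)"
definition scaleR_L2 :: "real \<Rightarrow> L2 \<Rightarrow> L2" where "r *\<^sub>R f = complex_of_real r *\<^sub>C (f::L2)"

lift_definition norm_L2 :: "L2 \<Rightarrow> real" is "\<lambda>f. sqrt (LINT z|circle_measure. (cmod (f z))\<^sup>2)"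
  by (auto intro!: integral_cong_AE elim: eventually_mono)

definition dist_L2 :: "L2 \<Rightarrow> L2 \<Rightarrow> real" where "dist_L2 f g = norm (f - g)"
definition sgn_L2 :: "L2 \<Rightarrow> L2" where "sgn_L2 f = inverse (norm f) *\<^sub>R (f::L2)"
definition uniformity_L2 :: "(L2 \<times> L2) filter" where
  "uniformity_L2 = (INF e\<in>{0<..}. principal {(f, g). dist f g < e})"
definition open_L2 :: "L2 set \<Rightarrow> bool" where
  "open_L2 U \<longleftrightarrow> (\<forall>x\<in>U. eventually (\<lambda>(x', y). x' = x \<longrightarrow> y \<in> U) uniformity)"

instance
proof
  fix f g h :: L2 and c d :: complex and r s :: real
  show add_assoc: "f + g + h = f + (g + h)" by transfer (auto intro: sq_integrable_add simp: add.assoc)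
  show add_comm: "f + g = g + f" by transfer (auto intro: sq_integrable_add simp: add.commute)
  show "0 + f = f" by transfer auto
  show "- f + f = 0"
    unfolding uminus_L2_def by transfer (auto simp: sq_integrable_def)
  show "f - g = f + - g" by (rule minus_L2_def)
  have C1: "c *\<^sub>C (f + g) = c *\<^sub>C f + c *\<^sub>C g" for c and f g :: L2
    by transfer (auto intro: sq_integrable_add sq_integrable_scale simp: distrib_left
        sq_integrable_scale[OF sq_integrable_add, simplified distrib_left])
  have C2: "(c + d) *\<^sub>C f = c *\<^sub>C f + d *\<^sub>C f" for c d and f :: L2
    by transfer (auto intro: sq_integrable_add sq_integrable_scale simp: distrib_right
        sq_integrable_scale[of _ "_ + _", simplified distrib_right])
  have C3: "c *\<^sub>C d *\<^sub>C f = (c * d) *\<^sub>C f" for c d and f :: L2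
    by transfer (auto intro: sq_integrable_scale simp: mult.assoc
        sq_integrable_scale[of _ "_ * _", simplified mult.assoc])
  have C4: "1 *\<^sub>C f = f" for f :: L2 by transfer auto
  show "c *\<^sub>C (f + g) = c *\<^sub>C f + c *\<^sub>C g" "(c + d) *\<^sub>C f = c *\<^sub>C f + d *\<^sub>C f"
    "c *\<^sub>C d *\<^sub>C f = (c * d) *\<^sub>C f" "1 *\<^sub>C f = f" by (fact C1 C2 C3 C4)+
  show "r *\<^sub>R f = complex_of_real r *\<^sub>C f" by (rule scaleR_L2_def)
  show "r *\<^sub>R (f + g) = r *\<^sub>R f + r *\<^sub>R g" "(r + s) *\<^sub>R f = r *\<^sub>R f + s *\<^sub>R f"
    "r *\<^sub>R s *\<^sub>R f = (r * s) *\<^sub>R f" "1 *\<^sub>R f = f"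
    by (simp_all add: scaleR_L2_def C1 C2 C3 C4)
  show "dist f g = norm (f - g)" by (rule dist_L2_def)
  show "sgn f = inverse (norm f) *\<^sub>R f" by (rule sgn_L2_def)
  show "uniformity = (INF e\<in>{0<..}. principal {(f :: L2, g). dist f g < e})" by (rule uniformity_L2_def)
  show "open U \<longleftrightarrow> (\<forall>x\<in>U. \<forall>\<^sub>F (x', y) in uniformity. x' = x \<longrightarrow> y \<in> U)" for U :: "L2 set"
    by (rule open_L2_def)
  show "norm f = 0 \<longleftrightarrow> f = 0"
    by transfer (auto simp: sq_integrable_def integral_nonneg_eq_0_iff_AE)
  show "norm (f + g) \<le> norm f + norm g"
    by transfer (auto intro: sq_integrable_triangle)
  show "norm (r *\<^sub>R f) = \<bar>r\<bar> * norm f"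
    unfolding scaleR_L2_def by transfer (auto simp: norm_mult power_mult_distrib real_sqrt_mult)
  show "cinner (f + g) h = cinner f h + cinner g h"
    by transfer (simp add: distrib_right sq_integrable_prod)
  show "cinner (c *\<^sub>C f) g = c * cinner f g"
    by transfer (simp add: mult.assoc)
  show "cinner g f = cnj (cinner f g)"
    by transfer (rule integral_prod_commute)
  show "cinner f f = complex_of_real ((norm f)\<^sup>2)"
    by transfer (simp add: complex_norm_square[symmetric] del: of_real_power)
qed

end

section \<open>Hardy spaces, inner functions and model spaces\<close>

lift_definition ess_sup_norm :: "L2 \<Rightarrow> ereal" is
  "\<lambda>f. esssup circle_measure (\<lambda>z. ereal (cmod (f z)))"
  by (rule esssup_AE_cong) (auto simp: sq_integrable_def elim: eventually_mono)

definition Linf :: "L2 set" where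
  "Linf = {\<phi>. ess_sup_norm \<phi> < \<infinity>}"

definition Linf_norm :: "L2 \<Rightarrow> real" where
  "Linf_norm \<phi> = real_of_ereal (ess_sup_norm \<phi>)"

text \<open>The pointwise product, with junk value \<open>0\<close> if it is not square integrable; this does not
occur when one of the factors is in \<open>Linf\<close>.\<close>

lift_definition L2_mult :: "L2 \<Rightarrow> L2 \<Rightarrow> L2"  (infixl "*\<^sub>L" 70) is
  "\<lambda>f g. if sq_integrable (\<lambda>z. f z * g z) then (\<lambda>z. f z * g z) else (\<lambda>z. 0)"
proof -
  fix f f' g g' :: "complex \<Rightarrow> complex"
  assume f: "sq_integrable f \<and> sq_integrable f' \<and> (AE z in circle_measure. f z = f' z)"
    and g: "sq_integrable g \<and> sq_integrable g' \<and> (AE z in circle_measure. g z = g' z)"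
  have AE: "AE z in circle_measure. f z * g z = f' z * g' z"
    using f g by (auto elim: eventually_elim2)
  have meas: "(\<lambda>z. f z * g z) \<in> borel_measurable circle_measure"
    "(\<lambda>z. f' z * g' z) \<in> borel_measurable circle_measure"
    using f g by (auto simp: sq_integrable_def)
  have "integrable circle_measure (\<lambda>z. (cmod (f z * g z))\<^sup>2) \<longleftrightarrow>
      integrable circle_measure (\<lambda>z. (cmod (f' z * g' z))\<^sup>2)"
    by (rule integrable_cong_AE) (use AE meas in \<open>auto elim: eventually_mono\<close>)
  then have "sq_integrable (\<lambda>z. f z * g z) \<longleftrightarrow> sq_integrable (\<lambda>z. f' z * g' z)"
    using meas by (simp add: sq_integrable_def)
  moreover have "sq_integrable (\<lambda>z. 0)"
    by (simp add: sq_integrable_def)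
  ultimately show "?thesis f f' g g'"
    using AE by auto
qed

lift_definition zpow :: "int \<Rightarrow> L2" is "\<lambda>n z. z powi n"
  subgoal for n
  proof -
    have "(\<lambda>z::complex. z powi n) \<in> borel_measurable borel"
      by (cases "n \<ge> 0") (simp_all add: power_int_def)
    moreover have "AE z in circle_measure. cmod (z powi n) \<le> 1"
      using AE_norm_circle_measure by eventually_elim (simp add: norm_power_int)
    ultimately show ?thesis
      by (auto intro: sq_integrable_bounded)
  qed
  done

text \<open>\<open>cinner f (zpow n)\<close> is the \<open>n\<close>-th Fourier coefficient of \<open>f\<close>.\<close>

definition H2 :: "L2 set" where
  "H2 = {f. \<forall>n<0. cinner f (zpow n) = 0}"

definition Hinf :: "L2 set" where
  "Hinf = H2 \<inter> Linf"

lift_definition unimodular :: "L2 \<Rightarrow> bool" is "\<lambda>f. AE z in circle_measure. cmod (f z) = 1"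
  by (auto elim: eventually_elim2)

definition inner_function :: "L2 \<Rightarrow> bool" where
  "inner_function \<theta> \<longleftrightarrow> \<theta> \<in> Hinf \<and> unimodular \<theta>"

text \<open>The constant functions are the multiples of \<open>zpow 0\<close>.\<close>

definition nonconstant :: "L2 \<Rightarrow> bool" where
  "nonconstant \<theta> \<longleftrightarrow> (\<nexists>c. \<theta> = c *\<^sub>C zpow 0)"

definition model_space :: "L2 \<Rightarrow> L2 set" where
  "model_space \<theta> = H2 \<inter> orth_compl ((*\<^sub>L) \<theta> ` H2)"

definition model_perp :: "L2 \<Rightarrow> L2 set" where
  "model_perp \<theta> = orth_compl (model_space \<theta>)"

section \<open>Asymmetric dual truncated Toeplitz operators\<close>

text \<open>\<open>dual_toeplitz_ext \<theta> \<alpha> \<phi> T\<close>: the densely defined map \<open>f \<mapsto> P\<^sub>\<alpha>\<^sup>\<bottom>(\<phi> f)\<close> extends to the bounded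
operator \<open>T\<close>.\<close>

definition dual_toeplitz_ext :: "L2 \<Rightarrow> L2 \<Rightarrow> L2 \<Rightarrow> (L2 \<Rightarrow> L2) \<Rightarrow> bool" where
  "dual_toeplitz_ext \<theta> \<alpha> \<phi> T \<longleftrightarrow> T \<in> bounded_ops (model_perp \<theta>) (model_perp \<alpha>) \<and>
     (\<forall>f \<in> model_perp \<theta> \<inter> Linf. T f = orth_proj (model_perp \<alpha>) (\<phi> *\<^sub>L f))"

definition dual_toeplitz :: "L2 \<Rightarrow> L2 \<Rightarrow> L2 \<Rightarrow> L2 \<Rightarrow> L2" where
  "dual_toeplitz \<theta> \<alpha> \<phi> = (THE T. dual_toeplitz_ext \<theta> \<alpha> \<phi> T)"

definition dual_toeplitz_ops :: "L2 \<Rightarrow> L2 \<Rightarrow> (L2 \<Rightarrow> L2) set" where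
  "dual_toeplitz_ops \<theta> \<alpha> = {T. \<exists>\<phi>. dual_toeplitz_ext \<theta> \<alpha> \<phi> T}"

definition analytic_dual_toeplitz_ops :: "L2 \<Rightarrow> L2 \<Rightarrow> (L2 \<Rightarrow> L2) set" where
  "analytic_dual_toeplitz_ops \<theta> \<alpha> = dual_toeplitz \<theta> \<alpha> ` Hinf"

text \<open>The case distinction only serves to make the map well defined on \<open>L2\<close> for arbitrary \<open>h\<close>; it
is used for integrable \<open>h\<close>.\<close>

lift_definition Linf_L1_pairing :: "(complex \<Rightarrow> complex) \<Rightarrow> L2 \<Rightarrow> complex" is
  "\<lambda>h \<phi>. if h \<in> borel_measurable circle_measure then LINT z|circle_measure. \<phi> z * h z else 0"
  by (auto intro!: integral_cong_AE elim: eventually_mono)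

definition Linf_weak_star :: "L2 topology" where
  "Linf_weak_star =
     weak_topology_on Linf {Linf_L1_pairing h | h. integrable circle_measure h}"

end

theory Submission
  imports Defs
begin

text \<open>
Let \<open>\<theta>\<close> and \<open>\<alpha>\<close> be nonconstant inner functions, and let \<open>D \<phi>\<close> be the dual truncated Toeplitz operator
with symbol \<open>\<phi>\<close>. The complement of \<open>K\<^sub>\<theta>\<close> is \<open>\<theta> H\<^sup>2 \<oplus> coH2\<close>, where \<open>coH2\<close> is the orthogonal
complement of \<open>H\<^sup>2\<close> in \<open>L\<^sup>2\<close>, so both spaces contain \<open>coH2\<close>; and multiplication by a high power of
\<open>z\<^sup>-\<^sup>1\<close> moves every trigonometric polynomial into \<open>coH2\<close>. This has three consequences.

First, \<open>\<langle>D \<phi> (z\<^sup>-\<^sup>N p), z\<^sup>-\<^sup>N q\<rangle> = \<langle>\<phi> p, q\<rangle>\<close> for trigonometric polynomials and large \<open>N\<close>, so the norm of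
\<open>D \<phi>\<close> bounds the multiplication by \<open>\<phi>\<close>, and \<open>\<phi> \<mapsto> D \<phi>\<close> is isometric (\<open>symbol_bound\<close>). It is weak*
continuous since \<open>\<langle>D \<phi>, \<Sum> f\<^sub>n \<otimes> g\<^sub>n\<rangle>\<close> is the integral of \<open>\<phi>\<close> against the integrable function
\<open>\<Sum> f\<^sub>n g\<^sub>n\<^sup>*\<close> (\<open>pairing_toeplitz_L1\<close>).

Second, every integrable \<open>h\<close> is a sum \<open>f\<^sub>1 g\<^sub>1\<^sup>* + f\<^sub>2 g\<^sub>2\<^sup>*\<close> with \<open>f\<^sub>1, f\<^sub>2\<close> in the first and \<open>g\<^sub>1, g\<^sub>2\<close> in
the second space, and with \<open>\<parallel>f\<^sub>1\<parallel> \<parallel>g\<^sub>1\<parallel> + \<parallel>f\<^sub>2\<parallel> \<parallel>g\<^sub>2\<parallel>\<close> as close to \<open>\<parallel>h\<parallel>\<^sub>1\<close> as desired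
(\<open>L1_factorization\<close>). By a theorem of Szego (\<open>analytic_modulus_exists\<close>) there is \<open>b\<close> in \<open>H\<^sup>2\<close> with
\<open>|b|\<^sup>2\<close> equal to \<open>|h|\<close> where the latter is not very small. Put \<open>s = h / b\<close>. The component \<open>k\<close> of
\<open>z\<^sup>-\<^sup>N s\<close> in \<open>K\<^sub>\<theta>\<close> is small for large \<open>N\<close>, and \<open>h = z\<^sup>N b (z\<^sup>-\<^sup>N s - k) + (z\<^sup>N \<theta> b) (\<theta>\<^sup>* k)\<close>, where the
conjugates of \<open>z\<^sup>N b\<close> and \<open>z\<^sup>N \<theta> b\<close> as well as \<open>\<theta>\<^sup>* k\<close> lie in \<open>coH2\<close>. Since weak* continuous functionals
on Toeplitz operators are given by integrable functions, they are given by operators of rank two; with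
the bound on the trace norm (\<open>trace_norm_rank_two_le\<close>) this is the property \<open>A\<^sub>1\<^sub>/\<^sub>2(1)\<close>.

Third, if \<open>\<langle>T f, g\<rangle>\<close> depends only on the product \<open>f g\<^sup>*\<close>, then \<open>T\<close> is a Toeplitz operator
(\<open>toeplitz_if_product_dependent\<close>). This condition says that \<open>T\<close> annihilates certain operators of
rank two, so the space of all Toeplitz operators is weak* closed and equal to the annihilator of the
operators of rank at most two that annihilate it.

The reflexivity of a weak* closed subspace \<open>S\<close> follows: an operator in the annihilator of the
annihilators of rank at most two is Toeplitz by the third point, and if it were not in \<open>S\<close>, a weak*
continuous functional would separate it from \<open>S\<close>, which is of rank two by the second point. The
operators with analytic symbols are cut out by the vanishing of the negative Fourier coefficients of
the symbol, and these are weak* continuous.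
\<close>

section \<open>Hilbert spaces\<close>

lemma cinner_add_right: "cinner x (y + z) = cinner x y + cinner x z"
  by (metis cinner_commute cinner_add_left complex_cnj_add)

lemma cinner_scaleC_right: "cinner x (c *\<^sub>C y) = cnj c * cinner x y"
  by (metis cinner_commute cinner_scaleC_left complex_cnj_mult)

lemma cinner_zero_left [simp]: "cinner 0 x = 0"
  using cinner_add_left[of 0 0 x] by simp

lemma cinner_zero_right [simp]: "cinner x 0 = 0"
  using cinner_add_right[of x 0 0] by simp

lemma cinner_minus_left: "cinner (- x) y = - cinner x y"
  using cinner_add_left[of "- x" x y] by (simp add: eq_neg_iff_add_eq_0)

lemma cinner_minus_right: "cinner x (- y) = - cinner x y"
  by (metis cinner_commute cinner_minus_left complex_cnj_minus)

lemma cinner_diff_left: "cinner (x - y) z = cinner x z - cinner y z"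
  using cinner_add_left[of x "- y" z] by (simp add: cinner_minus_left)

lemma cinner_diff_right: "cinner x (y - z) = cinner x y - cinner x z"
  using cinner_add_right[of x y "- z"] by (simp add: cinner_minus_right)

lemma cinner_sum_left: "cinner (sum f I) y = (\<Sum>i\<in>I. cinner (f i) y)"
  by (induction I rule: infinite_finite_induct) (auto simp: cinner_add_left)

lemma cinner_sum_right: "cinner y (sum f I) = (\<Sum>i\<in>I. cinner y (f i))"
  by (induction I rule: infinite_finite_induct) (auto simp: cinner_add_right)

lemma scaleC_zero_right [simp]: "c *\<^sub>C 0 = (0::'a::complex_inner)"
  by (rule complex_vector.scale_zero_right)

lemma scaleC_zero_left [simp]: "0 *\<^sub>C x = (0::'a::complex_inner)"
  by (rule complex_vector.scale_zero_left)

lemma scaleC_one' [simp]: "1 *\<^sub>C x = (x::'a::complex_inner)"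
  by (rule scaleC_one)

lemma scaleC_diff_right: "c *\<^sub>C (x - y) = c *\<^sub>C x - c *\<^sub>C (y::'a::complex_inner)"
  by (rule complex_vector.scale_right_diff_distrib)

lemma scaleC_minus1: "(- 1) *\<^sub>C x = - (x::'a::complex_inner)"
  by (simp add: complex_vector.scale_minus_left)

lemma norm_scaleC: "norm (c *\<^sub>C x) = cmod c * norm (x::'a::complex_inner)"
proof -
  have "complex_of_real ((norm (c *\<^sub>C x))\<^sup>2) = (c * cnj c) * complex_of_real ((norm x)\<^sup>2)"
    by (metis cinner_self cinner_scaleC_left cinner_scaleC_right mult.assoc)
  also have "\<dots> = complex_of_real ((cmod c * norm x)\<^sup>2)"
    by (simp add: complex_norm_square[symmetric] power_mult_distrib)
  finally have "(norm (c *\<^sub>C x))\<^sup>2 = (cmod c * norm x)\<^sup>2"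
    using of_real_eq_iff by blast
  then show ?thesis by (simp add: power2_eq_iff_nonneg)
qed

lemma norm_sq_cinner: "(norm x)\<^sup>2 = Re (cinner x x)"
  by (simp add: cinner_self)

lemma cinner_self_eq_0 [simp]: "cinner x x = 0 \<longleftrightarrow> x = 0"
  by (simp add: cinner_self)

lemma norm_add_sq: "(norm (x + y))\<^sup>2 = (norm x)\<^sup>2 + (norm y)\<^sup>2 + 2 * Re (cinner x y)"
proof -
  have "Re (cinner y x) = Re (cinner x y)" by (subst cinner_commute) simp
  then show ?thesis by (simp add: norm_sq_cinner cinner_add_left cinner_add_right)
qed

lemma norm_diff_sq: "(norm (x - y))\<^sup>2 = (norm x)\<^sup>2 + (norm y)\<^sup>2 - 2 * Re (cinner x y)"
  using norm_add_sq[of x "- y"] by (simp add: cinner_minus_right)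

lemma norm_add_sq_orth: "cinner x y = 0 \<Longrightarrow> (norm (x + y))\<^sup>2 = (norm x)\<^sup>2 + (norm y)\<^sup>2"
  by (simp add: norm_add_sq)

lemma parallelogram_law:
  "(norm (x - y))\<^sup>2 + (norm (x + y))\<^sup>2 = 2 * (norm x)\<^sup>2 + 2 * (norm (y::'a::complex_inner))\<^sup>2"
  by (simp add: norm_add_sq norm_diff_sq)

lemma norm_cinner_le: "cmod (cinner x y) \<le> norm x * norm y"
proof (cases "y = 0")
  case False
  then have ny: "norm y > 0" by simp
  define c where "c = cinner x y / complex_of_real ((norm y)\<^sup>2)"
  have o: "cinner (x - c *\<^sub>C y) (c *\<^sub>C y) = 0"
    using ny by (simp add: cinner_diff_left cinner_scaleC_left cinner_scaleC_right cinner_self c_def)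
  have "(norm x)\<^sup>2 = (norm (x - c *\<^sub>C y))\<^sup>2 + (norm (c *\<^sub>C y))\<^sup>2"
    using norm_add_sq_orth[OF o] by simp
  then have "(norm (c *\<^sub>C y))\<^sup>2 \<le> (norm x)\<^sup>2" by simp
  then have "norm (c *\<^sub>C y) \<le> norm x" by (simp add: power2_le_iff_abs_le)
  moreover have "norm (c *\<^sub>C y) = cmod (cinner x y) / norm y"
    using ny by (simp add: norm_scaleC c_def norm_divide power2_eq_square norm_mult)
  ultimately show ?thesis using ny by (simp add: field_simps)
qed simp

lemma bounded_linear_cinner_left: "bounded_linear (\<lambda>x. cinner x y)"
  by (rule bounded_linear_intro[where K = "norm y"])
    (auto simp: cinner_add_left scaleR_eq_scaleC cinner_scaleC_left norm_cinner_le scaleR_conv_of_real)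

lemma bounded_linear_cinner_right: "bounded_linear (\<lambda>x. cinner y x)"
  by (rule bounded_linear_intro[where K = "norm y"])
    (auto simp: cinner_add_right scaleR_eq_scaleC cinner_scaleC_right mult.commute scaleR_conv_of_real
      intro: order_trans[OF norm_cinner_le])

lemmas continuous_on_cinner_left = bounded_linear.continuous_on[OF bounded_linear_cinner_left]

text \<open>The constant \<open>csubspace\<close> is purely algebraic; Hilbert space arguments need closed subspaces.\<close>

definition closed_csubspace :: "'a::complex_inner set \<Rightarrow> bool" where
  "closed_csubspace M \<longleftrightarrow> 0 \<in> M \<and> (\<forall>x\<in>M. \<forall>y\<in>M. x + y \<in> M) \<and> (\<forall>c. \<forall>x\<in>M. c *\<^sub>C x \<in> M) \<and> closed M"

lemma closed_csubspaceD:
  assumes "closed_csubspace M"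
  shows "0 \<in> M" and "x \<in> M \<Longrightarrow> y \<in> M \<Longrightarrow> x + y \<in> M" and "x \<in> M \<Longrightarrow> c *\<^sub>C x \<in> M"
    and "x \<in> M \<Longrightarrow> y \<in> M \<Longrightarrow> x - y \<in> M" and "closed M"
proof -
  show *: "0 \<in> M" "\<And>x y. x \<in> M \<Longrightarrow> y \<in> M \<Longrightarrow> x + y \<in> M" "\<And>x c. x \<in> M \<Longrightarrow> c *\<^sub>C x \<in> M" "closed M"
    using assms by (auto simp: closed_csubspace_def)
  show "x \<in> M \<Longrightarrow> y \<in> M \<Longrightarrow> x - y \<in> M"
    using *(2)[of x "(- 1) *\<^sub>C y"] *(3)[of y "- 1"] by (simp add: scaleC_minus1)
qed

lemma closed_csubspace_orth_compl: "closed_csubspace (orth_compl X)"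
proof -
  have "closed (orth_compl X)"
  proof -
    have "orth_compl X = (\<Inter>y\<in>X. {x. cinner x y = 0})" by (auto simp: orth_compl_def)
    moreover have "closed {x. cinner x y = 0}" for y :: 'a
      by (intro closed_Collect_eq continuous_on_cinner_left continuous_intros)
    ultimately show ?thesis by auto
  qed
  then show ?thesis
    by (auto simp: closed_csubspace_def orth_compl_def cinner_add_left cinner_scaleC_left)
qed

lemma closed_csubspace_Int:
  "closed_csubspace A \<Longrightarrow> closed_csubspace B \<Longrightarrow> closed_csubspace (A \<inter> B)"
  by (auto simp: closed_csubspace_def)

lemma orth_compl_antimono: "A \<subseteq> B \<Longrightarrow> orth_compl B \<subseteq> orth_compl A"
  by (auto simp: orth_compl_def)

lemma orth_complD: "x \<in> orth_compl M \<Longrightarrow> y \<in> M \<Longrightarrow> cinner x y = 0"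
  by (simp add: orth_compl_def)

lemma orth_complD': "x \<in> orth_compl M \<Longrightarrow> y \<in> M \<Longrightarrow> cinner y x = 0"
  by (subst cinner_commute) (simp add: orth_compl_def)

text \<open>The projection theorem. A minimising sequence for the distance to \<open>M\<close> is Cauchy by the
parallelogram law, and at the nearest point the error is orthogonal to \<open>M\<close> because subtracting a
multiple of an element of \<open>M\<close> cannot shorten it.\<close>

lemma orth_decomp_exists:
  fixes M :: "'a::{complex_inner, complete_space} set"
  assumes M: "closed_csubspace M"
  obtains y where "y \<in> M" "x - y \<in> orth_compl M"
proof -
  note Md = closed_csubspaceD[OF M]
  define d where "d = (INF y\<in>M. (norm (x - y))\<^sup>2)"
  have bdd: "bdd_below ((\<lambda>y. (norm (x - y))\<^sup>2) ` M)" by (rule bdd_belowI[of _ 0]) auto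
  have d_le: "d \<le> (norm (x - y))\<^sup>2" if "y \<in> M" for y
    unfolding d_def by (rule cINF_lower[OF bdd that])
  have "\<exists>y\<in>M. (norm (x - y))\<^sup>2 < d + inverse (real (Suc n))" for n
  proof -
    have "(INF y\<in>M. (norm (x - y))\<^sup>2) < d + inverse (real (Suc n))" by (simp add: d_def)
    moreover have "M \<noteq> {}" using Md(1) by blast
    ultimately show ?thesis by (simp add: cINF_less_iff bdd)
  qed
  then obtain Y where Y: "\<And>n. Y n \<in> M" "\<And>n. (norm (x - Y n))\<^sup>2 < d + inverse (real (Suc n))"
    by metis
  have par: "(norm (Y m - Y n))\<^sup>2 \<le> 2 * inverse (real (Suc m)) + 2 * inverse (real (Suc n))" for m n
  proof -
    let ?a = "x - Y m" and ?b = "x - Y n"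
    have "(norm (?a - ?b))\<^sup>2 + (norm (?a + ?b))\<^sup>2 = 2 * (norm ?a)\<^sup>2 + 2 * (norm ?b)\<^sup>2"
      by (rule parallelogram_law)
    moreover have "(norm (?a + ?b))\<^sup>2 \<ge> 4 * d"
    proof -
      have "?a + ?b = 2 *\<^sub>R (x - (1/2) *\<^sub>C (Y m + Y n))"
        by (simp add: scaleR_eq_scaleC scaleC_diff_right scaleC_scaleC)
          (metis scaleR_2 scaleR_eq_scaleC of_real_numeral add_diff_add)
      then have "(norm (?a + ?b))\<^sup>2 = 4 * (norm (x - (1/2) *\<^sub>C (Y m + Y n)))\<^sup>2"
        by (simp add: power_mult_distrib)
      then show ?thesis using d_le[of "(1/2) *\<^sub>C (Y m + Y n)"] Md(2,3) Y(1) by simp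
    qed
    moreover have "norm (?a - ?b) = norm (Y m - Y n)" by (simp add: norm_minus_commute)
    ultimately show ?thesis using Y(2)[of m] Y(2)[of n] by simp
  qed
  have "Cauchy Y"
  proof (rule metric_CauchyI)
    fix e :: real assume "e > 0"
    then obtain N where N: "inverse (real (Suc N)) < e\<^sup>2 / 4"
      using reals_Archimedean[of "e\<^sup>2/4"] by auto
    have "dist (Y m) (Y n) < e" if "m \<ge> N" "n \<ge> N" for m n
    proof -
      have "inverse (real (Suc m)) \<le> inverse (real (Suc N))" "inverse (real (Suc n)) \<le> inverse (real (Suc N))"
        using that by (simp_all add: field_simps)
      then have "(norm (Y m - Y n))\<^sup>2 < e\<^sup>2" using par[of m n] N by linarith
      then show ?thesis using \<open>e > 0\<close> by (simp add: dist_norm power2_less_imp_less)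
    qed
    then show "\<exists>N. \<forall>m\<ge>N. \<forall>n\<ge>N. dist (Y m) (Y n) < e" by blast
  qed
  then obtain y where lim: "Y \<longlonglongrightarrow> y" using Cauchy_convergent convergent_def by blast
  have yM: "y \<in> M" using Md(5) Y(1) lim closed_sequentially by blast
  have "(norm (x - y))\<^sup>2 \<le> d"
  proof (rule LIMSEQ_le)
    show "(\<lambda>n. (norm (x - Y n))\<^sup>2) \<longlonglongrightarrow> (norm (x - y))\<^sup>2" by (intro tendsto_intros lim)
    show "(\<lambda>n. d + inverse (real (Suc n))) \<longlonglongrightarrow> d"
      using tendsto_add[OF tendsto_const LIMSEQ_inverse_real_of_nat, of d] by simp
    show "\<exists>N. \<forall>n\<ge>N. (norm (x - Y n))\<^sup>2 \<le> d + inverse (real (Suc n))" using Y(2) less_imp_le by blast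
  qed
  have "cinner (x - y) u = 0" if u: "u \<in> M" for u
  proof (rule ccontr)
    let ?r = "cinner (x - y) u"
    assume nz: "?r \<noteq> 0"
    then have "norm u > 0" by auto
    define c where "c = ?r / complex_of_real ((norm u)\<^sup>2)"
    have o: "cinner (x - y - c *\<^sub>C u) (c *\<^sub>C u) = 0"
      using \<open>norm u > 0\<close> by (simp add: cinner_diff_left cinner_scaleC_left cinner_scaleC_right cinner_self c_def)
    have "(norm (x - y))\<^sup>2 = (norm (x - y - c *\<^sub>C u))\<^sup>2 + (norm (c *\<^sub>C u))\<^sup>2"
      using norm_add_sq_orth[OF o] by simp
    moreover have "norm (c *\<^sub>C u) > 0" using \<open>norm u > 0\<close> nz by (simp add: c_def norm_scaleC)
    moreover have "d \<le> (norm (x - y - c *\<^sub>C u))\<^sup>2"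
      using d_le[of "y + c *\<^sub>C u"] Md(2,3) yM u by (simp add: diff_diff_eq)
    moreover have "(norm (c *\<^sub>C u))\<^sup>2 > 0" using \<open>norm (c *\<^sub>C u) > 0\<close> by simp
    ultimately show False using \<open>(norm (x - y))\<^sup>2 \<le> d\<close> by linarith
  qed
  then have "x - y \<in> orth_compl M" by (simp add: orth_compl_def)
  with yM that show ?thesis by blast
qed

lemma orth_decomp_unique:
  assumes "closed_csubspace M" "y \<in> M" "x - y \<in> orth_compl M" "y' \<in> M" "x - y' \<in> orth_compl M"
  shows "y = y'"
proof -
  have "y - y' \<in> M" using closed_csubspaceD(4)[OF assms(1)] assms by blast
  moreover have "y - y' \<in> orth_compl M"
    using closed_csubspaceD(4)[OF closed_csubspace_orth_compl assms(5,3)] by simp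
  ultimately have "cinner (y - y') (y - y') = 0" by (simp add: orth_compl_def)
  then show ?thesis by simp
qed

lemma orth_proj_props:
  fixes M :: "'a::{complex_inner, complete_space} set"
  assumes M: "closed_csubspace M"
  shows orth_proj_in: "orth_proj M x \<in> M" and orth_proj_diff: "x - orth_proj M x \<in> orth_compl M"
proof -
  obtain y where y: "y \<in> M" "x - y \<in> orth_compl M" using orth_decomp_exists[OF M] .
  have "orth_proj M x \<in> M \<and> x - orth_proj M x \<in> orth_compl M"
    unfolding orth_proj_def
    by (rule theI[of _ y]) (use y orth_decomp_unique[OF M] in auto)
  then show "orth_proj M x \<in> M" "x - orth_proj M x \<in> orth_compl M" by auto
qed

lemma orth_proj_eqI:
  fixes M :: "'a::{complex_inner, complete_space} set"
  assumes "closed_csubspace M" "y \<in> M" "x - y \<in> orth_compl M"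
  shows "orth_proj M x = y"
  using orth_decomp_unique orth_proj_in orth_proj_diff assms by blast

context
  fixes M :: "'a::{complex_inner, complete_space} set"
  assumes M: "closed_csubspace M"
begin

lemma orth_proj_add: "orth_proj M (x + y) = orth_proj M x + orth_proj M y"
proof (rule orth_proj_eqI[OF M])
  show "orth_proj M x + orth_proj M y \<in> M" using M closed_csubspaceD(2) orth_proj_in by blast
  have "x + y - (orth_proj M x + orth_proj M y) = (x - orth_proj M x) + (y - orth_proj M y)" by simp
  then show "x + y - (orth_proj M x + orth_proj M y) \<in> orth_compl M"
    using closed_csubspaceD(2)[OF closed_csubspace_orth_compl orth_proj_diff[OF M] orth_proj_diff[OF M]]
    by presburger
qed

lemma orth_proj_scaleC: "orth_proj M (c *\<^sub>C x) = c *\<^sub>C orth_proj M x"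
proof (rule orth_proj_eqI[OF M])
  show "c *\<^sub>C orth_proj M x \<in> M" using M closed_csubspaceD(3) orth_proj_in by blast
  show "c *\<^sub>C x - c *\<^sub>C orth_proj M x \<in> orth_compl M"
    using closed_csubspaceD(3)[OF closed_csubspace_orth_compl orth_proj_diff[OF M], of c x]
    by (simp add: scaleC_diff_right)
qed

lemma cinner_orth_proj:
  assumes "y \<in> M" shows "cinner (orth_proj M x) y = cinner x y" "cinner y (orth_proj M x) = cinner y x"
  using orth_complD[OF orth_proj_diff[OF M] assms, of x] orth_complD'[OF orth_proj_diff[OF M] assms, of x]
  by (simp_all add: cinner_diff_left cinner_diff_right)

lemma norm_orth_proj_le: "norm (orth_proj M x) \<le> norm x"
proof -
  have "cinner (orth_proj M x) (x - orth_proj M x) = 0"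
    using orth_complD'[OF orth_proj_diff[OF M] orth_proj_in[OF M]] .
  from norm_add_sq_orth[OF this] have "(norm (orth_proj M x))\<^sup>2 \<le> (norm x)\<^sup>2" by simp
  then show ?thesis by (simp add: power2_le_iff_abs_le)
qed

text \<open>The form in which totality is used: a closed subspace of \<open>H\<close> that contains a total subset
of \<open>H\<close> is all of \<open>H\<close>.\<close>

lemma closed_csubspace_total:
  assumes "closed_csubspace H" "X \<subseteq> M" "M \<subseteq> H" "H \<inter> orth_compl X \<subseteq> {0}"
  shows "M = H"
proof
  show "H \<subseteq> M"
  proof
    fix x assume x: "x \<in> H"
    have "x - orth_proj M x \<in> H \<inter> orth_compl X"
      using x assms orth_proj_in[OF M] orth_proj_diff[OF M] closed_csubspaceD(4)[OF assms(1)]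
        orth_compl_antimono[OF assms(2)] by blast
    then have "x - orth_proj M x = 0" using assms(4) by blast
    then show "x \<in> M" using orth_proj_in[OF M, of x] by simp
  qed
qed (fact assms)

end

section \<open>Orthonormal bases\<close>

definition orthonormal :: "'a::complex_inner set \<Rightarrow> bool" where
  "orthonormal E \<longleftrightarrow> (\<forall>e\<in>E. \<forall>e'\<in>E. cinner e e' = (if e = e' then 1 else 0))"

lemma orthonormalD:
  "orthonormal E \<Longrightarrow> e \<in> E \<Longrightarrow> e' \<in> E \<Longrightarrow> cinner e e' = (if e = e' then 1 else 0)"
  by (simp add: orthonormal_def)

text \<open>A maximal orthonormal set is a basis, because a nonzero vector orthogonal to it could be
normalised and added.\<close>

lemma is_onb_exists:
  fixes K :: "'a::complex_inner set"
  assumes K: "closed_csubspace K"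
  shows "\<exists>E. is_onb K E"
proof -
  have "\<exists>E\<in>{E. E \<subseteq> K \<and> orthonormal E}. \<forall>X\<in>{E. E \<subseteq> K \<and> orthonormal E}. E \<subseteq> X \<longrightarrow> X = E"
  proof (rule subset_Zorn')
    fix C assume C: "subset.chain {E. E \<subseteq> K \<and> orthonormal E} C"
    have "cinner e e' = (if e = e' then 1 else 0)" if ee: "e \<in> \<Union>C" "e' \<in> \<Union>C" for e e'
    proof -
      obtain A B where AB: "A \<in> C" "e \<in> A" "B \<in> C" "e' \<in> B" using ee by blast
      then have "A \<subseteq> B \<or> B \<subseteq> A" using C by (auto simp: subset_chain_def)
      then obtain D where "D \<in> C" "e \<in> D" "e' \<in> D" using AB by blast
      then have "orthonormal D" using C by (auto simp: subset_chain_def)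
      with \<open>e \<in> D\<close> \<open>e' \<in> D\<close> show ?thesis by (simp add: orthonormal_def)
    qed
    then show "\<Union>C \<in> {E. E \<subseteq> K \<and> orthonormal E}"
      using C unfolding orthonormal_def subset_chain_def by auto
  qed
  then obtain E where "E \<in> {E. E \<subseteq> K \<and> orthonormal E}"
    and maxE: "\<forall>X\<in>{E. E \<subseteq> K \<and> orthonormal E}. E \<subseteq> X \<longrightarrow> X = E" by (elim bexE)
  then have E: "E \<subseteq> K" "orthonormal E" by simp_all
  have max: "X = E" if "X \<subseteq> K" "orthonormal X" "E \<subseteq> X" for X
    using maxE that by simp
  have "x = 0" if x: "x \<in> K" "x \<in> orth_compl E" for x
  proof (rule ccontr)
    assume nz: "x \<noteq> 0"
    define u where "u = complex_of_real (inverse (norm x)) *\<^sub>C x"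
    have uu: "cinner u u = 1"
      using nz by (simp add: cinner_self u_def norm_scaleC norm_inverse power_mult_distrib)
    have uo: "cinner u e = 0" "cinner e u = 0" if "e \<in> E" for e
      using orth_complD[OF x(2) that] orth_complD'[OF x(2) that]
      by (simp_all add: u_def cinner_scaleC_left cinner_scaleC_right)
    have "u \<notin> E" using uo(1)[of u] uu by auto
    moreover have "orthonormal (insert u E)"
      using uu uo \<open>u \<notin> E\<close> orthonormalD[OF E(2)] unfolding orthonormal_def
      by (metis insert_iff)
    moreover have "u \<in> K" using closed_csubspaceD(3)[OF K x(1)] by (simp add: u_def)
    ultimately show False using max[of "insert u E"] E(1) by auto
  qed
  moreover have "0 \<in> K" "0 \<in> orth_compl E"
    using closed_csubspaceD(1)[OF K] closed_csubspaceD(1)[OF closed_csubspace_orth_compl] by auto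
  ultimately have "K \<inter> orth_compl E = {0}" by auto
  then have "is_onb K E" using E by (simp add: is_onb_def orthonormal_def)
  then show ?thesis ..
qed

lemma norm_sq_orthonormal_sum:
  assumes "orthonormal E" "finite F" "F \<subseteq> E"
  shows "(norm (\<Sum>e\<in>F. c e *\<^sub>C e))\<^sup>2 = (\<Sum>e\<in>F. (cmod (c e))\<^sup>2)"
proof -
  have "cinner (\<Sum>e\<in>F. c e *\<^sub>C e) (\<Sum>e\<in>F. c e *\<^sub>C e) =
    (\<Sum>e\<in>F. \<Sum>e'\<in>F. c e * (cnj (c e') * (if e = e' then 1 else 0)))"
    unfolding cinner_sum_left cinner_sum_right
    by (intro sum.cong refl)
      (simp add: cinner_scaleC_left cinner_scaleC_right orthonormalD[OF assms(1)] subsetD[OF assms(3)])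
  also have "\<dots> = (\<Sum>e\<in>F. c e * cnj (c e))"
    by (intro sum.cong refl) (simp add: assms(2) if_distrib sum.delta cong: if_cong)
  also have "\<dots> = complex_of_real (\<Sum>e\<in>F. (cmod (c e))\<^sup>2)"
    by (simp add: complex_norm_square[symmetric])
  finally show ?thesis by (simp add: norm_sq_cinner)
qed

lemma orthonormal_best_approx:
  assumes E: "orthonormal E" and F: "finite F" "F \<subseteq> E"
  shows "(norm (x - (\<Sum>e\<in>F. c e *\<^sub>C e)))\<^sup>2 =
    (norm (x - (\<Sum>e\<in>F. cinner x e *\<^sub>C e)))\<^sup>2 + (\<Sum>e\<in>F. (cmod (cinner x e - c e))\<^sup>2)"
proof -
  let ?p = "\<Sum>e\<in>F. cinner x e *\<^sub>C e"
  let ?d = "\<Sum>e\<in>F. (cinner x e - c e) *\<^sub>C e"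
  have "cinner (x - ?p) e = 0" if "e \<in> F" for e
  proof -
    have "cinner ?p e = (\<Sum>e'\<in>F. cinner x e' * (if e' = e then 1 else 0))"
      unfolding cinner_sum_left
      by (intro sum.cong refl)
        (simp add: cinner_scaleC_left orthonormalD[OF E] subsetD[OF F(2)] that)
    also have "\<dots> = cinner x e" using that F(1) by (simp add: if_distrib sum.delta cong: if_cong)
    finally show ?thesis by (simp add: cinner_diff_left)
  qed
  then have o: "cinner (x - ?p) ?d = 0" by (simp add: cinner_sum_right cinner_scaleC_right)
  have eq: "x - (\<Sum>e\<in>F. c e *\<^sub>C e) = (x - ?p) + ?d"
    by (simp add: complex_vector.scale_left_diff_distrib sum_subtractf)
  show ?thesis unfolding eq norm_add_sq_orth[OF o] norm_sq_orthonormal_sum[OF E F] ..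
qed

lemma bessel_finite:
  assumes "orthonormal E" "finite F" "F \<subseteq> E"
  shows "(\<Sum>e\<in>F. (cmod (cinner x e))\<^sup>2) \<le> (norm x)\<^sup>2"
  using orthonormal_best_approx[OF assms, of x "\<lambda>_. 0"] by simp

text \<open>The vectors that are limits of their Fourier sums form a closed subspace containing \<open>E\<close>, hence
everything; that it is a subspace, and that convergence along one set implies convergence of the
net, both rest on the fact that a Fourier sum is the best approximation with its index set.\<close>

lemma onb_expansion:
  fixes K :: "'a::{complex_inner, complete_space} set"
  assumes K: "closed_csubspace K" and E: "is_onb K E" and x: "x \<in> K"
  shows "((\<lambda>e. cinner x e *\<^sub>C e) has_sum x) E"
proof -
  have EK: "E \<subseteq> K" and oE: "orthonormal E" and tot: "K \<inter> orth_compl E = {0}"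
    using E by (auto simp: is_onb_def orthonormal_def)
  define M where "M = {x \<in> K. \<forall>\<epsilon>>0. \<exists>F. finite F \<and> F \<subseteq> E \<and> norm (x - (\<Sum>e\<in>F. cinner x e *\<^sub>C e)) < \<epsilon>}"
  have M_appr: "\<exists>F. finite F \<and> F \<subseteq> E \<and> norm (x - (\<Sum>e\<in>F. cinner x e *\<^sub>C e)) < \<epsilon>"
    if "x \<in> M" "\<epsilon> > 0" for x \<epsilon>
    using that by (simp add: M_def)
  have closeI: "x \<in> M" if x: "x \<in> K" and appr: "\<And>\<epsilon>. \<epsilon> > 0 \<Longrightarrow> \<exists>F c. finite F \<and> F \<subseteq> E \<and> norm (x - (\<Sum>e\<in>F. c e *\<^sub>C e)) < \<epsilon>" for x
  proof -
    have "\<exists>F. finite F \<and> F \<subseteq> E \<and> norm (x - (\<Sum>e\<in>F. cinner x e *\<^sub>C e)) < \<epsilon>" if e0: "\<epsilon> > 0" for \<epsilon>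
    proof -
      obtain F c where F: "finite F" "F \<subseteq> E" "norm (x - (\<Sum>e\<in>F. c e *\<^sub>C e)) < \<epsilon>"
        using appr[OF e0] by blast
      have "(norm (x - (\<Sum>e\<in>F. cinner x e *\<^sub>C e)))\<^sup>2 \<le> (norm (x - (\<Sum>e\<in>F. c e *\<^sub>C e)))\<^sup>2"
        unfolding orthonormal_best_approx[OF oE F(1,2), of x c] by (simp add: sum_nonneg)
      then have "norm (x - (\<Sum>e\<in>F. cinner x e *\<^sub>C e)) \<le> norm (x - (\<Sum>e\<in>F. c e *\<^sub>C e))"
        by (simp add: power2_le_iff_abs_le)
      then show ?thesis using F by (intro exI[of _ F]) auto
    qed
    then show ?thesis using x by (simp add: M_def)
  qed
  have mono: "norm (x - (\<Sum>e\<in>G. cinner x e *\<^sub>C e)) \<le> norm (x - (\<Sum>e\<in>F. cinner x e *\<^sub>C e))"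
    if "finite G" "G \<subseteq> E" "F \<subseteq> G" for F G x
  proof -
    have "(\<Sum>e\<in>F. cinner x e *\<^sub>C e) = (\<Sum>e\<in>G. (if e \<in> F then cinner x e else 0) *\<^sub>C e)"
      using that by (intro sum.mono_neutral_cong_left) auto
    then have "(norm (x - (\<Sum>e\<in>G. cinner x e *\<^sub>C e)))\<^sup>2 \<le> (norm (x - (\<Sum>e\<in>F. cinner x e *\<^sub>C e)))\<^sup>2"
      using orthonormal_best_approx[OF oE that(1,2), of x "\<lambda>e. if e \<in> F then cinner x e else 0"]
      by (simp add: sum_nonneg)
    then show ?thesis by (simp add: power2_le_iff_abs_le)
  qed
  have "closed_csubspace M"
    unfolding closed_csubspace_def
  proof (intro conjI ballI allI)
    show "0 \<in> M" using closed_csubspaceD(1)[OF K] by (auto simp: M_def)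
    show "x + y \<in> M" if xyM: "x \<in> M" "y \<in> M" for x y
    proof (rule closeI)
      show "x + y \<in> K" using xyM closed_csubspaceD(2)[OF K] by (auto simp: M_def)
      fix \<epsilon> :: real assume "\<epsilon> > 0"
      then have "\<epsilon>/2 > 0" by simp
      from M_appr[OF xyM(1) this] obtain F
        where F: "finite F" "F \<subseteq> E" "norm (x - (\<Sum>e\<in>F. cinner x e *\<^sub>C e)) < \<epsilon>/2" by blast
      from M_appr[OF xyM(2) \<open>\<epsilon>/2 > 0\<close>] obtain G
        where G: "finite G" "G \<subseteq> E" "norm (y - (\<Sum>e\<in>G. cinner y e *\<^sub>C e)) < \<epsilon>/2" by blast
      let ?U = "F \<union> G"
      have "norm ((x - (\<Sum>e\<in>?U. cinner x e *\<^sub>C e)) + (y - (\<Sum>e\<in>?U. cinner y e *\<^sub>C e))) < \<epsilon>/2 + \<epsilon>/2"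
        using mono[of ?U F x] mono[of ?U G y] F G by (intro norm_add_less) auto
      moreover have "(x - (\<Sum>e\<in>?U. cinner x e *\<^sub>C e)) + (y - (\<Sum>e\<in>?U. cinner y e *\<^sub>C e)) =
          x + y - (\<Sum>e\<in>?U. cinner (x + y) e *\<^sub>C e)"
        by (simp add: cinner_add_left scaleC_add_left sum.distrib)
      ultimately show "\<exists>F c. finite F \<and> F \<subseteq> E \<and> norm (x + y - (\<Sum>e\<in>F. c e *\<^sub>C e)) < \<epsilon>"
        using F G by (intro exI[of _ ?U] exI[of _ "\<lambda>e. cinner (x + y) e"]) auto
    qed
    show "c *\<^sub>C x \<in> M" if xM: "x \<in> M" for c x
    proof (rule closeI)
      show "c *\<^sub>C x \<in> K" using xM closed_csubspaceD(3)[OF K] by (auto simp: M_def)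
      fix \<epsilon> :: real assume "\<epsilon> > 0"
      then have "\<epsilon> / (cmod c + 1) > 0" by (simp add: add_nonneg_pos)
      then obtain F where F: "finite F" "F \<subseteq> E" "norm (x - (\<Sum>e\<in>F. cinner x e *\<^sub>C e)) < \<epsilon> / (cmod c + 1)"
        using M_appr[OF xM] by blast
      have "c *\<^sub>C x - (\<Sum>e\<in>F. (c * cinner x e) *\<^sub>C e) = c *\<^sub>C (x - (\<Sum>e\<in>F. cinner x e *\<^sub>C e))"
        by (simp add: scaleC_diff_right complex_vector.scale_sum_right scaleC_scaleC)
      moreover have "cmod c * norm (x - (\<Sum>e\<in>F. cinner x e *\<^sub>C e)) \<le> (cmod c + 1) * norm (x - (\<Sum>e\<in>F. cinner x e *\<^sub>C e))"
        by (intro mult_right_mono) auto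
      moreover have "(cmod c + 1) * norm (x - (\<Sum>e\<in>F. cinner x e *\<^sub>C e)) < \<epsilon>"
        using F(3) add_nonneg_pos[OF norm_ge_zero zero_less_one, of c]
        by (simp add: pos_less_divide_eq mult.commute del: mult_less_cancel_left_pos)
      ultimately show "\<exists>F c'. finite F \<and> F \<subseteq> E \<and> norm (c *\<^sub>C x - (\<Sum>e\<in>F. c' e *\<^sub>C e)) < \<epsilon>"
        using F by (intro exI[of _ F] exI[of _ "\<lambda>e. c * cinner x e"]) (auto simp: norm_scaleC)
    qed
    show "closed M"
      unfolding closed_sequential_limits
    proof (intro allI impI, elim conjE)
      fix X x assume X: "\<forall>n. X n \<in> M" and lim: "X \<longlonglongrightarrow> x"
      show "x \<in> M"
      proof (rule closeI)
        show "x \<in> K" using X lim closed_csubspaceD(5)[OF K] closed_sequentially[of K X x] by (auto simp: M_def)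
        fix \<epsilon> :: real assume "\<epsilon> > 0"
        then obtain n where n: "norm (X n - x) < \<epsilon>/2"
          using LIMSEQ_D[OF lim, of "\<epsilon>/2"] by auto
        obtain F where F: "finite F" "F \<subseteq> E" "norm (X n - (\<Sum>e\<in>F. cinner (X n) e *\<^sub>C e)) < \<epsilon>/2"
          using M_appr[of "X n" "\<epsilon>/2"] X \<open>\<epsilon> > 0\<close> by auto
        have "norm (x - (\<Sum>e\<in>F. cinner (X n) e *\<^sub>C e)) < \<epsilon>"
          using n F(3) norm_triangle_ineq[of "x - X n" "X n - (\<Sum>e\<in>F. cinner (X n) e *\<^sub>C e)"]
          by (simp add: norm_minus_commute)
        then show "\<exists>F c. finite F \<and> F \<subseteq> E \<and> norm (x - (\<Sum>e\<in>F. c e *\<^sub>C e)) < \<epsilon>"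
          using F by blast
      qed
    qed
  qed
  moreover have "E \<subseteq> M"
  proof
    fix e assume "e \<in> E"
    then show "e \<in> M"
      using EK by (intro closeI) (auto intro!: exI[of _ "{e}"] exI[of _ "\<lambda>_. 1"])
  qed
  ultimately have "M = K" using closed_csubspace_total[OF _ K, of M E] tot by (auto simp: M_def)
  then have xM: "x \<in> M" using x by simp
  show ?thesis
    unfolding has_sum_def tendsto_iff eventually_finite_subsets_at_top
  proof (intro allI impI)
    fix \<epsilon> :: real assume "\<epsilon> > 0"
    then obtain F where F: "finite F" "F \<subseteq> E" "norm (x - (\<Sum>e\<in>F. cinner x e *\<^sub>C e)) < \<epsilon>"
      using M_appr[OF xM] by blast
    have "dist (\<Sum>e\<in>Y. cinner x e *\<^sub>C e) x < \<epsilon>" if "finite Y" "F \<subseteq> Y" "Y \<subseteq> E" for Y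
      using le_less_trans[OF mono[OF that(1,3,2), of x] F(3)] by (simp add: dist_norm norm_minus_commute)
    with F show "\<exists>X. finite X \<and> X \<subseteq> E \<and>
        (\<forall>Y. finite Y \<and> X \<subseteq> Y \<and> Y \<subseteq> E \<longrightarrow> dist (\<Sum>e\<in>Y. cinner x e *\<^sub>C e) x < \<epsilon>)"
      by blast
  qed
qed

lemma onb_parseval:
  fixes K :: "'a::{complex_inner, complete_space} set"
  assumes "closed_csubspace K" "is_onb K E" "x \<in> K"
  shows "((\<lambda>e. cinner x e * cinner e y) has_sum cinner x y) E"
  using has_sum_bounded_linear[OF bounded_linear_cinner_left onb_expansion[OF assms], of y]
  by (simp add: comp_def cinner_scaleC_left)

section \<open>Bounded operators and the duality with trace class operators\<close>

lemma bounded_opsD: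
  assumes "T \<in> bounded_ops H K"
  shows "x \<notin> H \<Longrightarrow> T x = 0" and "x \<in> H \<Longrightarrow> T x \<in> K"
    and "x \<in> H \<Longrightarrow> y \<in> H \<Longrightarrow> T (x + y) = T x + T y" and "x \<in> H \<Longrightarrow> T (c *\<^sub>C x) = c *\<^sub>C T x"
  using assms by (auto simp: bounded_ops_def)

lemma bounded_opsI:
  assumes "\<And>x. x \<notin> H \<Longrightarrow> T x = 0" "\<And>x. x \<in> H \<Longrightarrow> T x \<in> K"
    and "\<And>x y. x \<in> H \<Longrightarrow> y \<in> H \<Longrightarrow> T (x + y) = T x + T y"
    and "\<And>c x. x \<in> H \<Longrightarrow> T (c *\<^sub>C x) = c *\<^sub>C T x"
    and "\<And>x. x \<in> H \<Longrightarrow> norm (T x) \<le> C * norm x"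
  shows "T \<in> bounded_ops H K"
  unfolding bounded_ops_def using assms by blast

lemma bounded_ops_bound:
  assumes "T \<in> bounded_ops H K"
  obtains C where "C \<ge> 0" "\<And>x. x \<in> H \<Longrightarrow> norm (T x) \<le> C * norm x"
proof -
  obtain C where C: "\<forall>x\<in>H. norm (T x) \<le> C * norm x" using assms by (auto simp: bounded_ops_def)
  have "norm (T x) \<le> max C 0 * norm x" if "x \<in> H" for x
    using C that by (meson max.cobounded1 mult_right_mono norm_ge_zero order_trans)
  then show ?thesis using that[of "max C 0"] by simp
qed

lemma bounded_ops_zero: "T \<in> bounded_ops H K \<Longrightarrow> closed_csubspace H \<Longrightarrow> T 0 = 0"
  using bounded_opsD(4)[of T H K 0 0] closed_csubspaceD(1)[of H] by simp

lemma bounded_ops_diff: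
  assumes T: "T \<in> bounded_ops H K" and H: "closed_csubspace H" and "x \<in> H" "y \<in> H"
  shows "T (x - y) = T x - T y"
  using bounded_opsD(3)[OF T assms(3) closed_csubspaceD(3)[OF H assms(4)], of "- 1"]
    bounded_opsD(4)[OF T assms(4), of "- 1"]
  by (simp add: scaleC_minus1)

lemma bounded_ops_tendsto:
  assumes T: "T \<in> bounded_ops H K" and H: "closed_csubspace H"
    and X: "\<And>n. X n \<in> H" and lim: "X \<longlonglongrightarrow> x"
  shows "(\<lambda>n. T (X n)) \<longlonglongrightarrow> T x"
proof -
  have x: "x \<in> H" using closed_sequentially[OF closed_csubspaceD(5)[OF H] X lim] .
  obtain C where C: "\<And>x. x \<in> H \<Longrightarrow> norm (T x) \<le> C * norm x" using bounded_ops_bound[OF T] by metis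
  have "(\<lambda>n. C * norm (X n - x)) \<longlonglongrightarrow> 0"
    using tendsto_mult_right_zero[OF tendsto_norm_zero[OF LIM_zero[OF lim]]] .
  then have "(\<lambda>n. T (X n) - T x) \<longlonglongrightarrow> 0"
    by (rule Lim_null_comparison[rotated])
      (use C closed_csubspaceD(4)[OF H X x] in \<open>simp add: bounded_ops_diff[OF T H X x, symmetric]\<close>)
  then show ?thesis by (simp add: LIM_zero_iff)
qed

lemma bounded_ops_sums:
  assumes T: "T \<in> bounded_ops H K" and H: "closed_csubspace H"
    and X: "\<And>n. X n \<in> H" and lim: "X sums x"
  shows "(\<lambda>n. T (X n)) sums T x"
proof -
  have S: "(\<Sum>i<n. X i) \<in> H" "T (\<Sum>i<n. X i) = (\<Sum>i<n. T (X i))" for n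
    by (induction n) (use X closed_csubspaceD(1,2)[OF H] bounded_ops_zero[OF T H] bounded_opsD(3)[OF T] in auto)
  show ?thesis
    using bounded_ops_tendsto[OF T H S(1) lim[unfolded sums_def]] by (simp add: sums_def S(2))
qed

lemma norm_le_op_norm:
  assumes T: "T \<in> bounded_ops H K" and H: "closed_csubspace H" and x: "x \<in> H"
  shows "norm (T x) \<le> op_norm H T * norm x"
proof (cases "x = 0")
  case False
  obtain C where C: "C \<ge> 0" "\<And>x. x \<in> H \<Longrightarrow> norm (T x) \<le> C * norm x" using bounded_ops_bound[OF T] by blast
  have bdd: "bdd_above ((\<lambda>x. norm (T x)) ` {x \<in> H. norm x \<le> 1})"
  proof (rule bdd_aboveI2)
    fix x assume "x \<in> {x \<in> H. norm x \<le> 1}"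
    then show "norm (T x) \<le> C" using C(2)[of x] mult_left_le[of "norm x" C] C(1) by auto
  qed
  define u where "u = complex_of_real (inverse (norm x)) *\<^sub>C x"
  have "u \<in> H" "norm u = 1"
    using False closed_csubspaceD(3)[OF H x] by (simp_all add: u_def norm_scaleC norm_inverse)
  then have "norm (T u) \<le> op_norm H T"
    unfolding op_norm_def by (intro cSUP_upper bdd) auto
  moreover have "norm (T u) = inverse (norm x) * norm (T x)"
    by (simp add: u_def bounded_opsD(4)[OF T x] norm_scaleC norm_inverse)
  ultimately show ?thesis using False by (simp add: field_simps)
qed (simp add: bounded_ops_zero[OF T H])

lemma op_norm_le:
  assumes H: "closed_csubspace H" and C: "C \<ge> 0" "\<And>x. x \<in> H \<Longrightarrow> norm (T x) \<le> C * norm x"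
  shows "op_norm H T \<le> C"
  unfolding op_norm_def
proof (rule cSUP_least)
  show "{x \<in> H. norm x \<le> 1} \<noteq> {}" using closed_csubspaceD(1)[OF H] by auto
  fix x assume "x \<in> {x \<in> H. norm x \<le> 1}"
  then show "norm (T x) \<le> C" using C(2)[of x] mult_left_le[of "norm x" C] C(1) by auto
qed

lemma tensor_seriesD:
  assumes "tensor_series H K t f g"
  shows "f n \<in> H" "g n \<in> K" "summable (\<lambda>n. (norm (f n))\<^sup>2)" "summable (\<lambda>n. (norm (g n))\<^sup>2)"
    and "x \<in> K \<Longrightarrow> (\<lambda>n. cinner x (g n) *\<^sub>C f n) sums t x"
  using assms by (auto simp: tensor_series_def)

lemma prod_le_sum_squares: "a * b \<le> a\<^sup>2 + (b::real)\<^sup>2"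
proof -
  have "0 \<le> (a - b)\<^sup>2" "0 \<le> (a + b)\<^sup>2" by simp_all
  then have "0 \<le> a\<^sup>2 + b\<^sup>2 - 2 * (a * b)" "0 \<le> a\<^sup>2 + b\<^sup>2 + 2 * (a * b)"
    by (simp_all add: power2_eq_square algebra_simps)
  moreover have "0 \<le> a\<^sup>2" "0 \<le> b\<^sup>2" by simp_all
  ultimately show ?thesis by linarith
qed

lemma tensor_series_summable:
  assumes "tensor_series H K t f g"
  shows "summable (\<lambda>n. norm (f n) * norm (g n))"
proof (rule summable_comparison_test'[OF summable_add[OF tensor_seriesD(3,4)[OF assms]]])
  show "norm (norm (f n) * norm (g n)) \<le> (norm (f n))\<^sup>2 + (norm (g n))\<^sup>2" for n
    using prod_le_sum_squares[of "norm (f n)" "norm (g n)"] by simp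
qed

text \<open>Whatever representation of \<open>t\<close> is used, the pairing is the trace of \<open>T \<circ> t\<close> in a fixed
orthonormal basis of \<open>K\<close>.\<close>

lemma tensor_series_trace:
  fixes K :: "'a::{complex_inner, complete_space} set"
  assumes H: "closed_csubspace H" and K: "closed_csubspace K" and T: "T \<in> bounded_ops H K"
    and t: "tensor_series H K t f g" and E: "is_onb K E"
  shows "(\<lambda>n. cinner (T (f n)) (g n)) sums (\<Sum>\<^sub>\<infinity>e\<in>E. cinner (T (t e)) e)"
proof -
  note td = tensor_seriesD[OF t]
  have EK: "E \<subseteq> K" and oE: "orthonormal E" using E by (auto simp: is_onb_def orthonormal_def)
  obtain C where C: "C \<ge> 0" "\<And>x. x \<in> H \<Longrightarrow> norm (T x) \<le> C * norm x" using bounded_ops_bound[OF T] by blast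
  define a where "a = (\<lambda>(n, e). cinner (T (f n)) e * cinner e (g n))"
  define b where "b n = C\<^sup>2 * (norm (f n))\<^sup>2 + (norm (g n))\<^sup>2" for n
  have b_sum: "summable b" unfolding b_def using td(3,4) by (intro summable_add summable_mult)
  have b0: "b n \<ge> 0" for n by (simp add: b_def)
  \<comment> \<open>By Bessel's inequality the rows of the double series are dominated by a summable sequence, so
    that the order of summation can be exchanged.\<close>
  have row: "(\<Sum>e\<in>F. norm (a (n, e))) \<le> b n" if F: "finite F" "F \<subseteq> E" for n F
  proof -
    have "(\<Sum>e\<in>F. norm (a (n, e))) \<le> (\<Sum>e\<in>F. (cmod (cinner (T (f n)) e))\<^sup>2 + (cmod (cinner (g n) e))\<^sup>2)"
    proof (rule sum_mono)
      fix e
      have "cmod (cinner e (g n)) = cmod (cinner (g n) e)" by (subst cinner_commute) simp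
      then show "norm (a (n, e)) \<le> (cmod (cinner (T (f n)) e))\<^sup>2 + (cmod (cinner (g n) e))\<^sup>2"
        using prod_le_sum_squares by (simp add: a_def norm_mult)
    qed
    also have "\<dots> \<le> (norm (T (f n)))\<^sup>2 + (norm (g n))\<^sup>2"
      unfolding sum.distrib by (intro add_mono bessel_finite[OF oE F])
    also have "(norm (T (f n)))\<^sup>2 \<le> (C * norm (f n))\<^sup>2" by (intro power_mono C td) auto
    finally show ?thesis by (simp add: b_def power_mult_distrib)
  qed
  have "(\<lambda>p. norm (a p)) summable_on (UNIV \<times> E)"
  proof (rule nonneg_bdd_above_summable_on)
    show "bdd_above (sum (\<lambda>p. norm (a p)) ` {F. F \<subseteq> UNIV \<times> E \<and> finite F})"
    proof (rule bdd_aboveI2)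
      fix P assume P: "P \<in> {F. F \<subseteq> (UNIV :: nat set) \<times> E \<and> finite F}"
      then have fin: "finite (fst ` P)" "finite (snd ` P)" and snd: "snd ` P \<subseteq> E" by auto
      have "sum (\<lambda>p. norm (a p)) P \<le> sum (\<lambda>p. norm (a p)) (fst ` P \<times> snd ` P)"
        using fin by (intro sum_mono2) (auto simp: rev_image_eqI)
      also have "\<dots> = (\<Sum>n\<in>fst ` P. \<Sum>e\<in>snd ` P. norm (a (n, e)))"
        by (simp add: sum.cartesian_product split_def)
      also have "\<dots> \<le> (\<Sum>n\<in>fst ` P. b n)" by (intro sum_mono row fin snd)
      also have "\<dots> \<le> suminf b" by (rule sum_le_suminf[OF b_sum fin(1)]) (use b0 in auto)
      finally show "sum (\<lambda>p. norm (a p)) P \<le> suminf b" .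
    qed
  qed auto
  then have "a summable_on (UNIV \<times> E)" by (rule abs_summable_summable)
  then obtain S where S: "(a has_sum S) (UNIV \<times> E)" by (auto simp: summable_on_def)
  have 1: "((\<lambda>n. cinner (T (f n)) (g n)) has_sum S) UNIV"
  proof (rule has_sum_SigmaD[OF S])
    show "((\<lambda>e. a (n, e)) has_sum cinner (T (f n)) (g n)) E" for n
      using onb_parseval[OF K E bounded_opsD(2)[OF T td(1)[of n]], of "g n"] by (simp add: a_def)
  qed
  have 2: "((\<lambda>e. cinner (T (t e)) e) has_sum S) E"
  proof (rule has_sum_SigmaD)
    show "((\<lambda>(e, n). a (n, e)) has_sum S) (E \<times> UNIV)" using S has_sum_swap[of a] by blast
    fix e assume e: "e \<in> E"
    have "(\<lambda>n. T (cinner e (g n) *\<^sub>C f n)) sums T (t e)"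
      by (rule bounded_ops_sums[OF T H]) (use e EK td closed_csubspaceD(3)[OF H] in auto)
    then have "(\<lambda>n. cinner (T (cinner e (g n) *\<^sub>C f n)) e) sums cinner (T (t e)) e"
      by (rule bounded_linear.sums[OF bounded_linear_cinner_left])
    then have s: "(\<lambda>n. a (n, e)) sums cinner (T (t e)) e"
      using td(1) by (simp add: a_def bounded_opsD(4)[OF T] cinner_scaleC_left mult.commute)
    have "summable (\<lambda>n. norm (a (n, e)))"
      by (rule summable_comparison_test'[OF b_sum]) (use row[of "{e}"] e in simp)
    then show "((\<lambda>n. case (e, n) of (e, n) \<Rightarrow> a (n, e)) has_sum cinner (T (t e)) e) UNIV"
      using norm_summable_imp_has_sum[OF _ s] by simp
  qed
  show ?thesis using has_sum_imp_sums[OF 1] infsumI[OF 2] by simp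
qed

lemma pairing_sums:
  fixes K :: "'a::{complex_inner, complete_space} set"
  assumes H: "closed_csubspace H" and K: "closed_csubspace K" and T: "T \<in> bounded_ops H K"
    and t: "tensor_series H K t f g"
  shows "(\<lambda>n. cinner (T (f n)) (g n)) sums pairing H K T t"
proof -
  obtain E where E: "is_onb K E" using is_onb_exists[OF K] by blast
  note tr = tensor_series_trace[OF H K T _ E]
  have "pairing H K T t = (\<Sum>\<^sub>\<infinity>e\<in>E. cinner (T (t e)) e)"
    unfolding pairing_def
  proof (rule the_equality)
    show "\<exists>f g. tensor_series H K t f g \<and> (\<lambda>n. cinner (T (f n)) (g n)) sums (\<Sum>\<^sub>\<infinity>e\<in>E. cinner (T (t e)) e)"
      using t tr by blast
    show "c = (\<Sum>\<^sub>\<infinity>e\<in>E. cinner (T (t e)) e)"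
      if "\<exists>f g. tensor_series H K t f g \<and> (\<lambda>n. cinner (T (f n)) (g n)) sums c" for c
      using that tr sums_unique2 by blast
  qed
  then show ?thesis using tr[OF t] by simp
qed

section \<open>Operators of rank two and their trace norm\<close>

text \<open>The operator \<open>f\<^sub>1 \<otimes> g\<^sub>1 + f\<^sub>2 \<otimes> g\<^sub>2\<close>, extended by zero outside \<open>K\<close> as required of an element of
\<open>bounded_ops\<close>.\<close>

definition rank_two :: "'a::complex_inner set \<Rightarrow> 'a \<Rightarrow> 'a \<Rightarrow> 'a \<Rightarrow> 'a \<Rightarrow> 'a \<Rightarrow> 'a" where
  "rank_two K f\<^sub>1 g\<^sub>1 f\<^sub>2 g\<^sub>2 = (\<lambda>x. if x \<in> K then cinner x g\<^sub>1 *\<^sub>C f\<^sub>1 + cinner x g\<^sub>2 *\<^sub>C f\<^sub>2 else 0)"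

context
  fixes H K :: "'a::{complex_inner, complete_space} set" and f\<^sub>1 g\<^sub>1 f\<^sub>2 g\<^sub>2 :: 'a
  assumes H: "closed_csubspace H" and K: "closed_csubspace K"
    and f: "f\<^sub>1 \<in> H" "f\<^sub>2 \<in> H" and g: "g\<^sub>1 \<in> K" "g\<^sub>2 \<in> K"
begin

lemma rank_two_tensor_series:
  "tensor_series H K (rank_two K f\<^sub>1 g\<^sub>1 f\<^sub>2 g\<^sub>2)
     (\<lambda>n. if n = 0 then f\<^sub>1 else if n = 1 then f\<^sub>2 else 0)
     (\<lambda>n. if n = 0 then g\<^sub>1 else if n = 1 then g\<^sub>2 else 0)"
proof -
  have fin: "summable (\<lambda>n::nat. (norm (if n = 0 then a else if n = 1 then b else 0))\<^sup>2)" for a b :: 'a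
    by (rule summable_finite[of "{0, 1}"]) auto
  have "(\<lambda>n. cinner x (if n = 0 then g\<^sub>1 else if n = 1 then g\<^sub>2 else 0) *\<^sub>C
      (if n = 0 then f\<^sub>1 else if n = 1 then f\<^sub>2 else 0)) sums (cinner x g\<^sub>1 *\<^sub>C f\<^sub>1 + cinner x g\<^sub>2 *\<^sub>C f\<^sub>2)" for x
    using sums_finite[of "{0::nat, 1}" "\<lambda>n. cinner x (if n = 0 then g\<^sub>1 else if n = 1 then g\<^sub>2 else 0) *\<^sub>C
      (if n = 0 then f\<^sub>1 else if n = 1 then f\<^sub>2 else 0)"] by simp
  then show ?thesis
    using f g closed_csubspaceD(1)[OF H] closed_csubspaceD(1)[OF K] fin
    by (auto simp: tensor_series_def rank_two_def)
qed

lemma rank_two_in_rank_le_ops: "rank_two K f\<^sub>1 g\<^sub>1 f\<^sub>2 g\<^sub>2 \<in> rank_le_ops 2 K H"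
proof -
  have "rank_two K f\<^sub>1 g\<^sub>1 f\<^sub>2 g\<^sub>2 \<in> bounded_ops K H"
  proof (rule bounded_opsI)
    show "norm (rank_two K f\<^sub>1 g\<^sub>1 f\<^sub>2 g\<^sub>2 x) \<le> (norm g\<^sub>1 * norm f\<^sub>1 + norm g\<^sub>2 * norm f\<^sub>2) * norm x" if "x \<in> K" for x
    proof -
      have "norm (rank_two K f\<^sub>1 g\<^sub>1 f\<^sub>2 g\<^sub>2 x) \<le> cmod (cinner x g\<^sub>1) * norm f\<^sub>1 + cmod (cinner x g\<^sub>2) * norm f\<^sub>2"
        using that by (simp add: rank_two_def norm_scaleC[symmetric] norm_triangle_ineq)
      also have "\<dots> \<le> (norm x * norm g\<^sub>1) * norm f\<^sub>1 + (norm x * norm g\<^sub>2) * norm f\<^sub>2"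
        by (intro add_mono mult_right_mono norm_cinner_le) auto
      finally show ?thesis by (simp add: algebra_simps)
    qed
    show "rank_two K f\<^sub>1 g\<^sub>1 f\<^sub>2 g\<^sub>2 x \<in> H" if "x \<in> K" for x
      using that f closed_csubspaceD(2,3)[OF H] by (simp add: rank_two_def)
    show "rank_two K f\<^sub>1 g\<^sub>1 f\<^sub>2 g\<^sub>2 (x + y) = rank_two K f\<^sub>1 g\<^sub>1 f\<^sub>2 g\<^sub>2 x + rank_two K f\<^sub>1 g\<^sub>1 f\<^sub>2 g\<^sub>2 y"
      if "x \<in> K" "y \<in> K" for x y
      using that closed_csubspaceD(2)[OF K that] by (simp add: rank_two_def cinner_add_left scaleC_add_left)
    show "rank_two K f\<^sub>1 g\<^sub>1 f\<^sub>2 g\<^sub>2 (c *\<^sub>C x) = c *\<^sub>C rank_two K f\<^sub>1 g\<^sub>1 f\<^sub>2 g\<^sub>2 x" if "x \<in> K" for c x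
      using that closed_csubspaceD(3)[OF K that]
      by (simp add: rank_two_def cinner_scaleC_left scaleC_add_right scaleC_scaleC)
  qed (simp add: rank_two_def)
  then have "rank_two K f\<^sub>1 g\<^sub>1 f\<^sub>2 g\<^sub>2 \<in> trace_class K H"
    using rank_two_tensor_series by (auto simp: trace_class_def)
  moreover have "rank_two K f\<^sub>1 g\<^sub>1 f\<^sub>2 g\<^sub>2 ` K \<subseteq> cspan {f\<^sub>1, f\<^sub>2}"
  proof (rule image_subsetI)
    fix x assume "x \<in> K"
    have "cinner x g\<^sub>1 *\<^sub>C f\<^sub>1 \<in> cspan {f\<^sub>1, f\<^sub>2}" "cinner x g\<^sub>2 *\<^sub>C f\<^sub>2 \<in> cspan {f\<^sub>1, f\<^sub>2}"
      by (rule complex_vector.span_scale, rule complex_vector.span_base, simp)+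
    then show "rank_two K f\<^sub>1 g\<^sub>1 f\<^sub>2 g\<^sub>2 x \<in> cspan {f\<^sub>1, f\<^sub>2}"
      using \<open>x \<in> K\<close> by (simp add: rank_two_def complex_vector.span_add)
  qed
  moreover have "card {f\<^sub>1, f\<^sub>2} \<le> 2" by (simp add: card_insert_if)
  ultimately show ?thesis
    unfolding rank_le_ops_def mem_Collect_eq by (intro conjI exI[of _ "{f\<^sub>1, f\<^sub>2}"]) simp_all
qed

lemma pairing_rank_two:
  assumes T: "T \<in> bounded_ops H K"
  shows "pairing H K T (rank_two K f\<^sub>1 g\<^sub>1 f\<^sub>2 g\<^sub>2) = cinner (T f\<^sub>1) g\<^sub>1 + cinner (T f\<^sub>2) g\<^sub>2"
proof -
  have "(\<lambda>n. cinner (T (if n = 0 then f\<^sub>1 else if n = 1 then f\<^sub>2 else 0))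
      (if n = 0 then g\<^sub>1 else if n = 1 then g\<^sub>2 else 0)) sums (cinner (T f\<^sub>1) g\<^sub>1 + cinner (T f\<^sub>2) g\<^sub>2)"
    using sums_finite[of "{0::nat, 1}" "\<lambda>n. cinner (T (if n = 0 then f\<^sub>1 else if n = 1 then f\<^sub>2 else 0))
      (if n = 0 then g\<^sub>1 else if n = 1 then g\<^sub>2 else 0)"] by simp
  from sums_unique2[OF pairing_sums[OF H K T rank_two_tensor_series] this] show ?thesis .
qed

end

text \<open>The property by which \<open>abs_op K t\<close> is chosen.\<close>

definition pos_root_of :: "'a::complex_inner set \<Rightarrow> ('a \<Rightarrow> 'a) \<Rightarrow> ('a \<Rightarrow> 'a) \<Rightarrow> bool" where
  "pos_root_of K t p \<longleftrightarrow> p \<in> bounded_ops K K \<and> (\<forall>x\<in>K. cinner (p x) x \<in> \<real>\<^sub>\<ge>\<^sub>0) \<and>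
     (\<forall>x\<in>K. \<forall>y\<in>K. cinner (p (p x)) y = cinner (t x) (t y))"

text \<open>Polarisation: the quadratic form is real at \<open>x + y\<close> and at \<open>x + \<i> y\<close>.\<close>

lemma positive_symmetric:
  assumes p: "p \<in> bounded_ops K K" and pos: "\<forall>x\<in>K. cinner (p x) x \<in> \<real>\<^sub>\<ge>\<^sub>0"
    and K: "closed_csubspace K" and x: "x \<in> K" and y: "y \<in> K"
  shows "cinner (p x) y = cinner x (p y)"
proof -
  have im: "Im (cinner (p u) u) = 0" if "u \<in> K" for u
    using pos that by (auto simp: complex_nonneg_Reals_iff)
  have iy: "\<i> *\<^sub>C y \<in> K" by (rule closed_csubspaceD(3)[OF K y])
  have "Im (cinner (p (x + y)) (x + y)) = 0" "Im (cinner (p (x + \<i> *\<^sub>C y)) (x + \<i> *\<^sub>C y)) = 0"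
    using im closed_csubspaceD(2)[OF K x] y iy by auto
  then have "Im (cinner (p x) y) + Im (cinner (p y) x) = 0" "Re (cinner (p y) x) - Re (cinner (p x) y) = 0"
    using im[OF x] im[OF y]
    by (simp_all add: bounded_opsD(3)[OF p x y] bounded_opsD(3)[OF p x iy] bounded_opsD(4)[OF p y]
        cinner_add_left cinner_add_right cinner_scaleC_left cinner_scaleC_right)
  then have "cinner (p x) y = cnj (cinner (p y) x)" by (simp add: complex_eq_iff)
  then show ?thesis by (metis cinner_commute)
qed

text \<open>An eigenvector of \<open>p\<^sup>2\<close> is one of the positive operator \<open>p\<close>: if \<open>v = p e - \<sigma> e\<close> with
\<open>\<sigma> > 0\<close> then \<open>p v + \<sigma> v = 0\<close>, so that \<open>\<sigma> \<parallel>v\<parallel>\<^sup>2 = - \<langle>p v, v\<rangle> \<le> 0\<close>.\<close>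

lemma positive_root_eigen:
  assumes p: "p \<in> bounded_ops K K" and pos: "\<forall>x\<in>K. cinner (p x) x \<in> \<real>\<^sub>\<ge>\<^sub>0"
    and K: "closed_csubspace K" and e: "e \<in> K" and \<sigma>: "\<sigma> \<ge> 0"
    and eig: "\<And>y. y \<in> K \<Longrightarrow> cinner (p (p e)) y = complex_of_real (\<sigma>\<^sup>2) * cinner e y"
  shows "p e = complex_of_real \<sigma> *\<^sub>C e"
proof (cases "\<sigma> = 0")
  case True
  have "cinner (p e) (p e) = cinner (p (p e)) e"
    using positive_symmetric[OF p pos K bounded_opsD(2)[OF p e] e] by simp
  then have "cinner (p e) (p e) = 0" using eig[OF e] True by simp
  then show ?thesis using True by simp
next
  case False
  have pe: "p e \<in> K" by (rule bounded_opsD(2)[OF p e])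
  define v where "v = p e - complex_of_real \<sigma> *\<^sub>C e"
  have vK: "v \<in> K" unfolding v_def by (intro closed_csubspaceD(3,4)[OF K] pe e)
  have "p v = p (p e) - complex_of_real \<sigma> *\<^sub>C p e"
    unfolding v_def by (simp add: bounded_ops_diff[OF p K pe closed_csubspaceD(3)[OF K e]] bounded_opsD(4)[OF p e])
  then have "cinner (p v) v = cinner (p (p e)) v - complex_of_real \<sigma> * cinner (p e) v"
    by (simp add: cinner_diff_left cinner_scaleC_left)
  moreover have "cinner v v = cinner (p e) v - complex_of_real \<sigma> * cinner e v"
    by (subst (1) v_def) (simp add: cinner_diff_left cinner_scaleC_left)
  ultimately have "cinner (p v) v + complex_of_real \<sigma> * cinner v v = 0"
    by (simp only: eig[OF vK]) (simp add: algebra_simps power2_eq_square)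
  then have "Re (cinner (p v) v) + \<sigma> * (norm v)\<^sup>2 = 0"
    by (simp add: cinner_self complex_eq_iff del: of_real_power)
  moreover have "Re (cinner (p v) v) \<ge> 0" using pos vK by (auto simp: complex_nonneg_Reals_iff)
  moreover have "\<sigma> * (norm v)\<^sup>2 \<ge> 0" using \<sigma> by simp
  ultimately have "\<sigma> * (norm v)\<^sup>2 = 0" by linarith
  then show ?thesis using False by (simp add: v_def)
qed

lemma bessel_two:
  fixes u v x :: "'a::complex_inner"
  assumes "cinner u v = 0" "u = 0 \<or> norm u = 1" "v = 0 \<or> norm v = 1"
  shows "(cmod (cinner x u))\<^sup>2 + (cmod (cinner x v))\<^sup>2 \<le> (norm x)\<^sup>2"
proof -
  have "cinner v u = 0" using assms(1) by (metis cinner_commute complex_cnj_zero)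
  have one: "norm w = 1 \<Longrightarrow> cinner w w = 1" for w :: 'a by (simp add: cinner_self)
  let ?p = "cinner x u *\<^sub>C u + cinner x v *\<^sub>C v"
  have *: "cinner ?p ?p = cinner x u * cnj (cinner x u) + cinner x v * cnj (cinner x v)"
    using assms \<open>cinner v u = 0\<close> one
    by (auto simp: cinner_add_left cinner_add_right cinner_scaleC_left cinner_scaleC_right)
  have **: "cinner x ?p = cinner x u * cnj (cinner x u) + cinner x v * cnj (cinner x v)"
    by (simp add: cinner_add_right cinner_scaleC_right mult.commute)
  have "0 \<le> (norm (x - ?p))\<^sup>2" by simp
  also have "\<dots> = (norm x)\<^sup>2 + (norm ?p)\<^sup>2 - 2 * Re (cinner x ?p)" by (rule norm_diff_sq)
  also have "(norm ?p)\<^sup>2 = Re (cinner ?p ?p)" by (rule norm_sq_cinner)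
  finally show ?thesis unfolding * ** by (simp add: complex_norm_square[symmetric] del: of_real_power)
qed

lemma cauchy_two:
  fixes a b c d A B :: real
  assumes "a\<^sup>2 + b\<^sup>2 \<le> A\<^sup>2" "c\<^sup>2 + d\<^sup>2 \<le> B\<^sup>2" "A \<ge> 0" "B \<ge> 0"
  shows "a * c + b * d \<le> A * B"
proof -
  have "(a * c + b * d)\<^sup>2 \<le> (a\<^sup>2 + b\<^sup>2) * (c\<^sup>2 + d\<^sup>2)"
    using zero_le_power2[of "a * d - b * c"] by (simp add: power2_eq_square algebra_simps)
  also have "\<dots> \<le> A\<^sup>2 * B\<^sup>2" using assms by (intro mult_mono) auto
  finally have "(a * c + b * d)\<^sup>2 \<le> (A * B)\<^sup>2" by (simp add: power_mult_distrib)
  then show ?thesis using assms(3,4) by (auto intro: power2_le_imp_le)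
qed

text \<open>The singular value decomposition of an operator of rank two. After a change of phase the
inner product of the images of an orthonormal pair is real, and it changes sign under a rotation by
a right angle; hence it vanishes for some angle in between. The orthonormal pair itself comes from
\<open>g\<^sub>1, g\<^sub>2\<close>, which is why they are independent here.\<close>

lemma rank_two_svd:
  fixes K :: "'a::complex_inner set" and f\<^sub>1 f\<^sub>2 :: 'a
  assumes K: "closed_csubspace K" and g: "g\<^sub>1 \<in> K" "g\<^sub>2 \<in> K"
    and indep: "g\<^sub>1 \<noteq> 0" "\<And>c. g\<^sub>2 \<noteq> c *\<^sub>C g\<^sub>1"
  defines "t \<equiv> rank_two K f\<^sub>1 g\<^sub>1 f\<^sub>2 g\<^sub>2"
  obtains e\<^sub>1 e\<^sub>2 where "e\<^sub>1 \<in> K" "e\<^sub>2 \<in> K" "cinner e\<^sub>1 e\<^sub>1 = 1" "cinner e\<^sub>2 e\<^sub>2 = 1"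
    "cinner e\<^sub>1 e\<^sub>2 = 0" "cinner e\<^sub>2 e\<^sub>1 = 0"
    "cinner (t e\<^sub>1) (t e\<^sub>2) = 0"
    "\<And>x. x \<in> K \<Longrightarrow> cinner x e\<^sub>1 = 0 \<Longrightarrow> cinner x e\<^sub>2 = 0 \<Longrightarrow> t x = 0"
proof -
  define a where "a = complex_of_real (inverse (norm g\<^sub>1)) *\<^sub>C g\<^sub>1"
  have aK: "a \<in> K" using closed_csubspaceD(3)[OF K g(1)] by (simp add: a_def)
  have aa: "cinner a a = 1"
    using indep(1) by (simp add: a_def cinner_self norm_scaleC norm_inverse power_mult_distrib)
  have g1: "g\<^sub>1 = complex_of_real (norm g\<^sub>1) *\<^sub>C a" using indep(1) by (simp add: a_def scaleC_scaleC)
  define b0 where "b0 = g\<^sub>2 - cinner g\<^sub>2 a *\<^sub>C a"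
  have "b0 \<noteq> 0" using indep(2)[of "cinner g\<^sub>2 a * complex_of_real (inverse (norm g\<^sub>1))"]
    by (simp add: b0_def a_def scaleC_scaleC)
  define b where "b = complex_of_real (inverse (norm b0)) *\<^sub>C b0"
  have b0a: "cinner b0 a = 0" by (simp add: b0_def cinner_diff_left cinner_scaleC_left aa)
  have bK: "b \<in> K" unfolding b_def b0_def by (intro closed_csubspaceD(3,4)[OF K] g aK)
  have bb: "cinner b b = 1" using \<open>b0 \<noteq> 0\<close> by (simp add: b_def cinner_self norm_scaleC norm_inverse power_mult_distrib)
  have ba: "cinner b a = 0" by (simp add: b_def cinner_scaleC_left b0a)
  have g2: "g\<^sub>2 = cinner g\<^sub>2 a *\<^sub>C a + complex_of_real (norm b0) *\<^sub>C b"
    using \<open>b0 \<noteq> 0\<close> by (simp add: b_def scaleC_scaleC b0_def)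
  have t_add: "t (x + y) = t x + t y" if "x \<in> K" "y \<in> K" for x y
    using that closed_csubspaceD(2)[OF K]
    by (simp add: t_def rank_two_def cinner_add_left scaleC_add_left)
  have t_scale: "t (c *\<^sub>C x) = c *\<^sub>C t x" if "x \<in> K" for x c
    using that closed_csubspaceD(3)[OF K]
    by (simp add: t_def rank_two_def cinner_scaleC_left scaleC_add_right scaleC_scaleC)
  obtain w where w: "cmod w = 1" "cnj w * cinner (t a) (t b) = complex_of_real (cmod (cinner (t a) (t b)))"
  proof (cases "cinner (t a) (t b) = 0")
    case True then show ?thesis using that[of 1] by simp
  next
    case False
    let ?r = "cinner (t a) (t b)"
    have "cnj (?r / complex_of_real (cmod ?r)) * ?r = ?r * cnj ?r / complex_of_real (cmod ?r)" by simp
    also have "\<dots> = complex_of_real (cmod ?r)"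
      unfolding complex_norm_square[symmetric] using False by (simp add: power2_eq_square)
    finally have "cnj (?r / complex_of_real (cmod ?r)) * ?r = complex_of_real (cmod ?r)" .
    then show ?thesis using that[of "?r / complex_of_real (cmod ?r)"] False by (simp add: norm_divide)
  qed
  define \<rho> where "\<rho> = cmod (cinner (t a) (t b))"
  define b' where "b' = w *\<^sub>C b"
  have ww: "w * cnj w = 1" using w(1) by (simp add: complex_norm_square[symmetric])
  have b'K: "b' \<in> K" unfolding b'_def by (rule closed_csubspaceD(3)[OF K bK])
  have b'b': "cinner b' b' = 1"
    using ww by (simp add: b'_def cinner_scaleC_left cinner_scaleC_right bb mult.commute)
  have b'a: "cinner b' a = 0" by (simp add: b'_def cinner_scaleC_left ba)
  have ab': "cinner a b' = 0" using b'a by (metis cinner_commute complex_cnj_zero)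
  have uv: "cinner (t a) (t b') = complex_of_real \<rho>"
    using w(2) by (simp add: b'_def t_scale[OF bK] cinner_scaleC_right \<rho>_def)
  have vu: "cinner (t b') (t a) = complex_of_real \<rho>"
    using uv by (metis cinner_commute complex_cnj_complex_of_real)
  \<comment> \<open>The inner product of the images of \<open>a\<close> and \<open>b'\<close> after rotation by the angle \<open>\<phi>\<close>.\<close>
  define q where "q \<phi> = cos \<phi> * sin \<phi> * ((norm (t b'))\<^sup>2 - (norm (t a))\<^sup>2) + \<rho> * ((cos \<phi>)\<^sup>2 - (sin \<phi>)\<^sup>2)" for \<phi>
  have "\<exists>\<phi>\<ge>0. \<phi> \<le> pi / 2 \<and> q \<phi> = 0"
  proof (rule IVT2')
    show "q (pi / 2) \<le> 0" "0 \<le> q 0" by (simp_all add: q_def \<rho>_def)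
    show "continuous_on {0..pi / 2} q" unfolding q_def by (intro continuous_intros)
  qed simp
  then obtain \<phi> where \<phi>: "q \<phi> = 0" by blast
  define c s where "c = complex_of_real (cos \<phi>)" and "s = complex_of_real (sin \<phi>)"
  have cs: "c * c + s * s = 1"
    by (simp add: c_def s_def power2_eq_square[symmetric] flip: of_real_power of_real_add)
  have cnj [simp]: "cnj c = c" "cnj s = s" by (simp_all add: c_def s_def)
  define e1 e2 where "e1 = c *\<^sub>C a + s *\<^sub>C b'" and "e2 = (- s) *\<^sub>C a + c *\<^sub>C b'"
  note simps = cinner_add_left cinner_add_right cinner_scaleC_left cinner_scaleC_right
    cinner_diff_left cinner_diff_right cinner_minus_left cinner_minus_right
  have te: "t e1 = c *\<^sub>C t a + s *\<^sub>C t b'" "t e2 = (- s) *\<^sub>C t a + c *\<^sub>C t b'"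
    unfolding e1_def e2_def using aK b'K closed_csubspaceD(3)[OF K] by (simp_all only: t_add t_scale)
  have "cinner (t e1) (t e2) = complex_of_real (q \<phi>)"
    unfolding te q_def by (simp add: simps uv vu cinner_self c_def s_def algebra_simps power2_eq_square)
  then have orth: "cinner (t e1) (t e2) = 0" using \<phi> by simp
  show ?thesis
  proof (rule that[of e1 e2])
    show "e1 \<in> K" "e2 \<in> K" unfolding e1_def e2_def by (intro closed_csubspaceD(2,3)[OF K] aK b'K)+
    show "cinner e1 e1 = 1" "cinner e2 e2 = 1"
      using cs by (simp_all add: e1_def e2_def simps aa b'b' b'a ab' add.commute)
    show "cinner e1 e2 = 0" "cinner e2 e1 = 0" by (simp_all add: e1_def e2_def simps aa b'b' b'a ab')
    show "cinner (t e1) (t e2) = 0" by (rule orth)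
    show "t x = 0" if x: "x \<in> K" "cinner x e1 = 0" "cinner x e2 = 0" for x
    proof -
      let ?A = "cinner x a" and ?B = "cinner x b'"
      have 1: "c * ?A + s * ?B = 0" "c * ?B - s * ?A = 0"
        using x(2,3) by (simp_all add: e1_def e2_def simps)
      have "(c * c + s * s) * ?A = c * (c * ?A + s * ?B) - s * (c * ?B - s * ?A)"
        "(c * c + s * s) * ?B = s * (c * ?A + s * ?B) + c * (c * ?B - s * ?A)"
        by (simp_all add: algebra_simps)
      then have "?A = 0" "?B = 0" unfolding 1 cs by simp_all
      moreover have "cinner x b = 0"
        using \<open>?B = 0\<close> ww by (auto simp: b'_def cinner_scaleC_right)
      ultimately have "cinner x g\<^sub>1 = 0" "cinner x g\<^sub>2 = 0"
        by (subst g1 g2, simp add: simps)+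
      then show ?thesis by (simp add: t_def rank_two_def)
    qed
  qed
qed

text \<open>With singular vectors \<open>e\<^sub>1, e\<^sub>2\<close> of \<open>t\<close> at hand, every positive root of \<open>t\<^sup>* t\<close> is
\<open>\<parallel>t e\<^sub>1\<parallel> e\<^sub>1 \<otimes> e\<^sub>1 + \<parallel>t e\<^sub>2\<parallel> e\<^sub>2 \<otimes> e\<^sub>2\<close>; the bound on its trace is Bessel's inequality for the pairs
\<open>e\<^sub>i\<close> and \<open>t e\<^sub>i / \<parallel>t e\<^sub>i\<parallel>\<close>.\<close>

lemma trace_norm_rank_two_le:
  fixes K :: "'a::{complex_inner, complete_space} set"
  assumes K: "closed_csubspace K" and g: "g\<^sub>1 \<in> K" "g\<^sub>2 \<in> K"
    and indep: "g\<^sub>1 \<noteq> 0" "\<And>c. g\<^sub>2 \<noteq> c *\<^sub>C g\<^sub>1"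
  shows "trace_norm K (rank_two K f\<^sub>1 g\<^sub>1 f\<^sub>2 g\<^sub>2) \<le> norm f\<^sub>1 * norm g\<^sub>1 + norm f\<^sub>2 * norm g\<^sub>2"
proof -
  define t where "t = rank_two K f\<^sub>1 g\<^sub>1 f\<^sub>2 g\<^sub>2"
  obtain e1 e2 where e: "e1 \<in> K" "e2 \<in> K" and on: "cinner e1 e1 = 1" "cinner e2 e2 = 1"
      "cinner e1 e2 = 0" "cinner e2 e1 = 0"
    and orth: "cinner (t e1) (t e2) = 0"
    and ker: "\<And>x. x \<in> K \<Longrightarrow> cinner x e1 = 0 \<Longrightarrow> cinner x e2 = 0 \<Longrightarrow> t x = 0"
    using rank_two_svd[OF K g indep, of f\<^sub>1 f\<^sub>2] unfolding t_def by blast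
  have orth': "cinner (t e2) (t e1) = 0" using orth by (metis cinner_commute complex_cnj_zero)
  define s1 s2 where "s1 = norm (t e1)" and "s2 = norm (t e2)"
  note simps = cinner_add_left cinner_add_right cinner_scaleC_left cinner_scaleC_right
  have t_add: "t (x + y) = t x + t y" if "x \<in> K" "y \<in> K" for x y
    using that closed_csubspaceD(2)[OF K]
    by (simp add: t_def rank_two_def cinner_add_left scaleC_add_left)
  have t_scale: "t (c *\<^sub>C x) = c *\<^sub>C t x" if "x \<in> K" for x c
    using that closed_csubspaceD(3)[OF K]
    by (simp add: t_def rank_two_def cinner_scaleC_left scaleC_add_right scaleC_scaleC)
  define r where "r x = x - (cinner x e1 *\<^sub>C e1 + cinner x e2 *\<^sub>C e2)" for x
  have r: "r x \<in> K" "cinner (r x) e1 = 0" "cinner (r x) e2 = 0" if "x \<in> K" for x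
  proof -
    show "r x \<in> K" unfolding r_def by (intro closed_csubspaceD(2,3,4)[OF K] e that)
    show "cinner (r x) e1 = 0" "cinner (r x) e2 = 0"
      by (simp_all add: r_def cinner_diff_left simps on)
  qed
  have span: "cinner x e1 *\<^sub>C e1 + cinner x e2 *\<^sub>C e2 \<in> K" for x
    by (intro closed_csubspaceD(2,3)[OF K] e)
  have x_eq: "x = r x + (cinner x e1 *\<^sub>C e1 + cinner x e2 *\<^sub>C e2)" for x by (simp add: r_def)
  have t_eq: "t x = cinner x e1 *\<^sub>C t e1 + cinner x e2 *\<^sub>C t e2" if "x \<in> K" for x
  proof -
    have "t x = t (r x) + t (cinner x e1 *\<^sub>C e1 + cinner x e2 *\<^sub>C e2)"
      by (subst x_eq) (rule t_add[OF r(1)[OF that] span])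
    then show ?thesis
      using ker[OF r[OF that]] e closed_csubspaceD(3)[OF K] by (simp add: t_add t_scale)
  qed
  have t_in: "cinner (t x) (t y) =
      complex_of_real (s1\<^sup>2) * (cinner x e1 * cinner e1 y) + complex_of_real (s2\<^sup>2) * (cinner x e2 * cinner e2 y)"
    if "x \<in> K" "y \<in> K" for x y
  proof -
    have "cnj (cinner y e1) = cinner e1 y" "cnj (cinner y e2) = cinner e2 y"
      by (metis cinner_commute)+
    then show ?thesis
      unfolding t_eq[OF that(1)] t_eq[OF that(2)]
      by (simp add: simps orth orth' cinner_self s1_def s2_def algebra_simps)
  qed
  define P where "P x = (if x \<in> K then (complex_of_real s1 * cinner x e1) *\<^sub>C e1 +
      (complex_of_real s2 * cinner x e2) *\<^sub>C e2 else 0)" for x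
  have P: "pos_root_of K t P"
    unfolding pos_root_of_def
  proof (intro conjI ballI)
    show "P \<in> bounded_ops K K"
    proof (rule bounded_opsI)
      show "norm (P x) \<le> (s1 + s2) * norm x" if "x \<in> K" for x
      proof -
        have ne: "norm e1 = 1" "norm e2 = 1"
          using on(1,2) by (simp_all add: cinner_self complex_eq_iff power2_eq_1_iff del: of_real_power)
            (metis norm_ge_zero not_one_le_zero neg_0_le_iff_le)+
        have "norm (P x) \<le> s1 * cmod (cinner x e1) + s2 * cmod (cinner x e2)"
          using that ne by (auto simp: P_def s1_def s2_def norm_scaleC norm_mult intro!: norm_triangle_le)
        also have "\<dots> \<le> s1 * norm x + s2 * norm x"
          using norm_cinner_le[of x e1] norm_cinner_le[of x e2] ne
          by (intro add_mono mult_left_mono) (auto simp: s1_def s2_def)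
        finally show ?thesis by (simp add: algebra_simps)
      qed
      show "P x \<in> K" if "x \<in> K" for x
        using that e closed_csubspaceD(2,3)[OF K] by (simp add: P_def)
      show "P (x + y) = P x + P y" if "x \<in> K" "y \<in> K" for x y
        using that closed_csubspaceD(2)[OF K that]
        by (simp add: P_def cinner_add_left scaleC_add_left distrib_left)
      show "P (c *\<^sub>C x) = c *\<^sub>C P x" if "x \<in> K" for c x
        using that closed_csubspaceD(3)[OF K that]
        by (simp add: P_def cinner_scaleC_left scaleC_add_right scaleC_scaleC mult.left_commute)
    qed (simp add: P_def)
    show "cinner (P x) x \<in> \<real>\<^sub>\<ge>\<^sub>0" if "x \<in> K" for x
    proof -
      have *: "cinner x e * cinner e x = complex_of_real ((cmod (cinner x e))\<^sup>2)" for e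
        by (metis cinner_commute complex_norm_square)
      have "cinner (P x) x = complex_of_real (s1 * (cmod (cinner x e1))\<^sup>2 + s2 * (cmod (cinner x e2))\<^sup>2)"
        using that by (simp add: P_def simps mult.assoc * del: of_real_power)
      then show ?thesis by (simp add: complex_nonneg_Reals_iff s1_def s2_def del: of_real_add of_real_mult)
    qed
    show "cinner (P (P x)) y = cinner (t x) (t y)" if "x \<in> K" "y \<in> K" for x y
    proof -
      have "P x \<in> K" using that e closed_csubspaceD(2,3)[OF K] by (simp add: P_def)
      moreover have "cinner (P x) e1 = complex_of_real s1 * cinner x e1" "cinner (P x) e2 = complex_of_real s2 * cinner x e2"
        using that by (simp_all add: P_def simps on)
      ultimately show ?thesis
        unfolding t_in[OF that] by (simp add: P_def simps power2_eq_square)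
    qed
  qed
  have "pos_root_of K t (abs_op K t)"
    unfolding abs_op_def pos_root_of_def[symmetric] by (rule someI[of _ P]) (rule P)
  then have p: "abs_op K t \<in> bounded_ops K K" and pos: "\<forall>x\<in>K. cinner (abs_op K t x) x \<in> \<real>\<^sub>\<ge>\<^sub>0"
    and root: "\<And>x y. x \<in> K \<Longrightarrow> y \<in> K \<Longrightarrow> cinner (abs_op K t (abs_op K t x)) y = cinner (t x) (t y)"
    by (auto simp: pos_root_of_def)
  have p1: "abs_op K t e1 = complex_of_real s1 *\<^sub>C e1"
    by (rule positive_root_eigen[OF p pos K e(1)]) (simp_all add: root e t_in on s1_def)
  have p2: "abs_op K t e2 = complex_of_real s2 *\<^sub>C e2"
    by (rule positive_root_eigen[OF p pos K e(2)]) (simp_all add: root e t_in on s2_def)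
  have p3: "abs_op K t (r x) = 0" if "x \<in> K" for x
    using positive_root_eigen[OF p pos K r(1)[OF that], of 0] r[OF that] by (simp add: root t_in)
  have p_eq: "abs_op K t x = (complex_of_real s1 * cinner x e1) *\<^sub>C e1 + (complex_of_real s2 * cinner x e2) *\<^sub>C e2"
    if "x \<in> K" for x
  proof -
    have "abs_op K t x = abs_op K t (r x) + abs_op K t (cinner x e1 *\<^sub>C e1 + cinner x e2 *\<^sub>C e2)"
      by (subst x_eq) (rule bounded_opsD(3)[OF p r(1)[OF that] span])
    then show ?thesis
      using p3[OF that] e closed_csubspaceD(3)[OF K]
      by (simp add: bounded_opsD(3,4)[OF p] p1 p2 scaleC_scaleC mult.commute)
  qed
  define E where "E = (SOME E. is_onb K E)"
  have E: "is_onb K E" unfolding E_def by (rule someI_ex[OF is_onb_exists[OF K]])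
  then have EK: "E \<subseteq> K" by (simp add: is_onb_def)
  have "((\<lambda>x. complex_of_real s1 * (cinner e1 x * cinner x e1) + complex_of_real s2 * (cinner e2 x * cinner x e2))
      has_sum (complex_of_real s1 * cinner e1 e1 + complex_of_real s2 * cinner e2 e2)) E"
    by (intro has_sum_add has_sum_cmult_right onb_parseval[OF K E] e)
  then have "((\<lambda>x. Re (complex_of_real s1 * (cinner e1 x * cinner x e1) + complex_of_real s2 * (cinner e2 x * cinner x e2)))
      has_sum (s1 + s2)) E"
    using has_sum_bounded_linear[OF bounded_linear_Re] by (fastforce simp: comp_def on)
  then have "((\<lambda>x. Re (cinner (abs_op K t x) x)) has_sum (s1 + s2)) E"
    by (rule has_sum_cong[THEN iffD1, rotated])
      (use EK in \<open>simp add: p_eq subset_iff simps mult_ac\<close>)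
  then have tn: "trace_norm K t = s1 + s2"
    unfolding trace_norm_def E_def[symmetric] by (rule infsumI)
  define v1 v2 where "v1 = complex_of_real (inverse s1) *\<^sub>C t e1" and "v2 = complex_of_real (inverse s2) *\<^sub>C t e2"
  have v: "cinner v1 v2 = 0" "v1 = 0 \<or> norm v1 = 1" "v2 = 0 \<or> norm v2 = 1"
    by (cases "t e1 = 0"; cases "t e2 = 0";
        simp add: v1_def v2_def simps orth norm_scaleC s1_def s2_def norm_inverse)+
  have "norm e1 = 1" "norm e2 = 1"
    using on(1,2) by (simp_all add: cinner_self complex_eq_iff power2_eq_1_iff del: of_real_power)
      (metis norm_ge_zero not_one_le_zero neg_0_le_iff_le)+
  then have b_e: "(cmod (cinner x e1))\<^sup>2 + (cmod (cinner x e2))\<^sup>2 \<le> (norm x)\<^sup>2" for x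
    using bessel_two[of e1 e2 x] on by simp
  have te: "t x = cinner x g\<^sub>1 *\<^sub>C f\<^sub>1 + cinner x g\<^sub>2 *\<^sub>C f\<^sub>2" if "x \<in> K" for x
    using that by (simp add: t_def rank_two_def)
  have sv: "norm (t y) \<le> cmod (cinner g\<^sub>1 y) * cmod (cinner f\<^sub>1 v) + cmod (cinner g\<^sub>2 y) * cmod (cinner f\<^sub>2 v)"
    if "y \<in> K" "v = complex_of_real (inverse (norm (t y))) *\<^sub>C t y" for y v
  proof -
    have "norm (t y) = cmod (cinner (t y) v)"
      by (cases "t y = 0")
        (simp_all add: that(2) cinner_scaleC_right cinner_self norm_mult norm_power norm_inverse power2_eq_square)
    also have "cinner (t y) v = cinner y g\<^sub>1 * cinner f\<^sub>1 v + cinner y g\<^sub>2 * cinner f\<^sub>2 v"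
      by (simp add: te[OF that(1)] simps)
    also have "cmod \<dots> \<le> cmod (cinner y g\<^sub>1) * cmod (cinner f\<^sub>1 v) + cmod (cinner y g\<^sub>2) * cmod (cinner f\<^sub>2 v)"
      by (metis norm_mult norm_triangle_ineq)
    also have "cmod (cinner y g\<^sub>1) = cmod (cinner g\<^sub>1 y)" by (metis cinner_commute complex_mod_cnj)
    also have "cmod (cinner y g\<^sub>2) = cmod (cinner g\<^sub>2 y)" by (metis cinner_commute complex_mod_cnj)
    finally show ?thesis .
  qed
  have "s1 + s2 \<le> (cmod (cinner g\<^sub>1 e1) * cmod (cinner f\<^sub>1 v1) + cmod (cinner g\<^sub>1 e2) * cmod (cinner f\<^sub>1 v2)) +
      (cmod (cinner g\<^sub>2 e1) * cmod (cinner f\<^sub>2 v1) + cmod (cinner g\<^sub>2 e2) * cmod (cinner f\<^sub>2 v2))"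
    using sv[OF e(1), of v1] sv[OF e(2), of v2] by (simp add: v1_def v2_def s1_def s2_def)
  also have "\<dots> \<le> norm g\<^sub>1 * norm f\<^sub>1 + norm g\<^sub>2 * norm f\<^sub>2"
    by (intro add_mono cauchy_two b_e bessel_two[OF v]) auto
  finally show ?thesis using tn by (simp add: t_def mult.commute)
qed

section \<open>Calculus in \<open>L\<^sup>2\<close> of the circle\<close>

abbreviation \<mu> :: "complex measure" where
  "\<mu> \<equiv> circle_measure"

interpretation circle: prob_space \<mu>
  by (rule prob_space_circle_measure)

lemma circle_prob_UNIV: "circle.prob UNIV = 1"
  using circle.prob_space by simp

lemma borel_measurable_cnj [measurable (raw)]:
  "f \<in> borel_measurable M \<Longrightarrow> (\<lambda>x. cnj (f x)) \<in> borel_measurable M"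
  using measurable_comp[of f M borel cnj borel]
    borel_measurable_continuous_onI[of cnj, OF continuous_on_cnj[OF continuous_on_id]]
  by (simp add: comp_def)

lemma sq_integrable_rep [simp, intro]: "sq_integrable (rep_L2 f)"
  using Quotient3_rep_reflp[OF Quotient3_L2] by blast

lemma rep_L2_measurable [measurable]: "rep_L2 f \<in> borel_measurable \<mu>"
  by (rule sq_integrable_meas) simp

lemma abs_rep_L2 [simp]: "abs_L2 (rep_L2 f) = f"
  by (rule Quotient3_abs_rep[OF Quotient3_L2])

lemma rep_abs_L2: "sq_integrable u \<Longrightarrow> AE z in \<mu>. rep_L2 (abs_L2 u) z = u z"
  using rep_abs_rsp_left[OF Quotient3_L2, of u u] by simp

lemma abs_L2_eqI:
  "sq_integrable u \<Longrightarrow> sq_integrable v \<Longrightarrow> AE z in \<mu>. u z = v z \<Longrightarrow> abs_L2 u = abs_L2 v"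
  by (rule Quotient3_rel_abs[OF Quotient3_L2]) simp

lemma L2_eqI: "AE z in \<mu>. rep_L2 f z = rep_L2 g z \<Longrightarrow> f = g"
  using abs_L2_eqI[of "rep_L2 f" "rep_L2 g"] by simp

lemma abs_L2_cong_rep: "sq_integrable u \<Longrightarrow> AE z in \<mu>. rep_L2 f z = u z \<Longrightarrow> abs_L2 u = f"
  using abs_L2_eqI[of "rep_L2 f" u] by simp

lemma rep_plus: "AE z in \<mu>. rep_L2 (f + g) z = rep_L2 f z + rep_L2 g z"
proof -
  have "f + g = abs_L2 (\<lambda>z. rep_L2 f z + rep_L2 g z)"
    using plus_L2.abs_eq[of "rep_L2 f" "rep_L2 g"] by simp
  then show ?thesis using rep_abs_L2[OF sq_integrable_add, of "rep_L2 f" "rep_L2 g"] by simp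
qed

lemma rep_scaleC: "AE z in \<mu>. rep_L2 (c *\<^sub>C f) z = c * rep_L2 f z"
proof -
  have "c *\<^sub>C f = abs_L2 (\<lambda>z. c * rep_L2 f z)"
    using scaleC_L2.abs_eq[of "rep_L2 f" c] by simp
  then show ?thesis using rep_abs_L2[OF sq_integrable_scale, of "rep_L2 f" c] by simp
qed

lemma rep_zero: "AE z in \<mu>. rep_L2 0 z = 0"
  unfolding zero_L2.abs_eq by (rule rep_abs_L2) (simp add: sq_integrable_def)

lemma rep_diff: "AE z in \<mu>. rep_L2 (f - g) z = rep_L2 f z - rep_L2 g z"
  using rep_plus[of f "(-1) *\<^sub>C g"] rep_scaleC[of "-1" g]
  by eventually_elim (simp add: scaleC_minus1)

lemma sq_integrable_powi: "sq_integrable (\<lambda>z. z powi n)"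
proof -
  have "(\<lambda>z::complex. z powi n) \<in> borel_measurable borel"
    by (cases "n \<ge> 0") (simp_all add: power_int_def)
  moreover have "AE z in \<mu>. cmod (z powi n) \<le> 1"
    using AE_norm_circle_measure by eventually_elim (simp add: norm_power_int)
  ultimately show ?thesis by (auto intro: sq_integrable_bounded)
qed

lemma rep_zpow: "AE z in \<mu>. rep_L2 (zpow n) z = z powi n"
  unfolding zpow.abs_eq by (rule rep_abs_L2[OF sq_integrable_powi])

lemma cinner_rep: "cinner f g = (LINT z|\<mu>. rep_L2 f z * cnj (rep_L2 g z))"
  by (rule cinner_L2.rep_eq)

lemma integrable_rep_prod: "integrable \<mu> (\<lambda>z. rep_L2 f z * cnj (rep_L2 g z))"
  by (rule sq_integrable_prod) simp_all

lemma norm_sq_rep: "(norm f)\<^sup>2 = (LINT z|\<mu>. (cmod (rep_L2 f z))\<^sup>2)"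
  by (simp add: norm_L2.rep_eq)

lemma norm_sq_abs: "sq_integrable u \<Longrightarrow> (norm (abs_L2 u))\<^sup>2 = (LINT z|\<mu>. (cmod (u z))\<^sup>2)"
  by (simp add: norm_L2.abs_eq)

lemma cinner_AE_eqI:
  assumes "AE z in \<mu>. rep_L2 f z * cnj (rep_L2 g z) = rep_L2 f' z * cnj (rep_L2 g' z)"
  shows "cinner f g = cinner f' g'"
  unfolding cinner_rep by (rule integral_cong_AE) (use assms in auto)

lemma cinner_AE_eq_integral:
  assumes "u \<in> borel_measurable \<mu>"
    and "AE z in \<mu>. rep_L2 f z * cnj (rep_L2 g z) = u z"
  shows "cinner f g = (LINT z|\<mu>. u z)"
  unfolding cinner_rep by (rule integral_cong_AE) (use assms in auto)

lemma norm_le_AE: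
  assumes "AE z in \<mu>. cmod (rep_L2 f z) \<le> cmod (rep_L2 g z)"
  shows "norm f \<le> norm g"
proof -
  have "(norm f)\<^sup>2 \<le> (norm g)\<^sup>2"
    unfolding norm_sq_rep
    by (rule integral_mono_AE) (use assms in \<open>auto simp: sq_integrable_int intro: power_mono\<close>)
  then show ?thesis by (simp add: power2_le_iff_abs_le)
qed

lemma L1_le_L2_norm:
  assumes "sq_integrable u"
  shows "integrable \<mu> u"
    and "(LINT z|\<mu>. cmod (u z)) \<le> norm (abs_L2 u)"
proof -
  have [measurable]: "u \<in> borel_measurable \<mu>" using assms by (rule sq_integrable_meas)
  have sq: "sq_integrable (\<lambda>z. complex_of_real (cmod (u z)))"
    using assms by (simp add: sq_integrable_def)
  have one: "sq_integrable (\<lambda>z. 1)" by (simp add: sq_integrable_def)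
  show "integrable \<mu> u" using sq_integrable_prod[OF assms one] by simp
  have "cinner (abs_L2 (\<lambda>z. complex_of_real (cmod (u z)))) (abs_L2 (\<lambda>z. 1)) =
      complex_of_real (LINT z|\<mu>. cmod (u z))"
    using sq one by (simp add: cinner_L2.abs_eq)
  then have "cmod (complex_of_real (LINT z|\<mu>. cmod (u z))) \<le>
      norm (abs_L2 (\<lambda>z. complex_of_real (cmod (u z)))) * norm (abs_L2 (\<lambda>z. 1))"
    using norm_cinner_le by metis
  moreover have "norm (abs_L2 (\<lambda>z. 1)) = 1" using one by (simp add: norm_L2.abs_eq circle_prob_UNIV)
  moreover have "norm (abs_L2 (\<lambda>z. complex_of_real (cmod (u z)))) = norm (abs_L2 u)"
    using sq assms by (simp add: norm_L2.abs_eq)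
  ultimately show "(LINT z|\<mu>. cmod (u z)) \<le> norm (abs_L2 u)" by simp
qed

text \<open>By monotone convergence the sum of the norms is integrable, hence finite almost everywhere.\<close>

lemma AE_summable_of_integrals:
  fixes u :: "nat \<Rightarrow> 'a \<Rightarrow> 'b::{banach, second_countable_topology}"
  assumes int: "\<And>n. integrable M (u n)" and sum: "summable (\<lambda>n. LINT z|M. norm (u n z))"
  shows "AE z in M. summable (\<lambda>n. norm (u n z))"
proof -
  note [measurable] = borel_measurable_integrable[OF int]
  have "(\<integral>\<^sup>+z. (\<Sum>n. ennreal (norm (u n z))) \<partial>M) = (\<Sum>n. \<integral>\<^sup>+z. ennreal (norm (u n z)) \<partial>M)"
    by (rule nn_integral_suminf) simp
  also have "\<dots> = (\<Sum>n. ennreal (LINT z|M. norm (u n z)))"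
    using int by (subst nn_integral_eq_integral) (auto intro: integrable_norm)
  also have "\<dots> = ennreal (\<Sum>n. LINT z|M. norm (u n z))"
    by (rule suminf_ennreal2) (use sum in auto)
  also have "\<dots> \<noteq> \<infinity>" by simp
  finally have "AE z in M. (\<Sum>n. ennreal (norm (u n z))) \<noteq> \<infinity>"
    by (intro nn_integral_PInf_AE) auto
  then show ?thesis
    by eventually_elim (auto intro: summable_suminf_not_top simp: top_ennreal_def)
qed

text \<open>The core of the theorem of Riesz and Fischer, since every Cauchy sequence has a subsequence of
this kind. The increments are summable in \<open>L\<^sup>2\<close>, hence in \<open>L\<^sup>1\<close>, so that the sequence converges
almost everywhere; by Fatou's lemma the pointwise limit is also the limit in \<open>L\<^sup>2\<close>.\<close>

lemma L2_fast_Cauchy_convergent: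
  fixes X :: "nat \<Rightarrow> L2"
  assumes fast: "\<And>n k. k \<ge> n \<Longrightarrow> norm (X k - X n) \<le> (1/2) ^ n"
  shows "convergent X"
proof -
  have inc: "(LINT z|\<mu>. cmod (rep_L2 (X (Suc n) - X n) z)) \<le> (1/2) ^ n" for n
    using L1_le_L2_norm(2)[of "rep_L2 (X (Suc n) - X n)"] fast[of n "Suc n"] by simp
  have "AE z in \<mu>. summable (\<lambda>n. norm (rep_L2 (X (Suc n) - X n) z))"
  proof (rule AE_summable_of_integrals)
    show "summable (\<lambda>n. LINT z|\<mu>. norm (rep_L2 (X (Suc n) - X n) z))"
      by (rule summable_comparison_test'[OF summable_geometric[of "1/2::real"]]) (use inc in auto)
  qed (simp add: L1_le_L2_norm(1))
  moreover have "AE z in \<mu>. \<forall>n. rep_L2 (X (Suc n) - X n) z = rep_L2 (X (Suc n)) z - rep_L2 (X n) z"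
    by (simp add: AE_all_countable rep_diff)
  ultimately have conv: "AE z in \<mu>. (\<lambda>n. rep_L2 (X n) z) \<longlonglongrightarrow> lim (\<lambda>n. rep_L2 (X n) z)"
  proof eventually_elim
    fix z assume "summable (\<lambda>n. norm (rep_L2 (X (Suc n) - X n) z))"
      and "\<forall>n. rep_L2 (X (Suc n) - X n) z = rep_L2 (X (Suc n)) z - rep_L2 (X n) z"
    then have "summable (\<lambda>n. rep_L2 (X (Suc n)) z - rep_L2 (X n) z)"
      using summable_norm_cancel by auto
    then have "convergent (\<lambda>n. \<Sum>i<n. rep_L2 (X (Suc i)) z - rep_L2 (X i) z)"
      by (simp add: summable_iff_convergent)
    then obtain l where "(\<lambda>n. \<Sum>i<n. rep_L2 (X (Suc i)) z - rep_L2 (X i) z) \<longlonglongrightarrow> l"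
      by (auto simp: convergent_def)
    then have "(\<lambda>n. rep_L2 (X n) z - rep_L2 (X 0) z) \<longlonglongrightarrow> l"
      unfolding sum_lessThan_telescope[of "\<lambda>n. rep_L2 (X n) z"] .
    from tendsto_add[OF this tendsto_const[of "rep_L2 (X 0) z"]]
    have "(\<lambda>n. rep_L2 (X n) z) \<longlonglongrightarrow> l + rep_L2 (X 0) z" by simp
    then have "convergent (\<lambda>n. rep_L2 (X n) z)" by (rule convergentI)
    then show "(\<lambda>n. rep_L2 (X n) z) \<longlonglongrightarrow> lim (\<lambda>n. rep_L2 (X n) z)" by (simp add: convergent_LIMSEQ_iff)
  qed
  define y where "y z = lim (\<lambda>n. rep_L2 (X n) z)" for z
  have [measurable]: "y \<in> borel_measurable \<mu>"
    unfolding y_def by (rule borel_measurable_lim_metric) simp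
  have fatou: "(\<integral>\<^sup>+z. ennreal ((cmod (y z - rep_L2 (X m) z))\<^sup>2) \<partial>\<mu>) \<le> ennreal (((1/2) ^ m)\<^sup>2)" for m
  proof -
    have "(\<integral>\<^sup>+z. ennreal ((cmod (y z - rep_L2 (X m) z))\<^sup>2) \<partial>\<mu>) =
        (\<integral>\<^sup>+z. liminf (\<lambda>k. ennreal ((cmod (rep_L2 (X k) z - rep_L2 (X m) z))\<^sup>2)) \<partial>\<mu>)"
    proof (rule nn_integral_cong_AE)
      show "AE z in \<mu>. ennreal ((cmod (y z - rep_L2 (X m) z))\<^sup>2) =
          liminf (\<lambda>k. ennreal ((cmod (rep_L2 (X k) z - rep_L2 (X m) z))\<^sup>2))"
        using conv
      proof eventually_elim
        fix z assume "(\<lambda>n. rep_L2 (X n) z) \<longlonglongrightarrow> lim (\<lambda>n. rep_L2 (X n) z)"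
        then have "(\<lambda>k. ennreal ((cmod (rep_L2 (X k) z - rep_L2 (X m) z))\<^sup>2)) \<longlonglongrightarrow>
            ennreal ((cmod (y z - rep_L2 (X m) z))\<^sup>2)"
          unfolding y_def by (intro tendsto_intros)
        then show "ennreal ((cmod (y z - rep_L2 (X m) z))\<^sup>2) =
            liminf (\<lambda>k. ennreal ((cmod (rep_L2 (X k) z - rep_L2 (X m) z))\<^sup>2))"
          using lim_imp_Liminf[OF sequentially_bot] by metis
      qed
    qed
    also have "\<dots> \<le> liminf (\<lambda>k. \<integral>\<^sup>+z. ennreal ((cmod (rep_L2 (X k) z - rep_L2 (X m) z))\<^sup>2) \<partial>\<mu>)"
      by (rule nn_integral_liminf) simp
    also have "\<dots> \<le> ennreal (((1/2) ^ m)\<^sup>2)"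
    proof (rule Liminf_le)
      show "\<forall>\<^sub>F k in sequentially. (\<integral>\<^sup>+z. ennreal ((cmod (rep_L2 (X k) z - rep_L2 (X m) z))\<^sup>2) \<partial>\<mu>)
          \<le> ennreal (((1/2) ^ m)\<^sup>2)"
        using eventually_ge_at_top[of m]
      proof eventually_elim
        fix k assume "m \<le> k"
        have "(\<integral>\<^sup>+z. ennreal ((cmod (rep_L2 (X k) z - rep_L2 (X m) z))\<^sup>2) \<partial>\<mu>) =
            (\<integral>\<^sup>+z. ennreal ((cmod (rep_L2 (X k - X m) z))\<^sup>2) \<partial>\<mu>)"
          by (rule nn_integral_cong_AE) (use rep_diff[of "X k" "X m"] in \<open>auto elim: eventually_mono\<close>)
        also have "\<dots> = ennreal ((norm (X k - X m))\<^sup>2)"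
          unfolding norm_sq_rep by (rule nn_integral_eq_integral) (simp_all add: sq_integrable_int)
        also have "\<dots> \<le> ennreal (((1/2) ^ m)\<^sup>2)"
          using fast[OF \<open>m \<le> k\<close>] by (intro ennreal_leI power_mono) auto
        finally show "(\<integral>\<^sup>+z. ennreal ((cmod (rep_L2 (X k) z - rep_L2 (X m) z))\<^sup>2) \<partial>\<mu>)
          \<le> ennreal (((1/2) ^ m)\<^sup>2)" .
      qed
    qed simp
    finally show ?thesis .
  qed
  have sq_diff: "sq_integrable (\<lambda>z. y z - rep_L2 (X m) z)" for m
    unfolding sq_integrable_def
  proof
    show "integrable \<mu> (\<lambda>z. (cmod (y z - rep_L2 (X m) z))\<^sup>2)"
      by (rule integrableI_nonneg) (use le_less_trans[OF fatou] in auto)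
  qed simp
  have sq_y: "sq_integrable y"
    using sq_integrable_add[OF sq_diff[of 0], of "rep_L2 (X 0)"] by simp
  have "norm (X m - abs_L2 y) \<le> (1/2) ^ m" for m
  proof -
    have "abs_L2 y - X m = abs_L2 (\<lambda>z. y z - rep_L2 (X m) z)"
      by (rule abs_L2_cong_rep[symmetric, OF sq_diff])
        (use rep_diff[of "abs_L2 y" "X m"] rep_abs_L2[OF sq_y] in \<open>eventually_elim, simp\<close>)
    then have "ennreal ((norm (abs_L2 y - X m))\<^sup>2) = (\<integral>\<^sup>+z. ennreal ((cmod (y z - rep_L2 (X m) z))\<^sup>2) \<partial>\<mu>)"
      using nn_integral_eq_integral[OF sq_integrable_int[OF sq_diff[of m]]]
      by (simp add: norm_sq_abs[OF sq_diff])
    then have "ennreal ((norm (abs_L2 y - X m))\<^sup>2) \<le> ennreal (((1/2) ^ m)\<^sup>2)" using fatou[of m] by simp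
    then have "(norm (abs_L2 y - X m))\<^sup>2 \<le> ((1/2) ^ m)\<^sup>2" by (subst (asm) ennreal_le_iff) auto
    then show ?thesis by (subst norm_minus_commute) (auto intro: power2_le_imp_le)
  qed
  then have "(\<lambda>m. X m - abs_L2 y) \<longlonglongrightarrow> 0"
    by (intro Lim_null_comparison[OF _ LIMSEQ_power_zero[of "1/2::real"]]) auto
  then show ?thesis using LIM_zero_cancel convergent_def by blast
qed

instance L2 :: complete_space
proof
  fix X :: "nat \<Rightarrow> L2" assume X: "Cauchy X"
  have "\<exists>N. \<forall>m\<ge>N. \<forall>n\<ge>N. norm (X m - X n) < (1/2) ^ k" for k
    using CauchyD[OF X, of "(1/2) ^ k"] by simp
  then obtain N where N: "\<And>k m n. m \<ge> N k \<Longrightarrow> n \<ge> N k \<Longrightarrow> norm (X m - X n) < (1/2) ^ k" by metis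
  define r where "r = rec_nat (N 0) (\<lambda>k s. max (Suc s) (N (Suc k)))"
  have r_Suc: "r (Suc k) = max (Suc (r k)) (N (Suc k))" for k by (simp add: r_def)
  have r: "r k < r (Suc k)" for k unfolding r_Suc by simp
  have Nr: "N k \<le> r k" for k
  proof (cases k)
    case 0
    then show ?thesis by (simp add: r_def)
  next
    case (Suc j)
    show ?thesis unfolding Suc r_Suc by simp
  qed
  have mono: "strict_mono r" using r by (simp add: strict_mono_Suc_iff)
  have "norm ((X \<circ> r) k - (X \<circ> r) n) \<le> (1/2) ^ n" if "k \<ge> n" for n k
  proof -
    have "r n \<le> r k" using mono that by (simp add: strict_mono_less_eq)
    then show ?thesis using N[of n "r k" "r n"] Nr[of n] by (simp add: less_imp_le)
  qed
  then obtain l where "(X \<circ> r) \<longlonglongrightarrow> l" using L2_fast_Cauchy_convergent[of "X \<circ> r"] by (auto simp: convergent_def)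
  then have "X \<longlonglongrightarrow> l" by (rule Cauchy_converges_subseq[OF X mono])
  then show "convergent X" by (auto simp: convergent_def)
qed

section \<open>Bounded functions, products and conjugates\<close>

lemma Linf_norm_props:
  assumes "\<phi> \<in> Linf"
  shows AE_le_Linf_norm: "AE z in \<mu>. cmod (rep_L2 \<phi> z) \<le> Linf_norm \<phi>"
    and Linf_norm_nonneg: "Linf_norm \<phi> \<ge> 0"
proof -
  let ?e = "esssup \<mu> (\<lambda>z. ereal (cmod (rep_L2 \<phi> z)))"
  have "?e < \<infinity>" using assms by (simp add: Linf_def ess_sup_norm.rep_eq)
  moreover have "0 \<le> ?e"
  proof -
    have "esssup \<mu> (\<lambda>z. 0::ereal) \<le> ?e" by (rule esssup_mono) auto
    then show ?thesis using circle.emeasure_space_1 by (simp add: esssup_const)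
  qed
  ultimately have e: "ereal (Linf_norm \<phi>) = ?e"
    by (simp add: Linf_norm_def ess_sup_norm.rep_eq ereal_real')
  show "Linf_norm \<phi> \<ge> 0" using \<open>0 \<le> ?e\<close> by (simp flip: e)
  show "AE z in \<mu>. cmod (rep_L2 \<phi> z) \<le> Linf_norm \<phi>"
    using esssup_AE[of "\<lambda>z. ereal (cmod (rep_L2 \<phi> z))" \<mu>] unfolding e[symmetric] by simp
qed

lemma LinfI:
  assumes "AE z in \<mu>. cmod (rep_L2 \<phi> z) \<le> C"
  shows "\<phi> \<in> Linf" and "Linf_norm \<phi> \<le> C"
proof -
  have *: "esssup \<mu> (\<lambda>z. ereal (cmod (rep_L2 \<phi> z))) \<le> ereal C"
    using assms by (intro esssup_I) auto
  then have "esssup \<mu> (\<lambda>z. ereal (cmod (rep_L2 \<phi> z))) < \<infinity>"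
    by (rule le_less_trans) simp
  then show mem: "\<phi> \<in> Linf" by (simp add: Linf_def ess_sup_norm.rep_eq)
  show "Linf_norm \<phi> \<le> C"
  proof (rule ccontr)
    assume "\<not> Linf_norm \<phi> \<le> C"
    moreover have "ereal (Linf_norm \<phi>) = ess_sup_norm \<phi>" 
    proof -
      have "0 \<le> ess_sup_norm \<phi>"
      proof -
        have "esssup \<mu> (\<lambda>z. 0::ereal) \<le> ess_sup_norm \<phi>"
          unfolding ess_sup_norm.rep_eq by (rule esssup_mono) auto
        then show ?thesis using circle.emeasure_space_1 by (simp add: esssup_const)
      qed
      then show ?thesis using mem by (simp add: Linf_norm_def Linf_def ereal_real')
    qed
    ultimately show False using * by (simp add: ess_sup_norm.rep_eq flip: ereal_less_eq(3))
  qed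
qed

lemma zpow_Linf [simp]: "zpow n \<in> Linf"
  by (rule LinfI(1)[where C = 1]) (use rep_zpow[of n] AE_norm_circle_measure in \<open>eventually_elim, simp add: norm_power_int\<close>)

lemma Linf_add:
  assumes p: "\<phi> \<in> Linf" and q: "\<psi> \<in> Linf"
  shows "\<phi> + \<psi> \<in> Linf"
proof (rule LinfI(1))
  show "AE z in \<mu>. cmod (rep_L2 (\<phi> + \<psi>) z) \<le> Linf_norm \<phi> + Linf_norm \<psi>"
    using rep_plus[of \<phi> \<psi>] AE_le_Linf_norm[OF p] AE_le_Linf_norm[OF q]
    by eventually_elim (simp add: norm_triangle_mono)
qed

lemma Linf_scaleC:
  assumes p: "\<phi> \<in> Linf"
  shows "c *\<^sub>C \<phi> \<in> Linf"
  by (rule LinfI(1)[where C = "cmod c * Linf_norm \<phi>"])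
    (use rep_scaleC[of c \<phi>] AE_le_Linf_norm[OF p] in \<open>eventually_elim, simp add: norm_mult mult_left_mono\<close>)

lemma Linf_zero: "0 \<in> Linf"
  by (rule LinfI(1)[where C = 0]) (use rep_zero in \<open>eventually_elim, simp\<close>)

lemma sq_integrable_bounded_mult:
  assumes [measurable]: "u \<in> borel_measurable \<mu>"
    and "AE z in \<mu>. cmod (u z) \<le> C" and v: "sq_integrable v"
  shows "sq_integrable (\<lambda>z. u z * v z)"
proof -
  note [measurable] = sq_integrable_meas[OF v]
  have "integrable \<mu> (\<lambda>z. (cmod (u z * v z))\<^sup>2)"
  proof (rule Bochner_Integration.integrable_bound)
    show "integrable \<mu> (\<lambda>z. C\<^sup>2 * (cmod (v z))\<^sup>2)" using sq_integrable_int[OF v] by simp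
    show "AE z in \<mu>. norm ((cmod (u z * v z))\<^sup>2) \<le> norm (C\<^sup>2 * (cmod (v z))\<^sup>2)"
      using assms(2) by eventually_elim (simp add: norm_mult power_mult_distrib mult_right_mono power_mono)
  qed simp
  then show ?thesis by (simp add: sq_integrable_def)
qed

lemma rep_mult_sq:
  assumes "sq_integrable (\<lambda>z. rep_L2 f z * rep_L2 g z)"
  shows "AE z in \<mu>. rep_L2 (f *\<^sub>L g) z = rep_L2 f z * rep_L2 g z"
proof -
  have "f *\<^sub>L g = abs_L2 (\<lambda>z. rep_L2 f z * rep_L2 g z)"
    using L2_mult.abs_eq[of "rep_L2 f" "rep_L2 g"] assms by simp
  then show ?thesis using rep_abs_L2[OF assms] by simp
qed

lemma L2_mult_commute: "f *\<^sub>L g = g *\<^sub>L f"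
  using L2_mult.abs_eq[of "rep_L2 f" "rep_L2 g"] L2_mult.abs_eq[of "rep_L2 g" "rep_L2 f"]
  by (simp add: mult.commute)

lemma rep_mult:
  assumes "a \<in> Linf"
  shows "AE z in \<mu>. rep_L2 (a *\<^sub>L f) z = rep_L2 a z * rep_L2 f z"
  by (rule rep_mult_sq, rule sq_integrable_bounded_mult[OF _ AE_le_Linf_norm[OF assms]]) simp_all

lemma rep_mult':
  "a \<in> Linf \<Longrightarrow> AE z in \<mu>. rep_L2 (f *\<^sub>L a) z = rep_L2 f z * rep_L2 a z"
  using rep_mult[of a f] by (simp add: L2_mult_commute mult.commute)

lemma Linf_mult:
  assumes a: "a \<in> Linf" and b: "b \<in> Linf"
  shows "a *\<^sub>L b \<in> Linf"
proof (rule LinfI(1))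
  show "AE z in \<mu>. cmod (rep_L2 (a *\<^sub>L b) z) \<le> Linf_norm a * Linf_norm b"
    using rep_mult[OF a, of b] AE_le_Linf_norm[OF a] AE_le_Linf_norm[OF b]
    by eventually_elim (simp add: norm_mult mult_mono Linf_norm_nonneg[OF a])
qed

lemma norm_mult_le:
  assumes a: "a \<in> Linf"
  shows "norm (a *\<^sub>L f) \<le> Linf_norm a * norm f"
proof -
  have "AE z in \<mu>. cmod (rep_L2 (a *\<^sub>L f) z) \<le>
      cmod (rep_L2 (complex_of_real (Linf_norm a) *\<^sub>C f) z)"
    using rep_mult[OF a, of f] rep_scaleC[of "complex_of_real (Linf_norm a)" f] AE_le_Linf_norm[OF a]
    by eventually_elim (simp add: norm_mult mult_right_mono Linf_norm_nonneg[OF a])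
  then have "norm (a *\<^sub>L f) \<le> norm (complex_of_real (Linf_norm a) *\<^sub>C f)" by (rule norm_le_AE)
  then show ?thesis using Linf_norm_nonneg[OF a] by (simp add: norm_scaleC)
qed

lemma mult_add_right:
  assumes a: "a \<in> Linf"
  shows "a *\<^sub>L (f + g) = a *\<^sub>L f + a *\<^sub>L g"
  by (rule L2_eqI)
    (use rep_mult[OF a, of f] rep_mult[OF a, of g] rep_mult[OF a, of "f + g"] rep_plus[of f g]
      rep_plus[of "a *\<^sub>L f" "a *\<^sub>L g"] in \<open>eventually_elim, simp add: algebra_simps\<close>)

lemma mult_scaleC_right:
  assumes a: "a \<in> Linf"
  shows "a *\<^sub>L (c *\<^sub>C f) = c *\<^sub>C (a *\<^sub>L f)"
  by (rule L2_eqI)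
    (use rep_mult[OF a, of f] rep_mult[OF a, of "c *\<^sub>C f"] rep_scaleC[of c f] rep_scaleC[of c "a *\<^sub>L f"]
      in \<open>eventually_elim, simp\<close>)

lemma mult_diff_right: "a \<in> Linf \<Longrightarrow> a *\<^sub>L (f - g) = a *\<^sub>L f - a *\<^sub>L g"
  using mult_add_right[of a f "(-1) *\<^sub>C g"] mult_scaleC_right[of a "-1" g]
  by (simp add: scaleC_minus1)

lemma mult_add_left:
  assumes a: "a \<in> Linf" and b: "b \<in> Linf"
  shows "(a + b) *\<^sub>L f = a *\<^sub>L f + b *\<^sub>L f"
  by (rule L2_eqI)
    (use rep_mult[OF a, of f] rep_mult[OF b, of f] rep_mult[OF Linf_add[OF a b], of f] rep_plus[of a b]
      rep_plus[of "a *\<^sub>L f" "b *\<^sub>L f"] in \<open>eventually_elim, simp add: algebra_simps\<close>)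

lemma mult_scaleC_left:
  assumes a: "a \<in> Linf"
  shows "(c *\<^sub>C a) *\<^sub>L f = c *\<^sub>C (a *\<^sub>L f)"
  by (rule L2_eqI)
    (use rep_mult[OF a, of f] rep_mult[OF Linf_scaleC[OF a], of c f] rep_scaleC[of c a]
      rep_scaleC[of c "a *\<^sub>L f"] in \<open>eventually_elim, simp\<close>)

lemma mult_assoc:
  assumes a: "a \<in> Linf" and b: "b \<in> Linf"
  shows "a *\<^sub>L (b *\<^sub>L f) = (a *\<^sub>L b) *\<^sub>L f"
  by (rule L2_eqI)
    (use rep_mult[OF a, of b] rep_mult[OF a, of "b *\<^sub>L f"] rep_mult[OF b, of f]
      rep_mult[OF Linf_mult[OF a b], of f] in \<open>eventually_elim, simp\<close>)

lemma zpow_mult: "zpow m *\<^sub>L zpow n = zpow (m + n)"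
proof (rule L2_eqI)
  show "AE z in \<mu>. rep_L2 (zpow m *\<^sub>L zpow n) z = rep_L2 (zpow (m + n)) z"
    using rep_mult[OF zpow_Linf, of m "zpow n"] rep_zpow[of m] rep_zpow[of n] rep_zpow[of "m + n"]
      AE_norm_circle_measure
  proof eventually_elim
    fix z :: complex assume "norm z = 1"
    then have "z \<noteq> 0" by auto
    moreover assume "rep_L2 (zpow m *\<^sub>L zpow n) z = rep_L2 (zpow m) z * rep_L2 (zpow n) z"
      "rep_L2 (zpow m) z = z powi m" "rep_L2 (zpow n) z = z powi n" "rep_L2 (zpow (m + n)) z = z powi (m + n)"
    ultimately show "rep_L2 (zpow m *\<^sub>L zpow n) z = rep_L2 (zpow (m + n)) z"
      by (simp add: power_int_add)
  qed
qed

lemma one_mult [simp]: "zpow 0 *\<^sub>L f = f"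
  by (rule L2_eqI) (use rep_mult[OF zpow_Linf, of 0 f] rep_zpow[of 0] in \<open>eventually_elim, simp\<close>)

lemma shift_shift: "zpow m *\<^sub>L (zpow n *\<^sub>L f) = zpow (m + n) *\<^sub>L f"
  by (simp add: mult_assoc zpow_mult)

definition conj_L2 :: "L2 \<Rightarrow> L2" where
  "conj_L2 f = abs_L2 (\<lambda>z. cnj (rep_L2 f z))"

lemma sq_integrable_cnj: "sq_integrable u \<Longrightarrow> sq_integrable (\<lambda>z. cnj (u z))"
  by (simp add: sq_integrable_def borel_measurable_cnj)

lemma rep_conj: "AE z in \<mu>. rep_L2 (conj_L2 f) z = cnj (rep_L2 f z)"
  unfolding conj_L2_def by (rule rep_abs_L2[OF sq_integrable_cnj]) simp

lemma conj_Linf: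
  assumes a: "a \<in> Linf"
  shows "conj_L2 a \<in> Linf"
  by (rule LinfI(1)[where C = "Linf_norm a"])
    (use rep_conj[of a] AE_le_Linf_norm[OF a] in \<open>eventually_elim, simp\<close>)

lemma cnj_unit: "cmod w = 1 \<Longrightarrow> cnj w = inverse w"
  using complex_norm_square[of w] inverse_unique[of w "cnj w"] by simp

lemma conj_zpow: "conj_L2 (zpow n) = zpow (- n)"
  by (rule L2_eqI)
    (use rep_conj[of "zpow n"] rep_zpow[of n] rep_zpow[of "-n"] AE_norm_circle_measure in
      \<open>eventually_elim, simp add: power_int_minus cnj_unit norm_power_int del: complex_cnj_power_int\<close>)

lemma cinner_mult:
  assumes a: "a \<in> Linf"
  shows "cinner (a *\<^sub>L f) g = cinner f (conj_L2 a *\<^sub>L g)"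
  by (rule cinner_AE_eqI)
    (use rep_mult[OF a, of f] rep_mult[OF conj_Linf[OF a], of g] rep_conj[of a] in \<open>eventually_elim, simp\<close>)

lemma cinner_shift: "cinner (zpow n *\<^sub>L f) g = cinner f (zpow (- n) *\<^sub>L g)"
  by (simp add: cinner_mult conj_zpow)

lemma unimodular_AE: "unimodular \<theta> \<longleftrightarrow> (AE z in \<mu>. cmod (rep_L2 \<theta> z) = 1)"
  by (simp add: unimodular.rep_eq)

lemma unimodular_Linf: "unimodular \<theta> \<Longrightarrow> \<theta> \<in> Linf"
  unfolding unimodular_AE by (rule LinfI(1)[where C = 1], erule eventually_mono) simp

lemma unimodular_zpow: "unimodular (zpow n)"
  unfolding unimodular_AE
  using rep_zpow[of n] AE_norm_circle_measure by eventually_elim (simp add: norm_power_int)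

lemma unimodular_conj:
  assumes u: "unimodular \<theta>"
  shows "unimodular (conj_L2 \<theta>)"
  unfolding unimodular_AE using rep_conj[of \<theta>] u[unfolded unimodular_AE] by eventually_elim simp

lemma unimodular_norm:
  assumes u: "unimodular \<theta>"
  shows "norm (\<theta> *\<^sub>L f) = norm f"
proof -
  have *: "AE z in \<mu>. cmod (rep_L2 (\<theta> *\<^sub>L f) z) = cmod (rep_L2 f z)"
    using rep_mult[OF unimodular_Linf[OF u], of f] u[unfolded unimodular_AE]
    by eventually_elim (simp add: norm_mult)
  show ?thesis by (intro antisym norm_le_AE) (use * in \<open>eventually_elim, simp\<close>)+
qed

lemma conj_conj [simp]: "conj_L2 (conj_L2 f) = f"
  by (rule L2_eqI) (use rep_conj[of f] rep_conj[of "conj_L2 f"] in \<open>eventually_elim, simp\<close>)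

lemma norm_conj [simp]: "norm (conj_L2 f) = norm f"
  by (intro antisym norm_le_AE; use rep_conj[of f] in \<open>eventually_elim, simp\<close>)

lemma cinner_conj: "cinner (conj_L2 f) (conj_L2 g) = cinner g f"
  by (rule cinner_AE_eqI)
    (use rep_conj[of f] rep_conj[of g] in \<open>eventually_elim, simp add: mult.commute\<close>)

section \<open>Completeness of the trigonometric system\<close>

lemma integral_powi:
  "(LINT z|\<mu>. z powi n) = (if n = 0 then 1 else 0)"
proof (cases "n = 0")
  case True
  then show ?thesis by (simp add: circle_prob_UNIV)
next
  case False
  have [measurable]: "cis \<in> borel_measurable borel"
    by (intro borel_measurable_continuous_onI continuous_intros)
  have [measurable]: "(\<lambda>z::complex. z powi n) \<in> borel_measurable borel"
    using sq_integrable_meas[OF sq_integrable_powi[of n]] by (simp cong: measurable_cong_sets)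
  have um: "uniform_measure lborel {0..<2*pi} = density lborel (\<lambda>t. ennreal (indicator {0..<2*pi} t / (2 * pi)))"
    unfolding uniform_measure_def
    by (intro arg_cong2[where f = density] refl ext)
      (simp add: ennreal_indicator[symmetric] divide_ennreal del: ennreal_indicator)
  have cisn: "cis t powi n = cis (of_int n * t)" for t
    by (simp add: cis_power_int mult.commute)
  have "(LINT z|\<mu>. z powi n) = (LINT t|uniform_measure lborel {0..<2*pi}. cis t powi n)"
    unfolding circle_measure_def by (rule integral_distr) simp_all
  also have "\<dots> = (LINT t|lborel. (indicator {0..<2*pi} t / (2 * pi)) *\<^sub>R (cis t powi n))"
    unfolding um by (rule integral_density) auto
  also have "\<dots> = (LINT t|lborel. (1 / (2 * pi)) *\<^sub>R (indicator {0..2*pi} t *\<^sub>R cis (of_int n * t)))"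
    unfolding cisn
  proof (rule integral_cong_AE)
    have "AE t in lborel. t \<noteq> 2 * pi" by (rule AE_lborel_singleton)
    then show "AE t in lborel. (indicator {0..<2*pi} t / (2 * pi)) *\<^sub>R cis (of_int n * t) =
        (1 / (2 * pi)) *\<^sub>R (indicator {0..2*pi} t *\<^sub>R cis (of_int n * t))"
      by eventually_elim (auto simp: indicator_def)
  qed simp_all
  also have "\<dots> = (1 / (2 * pi)) *\<^sub>R (LINT t|lborel. indicator {0..2*pi} t *\<^sub>R cis (of_int n * t))"
    by (rule integral_scaleR_right)
  also have "(LINT t|lborel. indicator {0..2*pi} t *\<^sub>R cis (of_int n * t)) =
      cis (of_int n * (2 * pi)) / (\<i> * of_int n) - cis (of_int n * 0) / (\<i> * of_int n)"
  proof (rule integral_FTC_atLeastAtMost)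
    fix t :: real assume "0 \<le> t" "t \<le> 2 * pi"
    have "cis (of_int n * t) = exp (t *\<^sub>R (\<i> * of_int n))" for t
      by (simp add: cis_conv_exp scaleR_conv_of_real mult_ac)
    then have "((\<lambda>t. cis (of_int n * t)) has_vector_derivative cis (of_int n * t) * (\<i> * of_int n))
        (at t within {0..2*pi})"
      using exp_scaleR_has_vector_derivative_right[of "\<i> * of_int n" t "{0..2*pi}"] by simp
    from has_vector_derivative_mult_left[OF this, of "1 / (\<i> * of_int n)"]
    show "((\<lambda>t. cis (of_int n * t) / (\<i> * of_int n)) has_vector_derivative cis (of_int n * t)) (at t within {0..2*pi})"
      using False by (simp add: scaleR_conv_of_real field_simps)
  qed (auto intro!: continuous_intros)
  also have "\<dots> = 0" using cis_multiple_2pi[of "of_int n"] by (simp add: mult.commute mult.left_commute)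
  finally show ?thesis using False by simp
qed

text \<open>The integrable functions with vanishing Fourier coefficients. They are invariant under
multiplication by \<open>z\<close> and \<open>z\<^sup>-\<^sup>1\<close>, and so, since \<open>z\<^sup>-\<^sup>1\<close> is the conjugate of \<open>z\<close> on the circle, under
multiplication by real polynomials in the real and imaginary parts of \<open>z\<close>.\<close>

definition trig_null :: "(complex \<Rightarrow> complex) set" where
  "trig_null = {k. integrable \<mu> k \<and> (\<forall>n. (LINT z|\<mu>. z powi n * k z) = 0)}"

lemma bounded_mult_integrable:
  fixes u k :: "complex \<Rightarrow> complex"
  assumes [measurable]: "u \<in> borel_measurable borel" and b: "AE z in \<mu>. cmod (u z) \<le> C"
    and k: "integrable \<mu> k"
  shows "integrable \<mu> (\<lambda>z. u z * k z)"
proof (rule Bochner_Integration.integrable_bound)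
  note [measurable] = borel_measurable_integrable[OF k]
  show "integrable \<mu> (\<lambda>z. C * norm (k z))" using k by simp
  show "AE z in \<mu>. norm (u z * k z) \<le> norm (C * norm (k z))"
    using b
  proof eventually_elim
    fix z assume "cmod (u z) \<le> C"
    then have "cmod (u z) * norm (k z) \<le> \<bar>C\<bar> * norm (k z)" by (intro mult_right_mono) auto
    then show "norm (u z * k z) \<le> norm (C * norm (k z))" by (simp add: norm_mult abs_mult)
  qed
  show "(\<lambda>z. u z * k z) \<in> borel_measurable \<mu>"
    by (intro borel_measurable_times) (simp_all cong: measurable_cong_sets)
qed

lemma powi_measurable [measurable]: "(\<lambda>z::complex. z powi n) \<in> borel_measurable borel"
  using sq_integrable_meas[OF sq_integrable_powi[of n]] by (simp cong: measurable_cong_sets)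

lemma AE_powi_bounded: "AE z in \<mu>. cmod (z powi n) \<le> 1"
  using AE_norm_circle_measure by eventually_elim (simp add: norm_power_int)

lemma trig_null_comb:
  assumes k: "k \<in> trig_null"
  shows "(\<lambda>z. (a * z powi m + b * z powi j) * k z) \<in> trig_null"
proof -
  have int: "integrable \<mu> (\<lambda>z. z powi n * k z)" for n
    using k by (intro bounded_mult_integrable[OF _ AE_powi_bounded]) (auto simp: trig_null_def)
  have int': "integrable \<mu> (\<lambda>z. a * (z powi m * k z) + b * (z powi j * k z))" for a b m j
    using int by auto
  have "(LINT z|\<mu>. z powi n * ((a * z powi m + b * z powi j) * k z)) = 0" for n
  proof -
    note [measurable] = borel_measurable_integrable[OF int'] borel_measurable_integrable[OF int]
    have "(LINT z|\<mu>. z powi n * ((a * z powi m + b * z powi j) * k z)) =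
        (LINT z|\<mu>. a * (z powi (n + m) * k z) + b * (z powi (n + j) * k z))"
    proof (rule integral_cong_AE)
      have "integrable \<mu> (\<lambda>z. z powi n * (a * (z powi m * k z) + b * (z powi j * k z)))"
        by (rule bounded_mult_integrable[OF _ AE_powi_bounded int']) simp
      then show "(\<lambda>z. z powi n * ((a * z powi m + b * z powi j) * k z)) \<in> borel_measurable \<mu>"
        by (simp add: algebra_simps borel_measurable_integrable)
      show "AE z in \<mu>. z powi n * ((a * z powi m + b * z powi j) * k z) =
          a * (z powi (n + m) * k z) + b * (z powi (n + j) * k z)"
        using AE_norm_circle_measure
      proof eventually_elim
        fix z :: complex assume "norm z = 1"
        then have "z \<noteq> 0" by auto
        then show "z powi n * ((a * z powi m + b * z powi j) * k z) =
            a * (z powi (n + m) * k z) + b * (z powi (n + j) * k z)"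
          by (simp add: power_int_add algebra_simps)
      qed
    qed simp
    also have "\<dots> = a * (LINT z|\<mu>. z powi (n + m) * k z) + b * (LINT z|\<mu>. z powi (n + j) * k z)"
      using int by simp
    also have "\<dots> = 0" using k by (simp add: trig_null_def)
    finally show ?thesis .
  qed
  moreover have "integrable \<mu> (\<lambda>z. (a * z powi m + b * z powi j) * k z)"
    using int'[of a m b j] by (simp add: algebra_simps)
  ultimately show ?thesis by (simp add: trig_null_def)
qed

lemma trig_null_cong:
  assumes k: "k \<in> trig_null" and l: "l \<in> borel_measurable \<mu>"
    and eq: "AE z in \<mu>. k z = l z"
  shows "l \<in> trig_null"
proof -
  have ki: "integrable \<mu> k" using k by (simp add: trig_null_def)
  have int: "integrable \<mu> l"
    using integrable_cong_AE_imp[OF ki l] eq by (simp add: eq_commute)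
  have "(LINT z|\<mu>. z powi n * l z) = (LINT z|\<mu>. z powi n * k z)" for n
  proof (rule integral_cong_AE)
    show "(\<lambda>z. z powi n * l z) \<in> borel_measurable \<mu>"
      "(\<lambda>z. z powi n * k z) \<in> borel_measurable \<mu>"
      using bounded_mult_integrable[OF _ AE_powi_bounded int] bounded_mult_integrable[OF _ AE_powi_bounded ki]
      by (auto intro: borel_measurable_integrable)
  qed (use eq in \<open>auto elim: eventually_mono\<close>)
  then show ?thesis using int k by (simp add: trig_null_def)
qed

lemma trig_null_polynomial:
  assumes "real_polynomial_function q" "k \<in> trig_null"
  shows "(\<lambda>z. complex_of_real (q z) * k z) \<in> trig_null"
  using assms
proof (induction arbitrary: k)
  case (linear f)
  define a b where "a = (complex_of_real (f 1) - \<i> * complex_of_real (f \<i>)) / 2"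
    and "b = (complex_of_real (f 1) + \<i> * complex_of_real (f \<i>)) / 2"
  show ?case
  proof (rule trig_null_cong[OF trig_null_comb[OF linear.prems, of a 1 b "-1"]])
    have [measurable]: "f \<in> borel_measurable borel"
      by (intro borel_measurable_continuous_onI linear_continuous_on linear.hyps)
    have "k \<in> borel_measurable \<mu>" using linear.prems by (auto simp: trig_null_def)
    then show "(\<lambda>z. complex_of_real (f z) * k z) \<in> borel_measurable \<mu>"
      by (intro borel_measurable_times) (simp_all cong: measurable_cong_sets)
    show "AE z in \<mu>. (a * z powi 1 + b * z powi - 1) * k z = complex_of_real (f z) * k z"
      using AE_norm_circle_measure
    proof eventually_elim
      fix z :: complex assume z: "norm z = 1"
      interpret bounded_linear f by (rule linear.hyps)
      have "z = Re z *\<^sub>R 1 + Im z *\<^sub>R \<i>" by (simp add: complex_eq_iff)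
      then have "f z = Re z * f 1 + Im z * f \<i>" by (metis add scaleR real_scaleR_def)
      moreover have "z powi - 1 = cnj z" using z by (simp add: power_int_minus cnj_unit)
      ultimately have "a * z powi 1 + b * z powi - 1 = complex_of_real (f z)"
        by (simp add: a_def b_def complex_eq_iff) (simp add: field_simps)
      then show "(a * z powi 1 + b * z powi - 1) * k z = complex_of_real (f z) * k z" by simp
    qed
  qed
next
  case (const c)
  then show ?case using trig_null_comb[OF const, of "complex_of_real c" 0 0 0] by simp
next
  case (add f g)
  note fk = add.IH(1)[OF add.prems] and gk = add.IH(2)[OF add.prems]
  have i: "integrable \<mu> (\<lambda>z. complex_of_real (f z) * k z)"
    "integrable \<mu> (\<lambda>z. complex_of_real (g z) * k z)" using fk gk by (auto simp: trig_null_def)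
  have "(LINT z|\<mu>. z powi n * (complex_of_real (f z) * k z) + z powi n * (complex_of_real (g z) * k z)) = 0" for n
    using fk gk i by (subst Bochner_Integration.integral_add)
      (auto simp: trig_null_def intro!: bounded_mult_integrable[OF _ AE_powi_bounded])
  then show ?case using i by (simp add: trig_null_def algebra_simps)
next
  case (mult f g)
  then show ?case using mult.IH(1)[OF mult.IH(2)[OF mult.prems]] by (simp add: mult.assoc)
qed

lemma trig_null_continuous:
  assumes k: "k \<in> trig_null" and f: "continuous_on UNIV (f :: complex \<Rightarrow> real)"
  shows "(LINT z|\<mu>. complex_of_real (f z) * k z) = 0"
proof -
  have ki: "integrable \<mu> k" using k by (simp add: trig_null_def)
  have fm: "(\<lambda>z. complex_of_real (f z)) \<in> borel_measurable borel"
    by (intro borel_measurable_continuous_onI continuous_intros f)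
  have "compact (f ` sphere 0 1)" by (intro compact_continuous_image continuous_on_subset[OF f]) auto
  then have "bounded (f ` sphere 0 1)" by (rule compact_imp_bounded)
  then obtain C where "\<forall>x\<in>f ` sphere 0 1. norm x \<le> C" unfolding bounded_iff by blast
  then have C: "\<bar>f z\<bar> \<le> C" if "norm z = 1" for z using that by simp
  have fi: "integrable \<mu> (\<lambda>z. complex_of_real (f z) * k z)"
    by (rule bounded_mult_integrable[OF fm _ ki, where C = C])
      (use AE_norm_circle_measure in \<open>eventually_elim, simp add: C\<close>)
  have small: "cmod (LINT z|\<mu>. complex_of_real (f z) * k z) \<le> e * (LINT z|\<mu>. cmod (k z))"
    if e: "e > 0" for e
  proof -
    obtain q where q: "real_polynomial_function q" "\<And>z. z \<in> sphere 0 1 \<Longrightarrow> \<bar>f z - q z\<bar> < e"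
      using Stone_Weierstrass_real_polynomial_function[OF compact_sphere continuous_on_subset[OF f] e] by blast
    note qk = trig_null_polynomial[OF q(1) k]
    then have qi: "integrable \<mu> (\<lambda>z. complex_of_real (q z) * k z)"
      and "(LINT z|\<mu>. complex_of_real (q z) * k z) = 0"
      by (auto simp: trig_null_def dest: spec[of _ 0])
    then have "(LINT z|\<mu>. complex_of_real (f z) * k z) =
        (LINT z|\<mu>. complex_of_real (f z) * k z - complex_of_real (q z) * k z)"
      using fi by simp
    also have "cmod \<dots> \<le> (LINT z|\<mu>. cmod (complex_of_real (f z) * k z - complex_of_real (q z) * k z))"
      by (rule integral_norm_bound)
    also have "\<dots> \<le> (LINT z|\<mu>. e * cmod (k z))"
    proof (rule integral_mono_AE)
      show "AE z in \<mu>. cmod (complex_of_real (f z) * k z - complex_of_real (q z) * k z) \<le> e * cmod (k z)"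
        using AE_norm_circle_measure
      proof eventually_elim
        fix z :: complex assume "norm z = 1"
        then have "\<bar>f z - q z\<bar> \<le> e" using q(2)[of z] by simp
        moreover have "complex_of_real (f z) * k z - complex_of_real (q z) * k z = complex_of_real (f z - q z) * k z"
          by (simp add: algebra_simps)
        ultimately show "cmod (complex_of_real (f z) * k z - complex_of_real (q z) * k z) \<le> e * cmod (k z)"
          by (simp add: norm_mult mult_right_mono del: of_real_diff)
      qed
    qed (use fi qi ki in auto)
    finally show ?thesis by simp
  qed
  have "cmod (LINT z|\<mu>. complex_of_real (f z) * k z) \<le> 0 + d" if "d > 0" for d
  proof -
    let ?I = "LINT z|\<mu>. cmod (k z)"
    have I: "?I \<ge> 0" by simp
    have "cmod (LINT z|\<mu>. complex_of_real (f z) * k z) \<le> d / (?I + 1) * ?I"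
    proof (intro small divide_pos_pos)
      show "0 < ?I + 1" using I by linarith
    qed (fact that)
    also have "\<dots> = d * (?I / (?I + 1))" by simp
    also have "\<dots> \<le> d * 1"
    proof (intro mult_left_mono)
      have "?I + 1 > 0" using I by linarith
      then show "?I / (?I + 1) \<le> 1" by (subst pos_divide_le_eq) auto
    qed (use that in simp)
    finally show ?thesis by simp
  qed
  then have "cmod (LINT z|\<mu>. complex_of_real (f z) * k z) \<le> 0" by (rule field_le_epsilon)
  then show ?thesis by simp
qed

text \<open>An integrable function on the circle with vanishing Fourier coefficients is zero: by the
Stone--Weierstrass theorem it annihilates the continuous functions, hence the indicator functions
of closed sets, and these generate the Borel sets.\<close>

lemma fourier_unique:
  assumes int: "integrable \<mu> k"
    and zero: "\<And>n. (LINT z|\<mu>. z powi n * k z) = 0"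
  shows "AE z in \<mu>. k z = 0"
proof (rule circle.density_zero[OF int])
  have k: "k \<in> trig_null" using assms by (simp add: trig_null_def)
  note [measurable] = borel_measurable_integrable[OF int]
  have set_int: "set_integrable \<mu> A k" if "A \<in> sets borel" for A
    unfolding set_integrable_def using that int by (intro integrable_mult_indicator) auto
  fix A assume "A \<in> sets \<mu>"
  then have A: "A \<in> sigma_sets UNIV (Collect closed)" by (simp add: borel_eq_closed)
  have "Int_stable (Collect closed :: complex set set)" by (auto simp: Int_stable_def)
  moreover have "Collect closed \<subseteq> Pow (UNIV :: complex set)" by simp
  ultimately show "set_lebesgue_integral \<mu> A k = 0"
    using A
  proof (induction rule: sigma_sets_induct_disjoint)
    case (basic C)
    then have C: "closed C" by simp
    show ?case
    proof (cases "C = {}")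
      case False
      define f where "f m z = max 0 (1 - real m * infdist z C)" for m z
      have fc: "continuous_on UNIV (f m)" for m unfolding f_def by (intro continuous_intros)
      have lim: "(\<lambda>m. complex_of_real (f m z)) \<longlonglongrightarrow> indicator C z" for z
      proof (cases "z \<in> C")
        case True
        then show ?thesis by (simp add: f_def)
      next
        case no: False
        then have pos: "infdist z C > 0"
          using C False by (meson infdist_pos_not_in_closed)
        then obtain M where M: "1 < real M * infdist z C" using reals_Archimedean3 by blast
        have "f m z = 0" if "m \<ge> M" for m
        proof -
          have "real M * infdist z C \<le> real m * infdist z C" using that pos by simp
          then show ?thesis using M by (simp add: f_def)
        qed
        then have "\<forall>\<^sub>F m in sequentially. complex_of_real (f m z) = indicator C z"
          using no by (auto simp: eventually_sequentially)
        then show ?thesis by (rule tendsto_eventually)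
      qed
      have "(\<lambda>m. LINT z|\<mu>. complex_of_real (f m z) * k z) \<longlonglongrightarrow> (LINT z|\<mu>. indicator C z * k z)"
      proof (rule integral_dominated_convergence)
        show "integrable \<mu> (\<lambda>z. norm (k z))" using int by simp
        show "(\<lambda>z. indicator C z * k z) \<in> borel_measurable \<mu>"
          using C by (intro borel_measurable_times borel_measurable_indicator) auto
        show "(\<lambda>z. complex_of_real (f m z) * k z) \<in> borel_measurable \<mu>" for m
          by (intro borel_measurable_times)
            (use borel_measurable_continuous_onI[OF fc[of m]] in \<open>simp_all cong: measurable_cong_sets\<close>)
        show "AE z in \<mu>. (\<lambda>m. complex_of_real (f m z) * k z) \<longlonglongrightarrow> indicator C z * k z"
          by (intro AE_I2 tendsto_intros lim)
        show "AE z in \<mu>. norm (complex_of_real (f m z) * k z) \<le> norm (k z)" for m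
        proof (rule AE_I2)
          fix z
          have "\<bar>f m z\<bar> \<le> 1" by (auto simp: f_def infdist_nonneg)
          then show "norm (complex_of_real (f m z) * k z) \<le> norm (k z)"
            by (simp add: norm_mult mult_left_le_one_le)
        qed
      qed
      then have "(LINT z|\<mu>. indicator C z * k z) = 0"
        using trig_null_continuous[OF k fc] by (simp add: LIMSEQ_const_iff)
      then show ?thesis
        by (simp add: set_lebesgue_integral_def scaleR_conv_of_real of_real_indicator)
    qed (simp add: set_lebesgue_integral_def)
  next
    case empty
    show ?case by (simp add: set_lebesgue_integral_def)
  next
    case (compl A)
    then have A: "A \<in> sets borel" by (simp add: borel_eq_closed)
    have "(LINT z|\<mu>. k z) = 0" using zero[of 0] by simp
    moreover have "set_lebesgue_integral \<mu> (UNIV - A) k =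
        (LINT z|\<mu>. k z) - set_lebesgue_integral \<mu> A k"
    proof -
      have "set_lebesgue_integral \<mu> (A \<union> (UNIV - A)) k =
          set_lebesgue_integral \<mu> A k + set_lebesgue_integral \<mu> (UNIV - A) k"
        by (rule set_integral_Un) (use A set_int in auto)
      then show ?thesis by (simp add: set_lebesgue_integral_def)
    qed
    ultimately show ?case using compl by simp
  next
    case (union A)
    have A: "A i \<in> sets borel" for i using union(2) by (auto simp: borel_eq_closed)
    have "set_lebesgue_integral \<mu> (\<Union>i. A i) k = (\<Sum>i. set_lebesgue_integral \<mu> (A i) k)"
      by (rule lebesgue_integral_countable_add)
        (use A union(1) set_int in \<open>auto simp: disjoint_family_on_def\<close>)
    then show ?case using union(3) by simp
  qed
qed

lemma rep_zpow_cnj: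
  "AE z in \<mu>. rep_L2 (zpow m) z * cnj (rep_L2 (zpow n) z) = z powi (m - n)"
  using rep_zpow[of m] rep_zpow[of n] AE_norm_circle_measure
proof eventually_elim
  fix z :: complex assume "norm z = 1" and r: "rep_L2 (zpow m) z = z powi m" "rep_L2 (zpow n) z = z powi n"
  then have "z \<noteq> 0" "cnj (z powi n) = z powi (- n)"
    by (auto simp: cnj_unit norm_power_int power_int_minus simp del: complex_cnj_power_int)
  then show "rep_L2 (zpow m) z * cnj (rep_L2 (zpow n) z) = z powi (m - n)"
    unfolding r using power_int_add[of z m "- n"] by (simp del: complex_cnj_power_int)
qed

lemma cinner_zpow_zpow: "cinner (zpow m) (zpow n) = (if m = n then 1 else 0)"
proof -
  have "cinner (zpow m) (zpow n) = (LINT z|\<mu>. z powi (m - n))"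
    by (rule cinner_AE_eq_integral[OF _ rep_zpow_cnj]) (simp cong: measurable_cong_sets)
  then show ?thesis by (simp add: integral_powi)
qed

lemma zpow_onb: "is_onb UNIV (range zpow)"
proof -
  have inj: "zpow m = zpow n \<longleftrightarrow> m = n" for m n
    using cinner_zpow_zpow[of m n] cinner_zpow_zpow[of m m] by (metis zero_neq_one)
  have "f = 0" if f: "f \<in> orth_compl (range zpow)" for f
  proof -
    have "AE z in \<mu>. rep_L2 f z = 0"
    proof (rule fourier_unique)
      show "integrable \<mu> (rep_L2 f)" by (rule L1_le_L2_norm) simp
      show "(LINT z|\<mu>. z powi n * rep_L2 f z) = 0" for n
      proof -
        have "cinner f (zpow (- n)) = (LINT z|\<mu>. z powi n * rep_L2 f z)"
        proof (rule cinner_AE_eq_integral)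
          show "AE z in \<mu>. rep_L2 f z * cnj (rep_L2 (zpow (- n)) z) = z powi n * rep_L2 f z"
            using rep_zpow[of "- n"] AE_norm_circle_measure
            by eventually_elim
              (simp add: power_int_minus cnj_unit norm_power_int norm_inverse del: complex_cnj_power_int complex_cnj_inverse)
          show "(\<lambda>z. z powi n * rep_L2 f z) \<in> borel_measurable \<mu>"
            by (intro borel_measurable_times) (simp_all cong: measurable_cong_sets)
        qed
        then show ?thesis using f by (simp add: orth_compl_def)
      qed
    qed
    then show "f = 0" using rep_zero by (intro L2_eqI) (auto elim: eventually_elim2)
  qed
  then show ?thesis
    using closed_csubspaceD(1)[OF closed_csubspace_orth_compl]
    by (auto simp: is_onb_def cinner_zpow_zpow inj)
qed

lemma closed_csubspace_UNIV: "closed_csubspace UNIV"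
  by (simp add: closed_csubspace_def)

section \<open>Hardy spaces and model spaces\<close>

text \<open>The orthogonal complement of \<open>H\<^sup>2\<close>, that is, the complex conjugate of \<open>z H\<^sup>2\<close>.\<close>

definition coH2 :: "L2 set" where
  "coH2 = {f. \<forall>n\<ge>0. cinner f (zpow n) = 0}"

text \<open>Each summand of the Parseval formula has a factor that vanishes.\<close>

lemma coH2_orth_H2:
  assumes "f \<in> coH2" "g \<in> H2"
  shows "cinner f g = 0"
proof -
  have "((\<lambda>e. cinner f e * cinner e g) has_sum cinner f g) (range zpow)"
    by (rule onb_parseval[OF closed_csubspace_UNIV zpow_onb]) simp
  moreover have "cinner f e * cinner e g = 0" if "e \<in> range zpow" for e
  proof -
    from that obtain n where e: "e = zpow n" by blast
    have "cinner g (zpow n) = 0 \<Longrightarrow> cinner (zpow n) g = 0" by (subst cinner_commute) simp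
    then show ?thesis using assms by (cases "n \<ge> 0") (auto simp: e coH2_def H2_def)
  qed
  ultimately have "((\<lambda>e. 0) has_sum cinner f g) (range zpow)"
    by (simp cong: has_sum_cong)
  then show ?thesis using has_sum_0 has_sum_unique by (metis (mono_tags, lifting))
qed

lemma H2_orth_coH2: "g \<in> H2 \<Longrightarrow> f \<in> coH2 \<Longrightarrow> cinner g f = 0"
  using coH2_orth_H2[of f g] by (metis cinner_commute complex_cnj_zero)

lemma zpow_H2: "n \<ge> 0 \<Longrightarrow> zpow n \<in> H2"
  by (auto simp: H2_def cinner_zpow_zpow)

lemma zpow_coH2: "n < 0 \<Longrightarrow> zpow n \<in> coH2"
  by (auto simp: coH2_def cinner_zpow_zpow)

lemma coH2I: "(\<And>u. u \<in> H2 \<Longrightarrow> cinner f u = 0) \<Longrightarrow> f \<in> coH2"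
  using zpow_H2 by (auto simp: coH2_def)

lemma closed_csubspace_H2: "closed_csubspace H2"
proof -
  have "H2 = orth_compl (zpow ` {..<0})" by (auto simp: H2_def orth_compl_def)
  then show ?thesis using closed_csubspace_orth_compl by metis
qed

lemma closed_csubspace_coH2: "closed_csubspace coH2"
proof -
  have "coH2 = orth_compl (zpow ` {0..})" by (auto simp: coH2_def orth_compl_def)
  then show ?thesis using closed_csubspace_orth_compl by metis
qed

lemma Hinf_Linf: "a \<in> Hinf \<Longrightarrow> a \<in> Linf" and Hinf_H2: "a \<in> Hinf \<Longrightarrow> a \<in> H2"
  by (auto simp: Hinf_def)

text \<open>For \<open>n < 0\<close> the conjugate of \<open>a\<close> times \<open>z\<^sup>n\<close> has only negative frequencies, so it is orthogonal
to \<open>u\<close>.\<close>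

lemma Hinf_mult_H2:
  assumes a: "a \<in> Hinf" and u: "u \<in> H2"
  shows "a *\<^sub>L u \<in> H2"
proof -
  have "cinner (a *\<^sub>L u) (zpow n) = 0" if n: "n < 0" for n
  proof -
    have "conj_L2 a *\<^sub>L zpow n \<in> coH2"
      unfolding coH2_def
    proof (intro CollectI allI impI)
      fix m :: int assume m: "m \<ge> 0"
      have "cinner (conj_L2 a *\<^sub>L zpow n) (zpow m) = cinner (zpow n *\<^sub>L zpow (- m)) (a)"
        using cinner_shift[of "- m" "zpow n" a] cinner_mult[OF conj_Linf[OF Hinf_Linf[OF a]], of "zpow n" "zpow m"]
        by (simp add: L2_mult_commute)
      also have "\<dots> = cnj (cinner a (zpow (n - m)))" by (subst cinner_commute) (simp add: zpow_mult)
      also have "\<dots> = 0" using Hinf_H2[OF a] m n by (simp add: H2_def)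
      finally show "cinner (conj_L2 a *\<^sub>L zpow n) (zpow m) = 0" .
    qed
    then show ?thesis using H2_orth_coH2[OF u] by (simp add: cinner_mult[OF Hinf_Linf[OF a]])
  qed
  then show ?thesis by (simp add: H2_def)
qed

lemma conj_Hinf_mult_coH2:
  assumes a: "a \<in> Hinf" and f: "f \<in> coH2"
  shows "conj_L2 a *\<^sub>L f \<in> coH2"
  by (rule coH2I)
    (simp add: cinner_mult[OF conj_Linf[OF Hinf_Linf[OF a]]] coH2_orth_H2[OF f Hinf_mult_H2[OF a]])

lemma zpow_Hinf: "n \<ge> 0 \<Longrightarrow> zpow n \<in> Hinf"
  by (simp add: Hinf_def zpow_H2)

lemma shift_conj_H2_in_coH2:
  assumes b: "b \<in> H2" and n: "n < 0"
  shows "zpow n *\<^sub>L conj_L2 b \<in> coH2"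
  unfolding coH2_def
proof (intro CollectI allI impI)
  fix m :: int assume m: "m \<ge> 0"
  have "cinner (zpow n *\<^sub>L conj_L2 b) (zpow m) = cinner (conj_L2 b) (conj_L2 (zpow (n - m)))"
    by (simp add: cinner_shift zpow_mult conj_zpow)
  also have "\<dots> = cnj (cinner b (zpow (n - m)))" unfolding cinner_conj by (rule cinner_commute)
  also have "\<dots> = 0" using b n m by (simp add: H2_def)
  finally show "cinner (zpow n *\<^sub>L conj_L2 b) (zpow m) = 0" .
qed

lemma inner_functionD:
  assumes "inner_function \<theta>"
  shows inner_Hinf: "\<theta> \<in> Hinf" and inner_Linf: "\<theta> \<in> Linf" and inner_unimodular: "unimodular \<theta>"
  using assms by (auto simp: inner_function_def Hinf_def)

lemma closed_csubspace_model_space: "closed_csubspace (model_space \<theta>)"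
  unfolding model_space_def by (intro closed_csubspace_Int closed_csubspace_H2 closed_csubspace_orth_compl)

lemma closed_csubspace_model_perp: "closed_csubspace (model_perp \<theta>)"
  unfolding model_perp_def by (rule closed_csubspace_orth_compl)

lemma coH2_model_perp: "f \<in> coH2 \<Longrightarrow> f \<in> model_perp \<theta>"
  by (auto simp: model_perp_def orth_compl_def model_space_def coH2_orth_H2)

lemma mult_H2_model_perp: "u \<in> H2 \<Longrightarrow> \<theta> *\<^sub>L u \<in> model_perp \<theta>"
  unfolding model_perp_def model_space_def by (auto simp: orth_compl_def) (subst cinner_commute, simp)

lemma conj_mult_model_space:
  assumes \<theta>: "inner_function \<theta>" and k: "k \<in> model_space \<theta>"
  shows "conj_L2 \<theta> *\<^sub>L k \<in> coH2"
proof (rule coH2I)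
  fix u assume "u \<in> H2"
  then have "cinner k (\<theta> *\<^sub>L u) = 0" using k by (auto simp: model_space_def orth_compl_def)
  then show "cinner (conj_L2 \<theta> *\<^sub>L k) u = 0"
    by (simp add: cinner_mult[OF conj_Linf[OF inner_Linf[OF \<theta>]]])
qed

text \<open>The exponentials spanning the two summands of \<open>\<theta> H\<^sup>2 \<oplus> coH2\<close>, which is the complement of the
model space.\<close>

definition model_perp_gens :: "L2 \<Rightarrow> L2 set" where
  "model_perp_gens \<theta> = {zpow n | n. n < 0} \<union> {\<theta> *\<^sub>L zpow n | n. n \<ge> 0}"

lemma model_perp_gens_subset:
  assumes "inner_function \<theta>"
  shows "model_perp_gens \<theta> \<subseteq> model_perp \<theta> \<inter> Linf"
  using zpow_coH2 zpow_H2 coH2_model_perp mult_H2_model_perp Linf_mult[OF inner_Linf[OF assms] zpow_Linf]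
  unfolding model_perp_gens_def by auto

text \<open>A function orthogonal to all \<open>z\<^sup>n\<close> with \<open>n < 0\<close> and all \<open>\<theta> z\<^sup>n\<close> with \<open>n \<ge> 0\<close> lies in the model
space, so it vanishes if it is also orthogonal to the model space.\<close>

lemma model_perp_gens_total:
  assumes \<theta>: "inner_function \<theta>"
  shows "model_perp \<theta> \<inter> orth_compl (model_perp_gens \<theta>) \<subseteq> {0}"
proof
  fix f assume f: "f \<in> model_perp \<theta> \<inter> orth_compl (model_perp_gens \<theta>)"
  then have o: "cinner f g = 0" if "g \<in> model_perp_gens \<theta>" for g using that by (auto simp: orth_compl_def)
  have "f \<in> H2" using o by (auto simp: H2_def model_perp_gens_def)
  have "conj_L2 \<theta> *\<^sub>L f \<in> coH2"
    using o by (auto simp: coH2_def model_perp_gens_def cinner_mult[OF conj_Linf[OF inner_Linf[OF \<theta>]]])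
  then have "cinner f (\<theta> *\<^sub>L u) = 0" if "u \<in> H2" for u
    using coH2_orth_H2[OF _ that, of "conj_L2 \<theta> *\<^sub>L f"] by (simp add: cinner_mult[OF conj_Linf[OF inner_Linf[OF \<theta>]]])
  then have "f \<in> model_space \<theta>" using \<open>f \<in> H2\<close> by (auto simp: model_space_def orth_compl_def)
  then have "cinner f f = 0" using f by (auto simp: model_perp_def orth_compl_def)
  then show "f \<in> {0}" by simp
qed

section \<open>Factorisation of integrable functions\<close>

text \<open>Szego's theorem. Project \<open>g = \<surd>w\<close> onto the orthogonal complement of \<open>z g, z\<^sup>2 g, \<dots>\<close>. The
projection \<open>G\<close> is orthogonal to all its shifts, so \<open>|G|\<close> is constant; it is not zero, since \<open>g\<close> is
not orthogonal to \<open>1 / g\<close>, which is orthogonal to all \<open>z\<^sup>n g\<close> with \<open>n \<ge> 1\<close>. The orthogonality of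
\<open>G\<close> to \<open>z\<^sup>n g\<close> says that \<open>g\<close> times the conjugate of \<open>G\<close> is analytic.\<close>

lemma analytic_modulus_exists:
  fixes w :: "complex \<Rightarrow> real"
  assumes w: "integrable \<mu> w" and \<eta>: "\<eta> > 0" "\<And>z. w z \<ge> \<eta>"
  obtains b where "b \<in> H2" "AE z in \<mu>. (cmod (rep_L2 b z))\<^sup>2 = w z"
proof -
  note [measurable] = borel_measurable_integrable[OF w]
  have wpos: "w z > 0" for z using \<eta>(2)[of z] \<eta>(1) by linarith
  have sq1: "sq_integrable (\<lambda>z. complex_of_real (sqrt (w z)))"
    using w wpos by (simp add: sq_integrable_def less_imp_le)
  have sq2: "sq_integrable (\<lambda>z. complex_of_real (1 / sqrt (w z)))"
  proof -
    have "integrable \<mu> (\<lambda>z. (cmod (complex_of_real (1 / sqrt (w z))))\<^sup>2)"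
    proof (rule circle.integrable_const_bound[where B = "1 / \<eta>"])
      show "AE z in \<mu>. norm ((cmod (complex_of_real (1 / sqrt (w z))))\<^sup>2) \<le> 1 / \<eta>"
        using wpos \<eta> by (intro AE_I2) (simp add: power_divide less_imp_le frac_le norm_divide)
    qed simp
    then show ?thesis by (simp add: sq_integrable_def)
  qed
  define g r where "g = abs_L2 (\<lambda>z. complex_of_real (sqrt (w z)))"
    and "r = abs_L2 (\<lambda>z. complex_of_real (1 / sqrt (w z)))"
  have rep_g: "AE z in \<mu>. rep_L2 g z = complex_of_real (sqrt (w z))"
    unfolding g_def by (rule rep_abs_L2[OF sq1])
  have rep_r: "AE z in \<mu>. rep_L2 r z = complex_of_real (1 / sqrt (w z))"
    unfolding r_def by (rule rep_abs_L2[OF sq2])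
  define N where "N = orth_compl {zpow n *\<^sub>L g | n. n \<ge> 1}"
  have N: "closed_csubspace N" unfolding N_def by (rule closed_csubspace_orth_compl)
  define G where "G = orth_proj N g"
  have GN: "G \<in> N" unfolding G_def by (rule orth_proj_in[OF N])
  have gG: "g - G \<in> orth_compl N" unfolding G_def by (rule orth_proj_diff[OF N])
  have G_orth: "cinner (zpow n *\<^sub>L g) G = 0" if "n \<ge> 1" for n
    using GN that unfolding N_def by (intro orth_complD') auto
  have G_shift: "cinner (zpow n *\<^sub>L G) G = 0" if n: "n \<ge> 1" for n
  proof -
    have "zpow (- n) *\<^sub>L G \<in> N"
      unfolding N_def orth_compl_def
    proof (intro CollectI ballI)
      fix y assume "y \<in> {zpow n *\<^sub>L g | n. n \<ge> 1}"
      then obtain m where m: "m \<ge> 1" "y = zpow m *\<^sub>L g" by blast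
      have "cinner G (zpow (n + m) *\<^sub>L g) = 0"
        using G_orth[of "n + m"] m n by (metis cinner_commute complex_cnj_zero add_increasing2 order_trans zero_le_one)
      then show "cinner (zpow (- n) *\<^sub>L G) y = 0" by (simp add: m cinner_shift shift_shift)
    qed
    then have "cinner (g - G) (zpow (- n) *\<^sub>L G) = 0" by (rule orth_complD[OF gG])
    moreover have "cinner g (zpow (- n) *\<^sub>L G) = 0" using G_orth[OF n] by (simp add: cinner_shift)
    ultimately show ?thesis by (simp add: cinner_diff_left cinner_shift)
  qed
  have int_G: "integrable \<mu> (\<lambda>z. (cmod (rep_L2 G z))\<^sup>2)" by (simp add: sq_integrable_int)
  define c where "c = (norm G)\<^sup>2"
  have coef: "cinner (zpow n *\<^sub>L G) G = (LINT z|\<mu>. z powi n * complex_of_real ((cmod (rep_L2 G z))\<^sup>2))" for n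
  proof (rule cinner_AE_eq_integral)
    show "(\<lambda>z. z powi n * complex_of_real ((cmod (rep_L2 G z))\<^sup>2)) \<in> borel_measurable \<mu>"
      by (intro borel_measurable_times) (simp_all cong: measurable_cong_sets)
    show "AE z in \<mu>. rep_L2 (zpow n *\<^sub>L G) z * cnj (rep_L2 G z) = z powi n * complex_of_real ((cmod (rep_L2 G z))\<^sup>2)"
      using rep_mult[OF zpow_Linf, of n G] rep_zpow[of n]
      by eventually_elim (simp add: complex_norm_square mult.assoc del: of_real_power)
  qed
  have G_shift': "cinner (zpow n *\<^sub>L G) G = 0" if "n \<noteq> 0" for n
  proof (cases "n \<ge> 1")
    case False
    then have "- n \<ge> 1" using that by simp
    have "cinner (zpow n *\<^sub>L G) G = cnj (cinner (zpow (- n) *\<^sub>L G) G)"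
      by (subst cinner_shift) (rule cinner_commute)
    then show ?thesis using G_shift[OF \<open>- n \<ge> 1\<close>] by simp
  qed (rule G_shift)
  have "AE z in \<mu>. complex_of_real ((cmod (rep_L2 G z))\<^sup>2 - c) = 0"
  proof (rule fourier_unique)
    show "integrable \<mu> (\<lambda>z. complex_of_real ((cmod (rep_L2 G z))\<^sup>2 - c))"
      using int_G by (intro integrable_of_real) simp
    fix n
    have i1: "integrable \<mu> (\<lambda>z. z powi n * complex_of_real ((cmod (rep_L2 G z))\<^sup>2))"
      by (rule bounded_mult_integrable[OF _ AE_powi_bounded integrable_of_real[OF int_G]]) simp
    have i2: "integrable \<mu> (\<lambda>z. z powi n * complex_of_real c)"
      by (rule bounded_mult_integrable[OF _ AE_powi_bounded]) auto
    have "(LINT z|\<mu>. z powi n * complex_of_real ((cmod (rep_L2 G z))\<^sup>2 - c)) =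
        (LINT z|\<mu>. z powi n * complex_of_real ((cmod (rep_L2 G z))\<^sup>2) - z powi n * complex_of_real c)"
      by (simp add: algebra_simps)
    also have "\<dots> = cinner (zpow n *\<^sub>L G) G - (LINT z|\<mu>. z powi n) * complex_of_real c"
      unfolding coef using i1 i2 by simp
    also have "\<dots> = 0"
    proof (cases "n = 0")
      case True
      then show ?thesis by (simp add: circle_prob_UNIV cinner_self c_def)
    next
      case False
      then show ?thesis by (simp add: integral_powi G_shift')
    qed
    finally show "(LINT z|\<mu>. z powi n * complex_of_real ((cmod (rep_L2 G z))\<^sup>2 - c)) = 0" .
  qed
  then have G_mod: "AE z in \<mu>. (cmod (rep_L2 G z))\<^sup>2 = c"
    by eventually_elim (simp only: of_real_eq_0_iff right_minus_eq)
  have "G \<noteq> 0"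
  proof
    assume "G = 0"
    have "r \<in> N"
      unfolding N_def orth_compl_def
    proof (intro CollectI ballI)
      fix y assume "y \<in> {zpow n *\<^sub>L g | n. n \<ge> 1}"
      then obtain m where m: "m \<ge> 1" "y = zpow m *\<^sub>L g" by blast
      have "cinner r y = (LINT z|\<mu>. z powi (- m))"
        unfolding m
      proof (rule cinner_AE_eq_integral)
        show "(\<lambda>z. z powi - m) \<in> borel_measurable \<mu>" by (simp cong: measurable_cong_sets)
        show "AE z in \<mu>. rep_L2 r z * cnj (rep_L2 (zpow m *\<^sub>L g) z) = z powi - m"
          using rep_r rep_g rep_mult[OF zpow_Linf, of m g] rep_zpow[of m] AE_norm_circle_measure
        proof eventually_elim
          fix z :: complex
          assume a: "rep_L2 r z = complex_of_real (1 / sqrt (w z))" "rep_L2 g z = complex_of_real (sqrt (w z))"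
            "rep_L2 (zpow m *\<^sub>L g) z = rep_L2 (zpow m) z * rep_L2 g z" "rep_L2 (zpow m) z = z powi m" "cmod z = 1"
          have "sqrt (w z) \<noteq> 0" using wpos[of z] by simp
          then have "complex_of_real (1 / sqrt (w z)) * complex_of_real (sqrt (w z)) = 1"
            by (simp flip: of_real_mult)
          then show "rep_L2 r z * cnj (rep_L2 (zpow m *\<^sub>L g) z) = z powi - m"
            using a by (simp add: cnj_unit norm_power_int power_int_minus mult.left_commute
                del: complex_cnj_power_int of_real_divide)
        qed
      qed
      then show "cinner r y = 0" using m by (simp add: integral_powi)
    qed
    then have "cinner g r = 0" using orth_complD[OF gG] \<open>G = 0\<close> by simp
    moreover have "cinner g r = (LINT z|\<mu>. 1)"
    proof (rule cinner_AE_eq_integral)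
      show "AE z in \<mu>. rep_L2 g z * cnj (rep_L2 r z) = 1"
        using rep_r rep_g
      proof eventually_elim
        fix z assume "rep_L2 r z = complex_of_real (1 / sqrt (w z))" "rep_L2 g z = complex_of_real (sqrt (w z))"
        moreover have "sqrt (w z) \<noteq> 0" using wpos[of z] by simp
        ultimately show "rep_L2 g z * cnj (rep_L2 r z) = 1" by (simp flip: of_real_mult)
      qed
    qed simp
    ultimately show False by (simp add: circle_prob_UNIV)
  qed
  then have "c > 0" by (simp add: c_def)
  have G_Linf: "G \<in> Linf"
    by (rule LinfI(1)[where C = "sqrt c"])
      (use G_mod in \<open>eventually_elim, simp add: real_le_rsqrt\<close>)
  define b where "b = complex_of_real (1 / sqrt c) *\<^sub>C (conj_L2 G *\<^sub>L g)"
  have "b \<in> H2"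
    unfolding H2_def
  proof (intro CollectI allI impI)
    fix n :: int assume "n < 0"
    then have "cinner (zpow (- n) *\<^sub>L g) G = 0" by (intro G_orth) simp
    moreover have "cinner (conj_L2 G *\<^sub>L g) (zpow n) = cinner g (zpow n *\<^sub>L G)"
      using cinner_mult[OF conj_Linf[OF G_Linf], of g "zpow n"] by (simp add: L2_mult_commute)
    ultimately show "cinner b (zpow n) = 0" by (simp add: b_def cinner_scaleC_left cinner_shift)
  qed
  moreover have "AE z in \<mu>. (cmod (rep_L2 b z))\<^sup>2 = w z"
    using rep_scaleC[of "complex_of_real (1 / sqrt c)" "conj_L2 G *\<^sub>L g"] rep_mult[OF conj_Linf[OF G_Linf], of g]
      rep_conj[of G] rep_g G_mod
    unfolding b_def
    by eventually_elim
      (use \<open>c > 0\<close> wpos in \<open>simp add: norm_mult norm_divide power_mult_distrib power_divide less_imp_le\<close>)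
  ultimately show ?thesis using that by blast
qed

text \<open>Trigonometric polynomials enter only through two properties: they are bounded, and a
sufficiently high power of \<open>z\<^sup>-\<^sup>1\<close> moves them into \<open>coH2\<close>.\<close>

definition eventually_coH2 :: "L2 set" where
  "eventually_coH2 = {p \<in> Linf. \<exists>N0. \<forall>N\<ge>N0. zpow (- N) *\<^sub>L p \<in> coH2}"

lemma eventually_coH2_dense:
  assumes "\<delta> > 0"
  obtains p where "p \<in> eventually_coH2" "norm (x - p) < \<delta>"
proof -
  have "((\<lambda>e. cinner x e *\<^sub>C e) has_sum x) (range zpow)"
    by (rule onb_expansion[OF closed_csubspace_UNIV zpow_onb]) simp
  then have "\<forall>\<^sub>F F in finite_subsets_at_top (range zpow). dist (\<Sum>e\<in>F. cinner x e *\<^sub>C e) x < \<delta>"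
    using assms by (simp add: has_sum_def tendstoD)
  then obtain F where F: "finite F" "F \<subseteq> range zpow" "dist (\<Sum>e\<in>F. cinner x e *\<^sub>C e) x < \<delta>"
    unfolding eventually_finite_subsets_at_top by blast
  have "(\<Sum>e\<in>F. c e *\<^sub>C e) \<in> eventually_coH2" for c
    using F(1,2)
  proof (induction F)
    case empty
    have "zpow (- N) *\<^sub>L 0 = 0" for N using mult_scaleC_right[OF zpow_Linf, of "- N" 0 0] by simp
    then show ?case using closed_csubspaceD(1)[OF closed_csubspace_coH2] by (simp add: eventually_coH2_def Linf_zero)
  next
    case (insert e F)
    then obtain n where e: "e = zpow n" by blast
    obtain N0 where N0: "\<And>N. N \<ge> N0 \<Longrightarrow> zpow (- N) *\<^sub>L (\<Sum>e\<in>F. c e *\<^sub>C e) \<in> coH2" and L: "(\<Sum>e\<in>F. c e *\<^sub>C e) \<in> Linf"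
      using insert by (auto simp: eventually_coH2_def)
    have "zpow (- N) *\<^sub>L (c e *\<^sub>C e + (\<Sum>e\<in>F. c e *\<^sub>C e)) \<in> coH2" if N: "N \<ge> max N0 (n + 1)" for N
    proof -
      have "zpow (- N) *\<^sub>L (c e *\<^sub>C e) = c e *\<^sub>C zpow (- N + n)"
        by (simp only: mult_scaleC_right[OF zpow_Linf] e zpow_mult)
      moreover have "zpow (- N + n) \<in> coH2" using N by (intro zpow_coH2) simp
      ultimately show ?thesis
        unfolding mult_add_right[OF zpow_Linf]
        using N N0 closed_csubspaceD(2,3)[OF closed_csubspace_coH2] by simp
    qed
    then have "\<exists>N0. \<forall>N\<ge>N0. zpow (- N) *\<^sub>L (c e *\<^sub>C e + (\<Sum>e\<in>F. c e *\<^sub>C e)) \<in> coH2" by blast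
    moreover have "c e *\<^sub>C e + (\<Sum>e\<in>F. c e *\<^sub>C e) \<in> Linf"
      unfolding e by (intro Linf_add Linf_scaleC zpow_Linf L)
    ultimately show ?case using insert.hyps by (simp add: eventually_coH2_def)
  qed
  then show ?thesis using that F(3) by (metis dist_commute dist_norm)
qed

lemma shift_approx_coH2:
  assumes "\<delta> > 0"
  obtains N q where "N \<ge> 1" "q \<in> coH2" "norm (zpow (- N) *\<^sub>L s - q) < \<delta>"
proof -
  obtain p where p: "p \<in> eventually_coH2" "norm (s - p) < \<delta>" by (rule eventually_coH2_dense[OF assms])
  then obtain N0 where "\<And>N. N \<ge> N0 \<Longrightarrow> zpow (- N) *\<^sub>L p \<in> coH2" by (auto simp: eventually_coH2_def)
  then have "zpow (- max N0 1) *\<^sub>L p \<in> coH2" by simp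
  moreover have "norm (zpow (- max N0 1) *\<^sub>L s - zpow (- max N0 1) *\<^sub>L p) < \<delta>"
    using p(2) by (simp add: unimodular_norm[OF unimodular_zpow] flip: mult_diff_right[OF zpow_Linf])
  ultimately show ?thesis using that[of "max N0 1"] by simp
qed

text \<open>Every integrable \<open>h\<close> is of the form \<open>f\<^sub>1 g\<^sub>1\<^sup>* + f\<^sub>2 g\<^sub>2\<^sup>*\<close>. Write \<open>h = b s\<close> with \<open>b\<close> analytic and
\<open>|b|\<^sup>2\<close> slightly larger than \<open>|h|\<close>. For large \<open>N\<close> the function \<open>z\<^sup>-\<^sup>N s\<close> is close to \<open>coH2\<close>, so its
component \<open>k\<close> in \<open>K\<^sub>\<theta>\<close> is small; its other component is \<open>f\<^sub>1\<close>, and \<open>g\<^sub>1\<close> is the conjugate of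
\<open>z\<^sup>N b\<close>. What is missing is \<open>z\<^sup>N b k = (\<theta>\<^sup>* k) (z\<^sup>N \<theta> b)\<close>, where \<open>\<theta>\<^sup>* k\<close> belongs to \<open>coH2\<close> because \<open>k\<close>
is in the model space; this is the second term.\<close>

lemma L1_factorization:
  assumes \<theta>: "inner_function \<theta>" and nc: "nonconstant \<theta>"
    and h: "integrable \<mu> h" and \<epsilon>: "\<epsilon> > 0"
  obtains f\<^sub>1 g\<^sub>1 f\<^sub>2 g\<^sub>2 where "f\<^sub>1 \<in> model_perp \<theta>" "f\<^sub>2 \<in> model_perp \<theta>"
    "g\<^sub>1 \<in> model_perp \<alpha>" "g\<^sub>2 \<in> model_perp \<alpha>"
    "AE z in \<mu>. h z = rep_L2 f\<^sub>1 z * cnj (rep_L2 g\<^sub>1 z) + rep_L2 f\<^sub>2 z * cnj (rep_L2 g\<^sub>2 z)"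
    "norm f\<^sub>1 * norm g\<^sub>1 + norm f\<^sub>2 * norm g\<^sub>2 \<le> (LINT z|\<mu>. cmod (h z)) + \<epsilon>"
    "g\<^sub>1 \<noteq> 0" "\<And>c. g\<^sub>2 \<noteq> c *\<^sub>C g\<^sub>1"
proof -
  note [measurable] = borel_measurable_integrable[OF h]
  define A where "A = (LINT z|\<mu>. cmod (h z))"
  have A0: "A \<ge> 0" by (simp add: A_def)
  \<comment> \<open>Half of \<open>\<epsilon>\<close> pays for bounding the weight \<open>w\<close> away from zero, the other half for the second term.\<close>
  define \<eta> where "\<eta> = \<epsilon> / 2"
  have \<eta>: "\<eta> > 0" using \<epsilon> by (simp add: \<eta>_def)
  \<comment> \<open>The lower bound makes \<open>w\<close> the square of the modulus of an analytic function.\<close>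
  define w where "w z = max (cmod (h z)) \<eta>" for z
  have w: "integrable \<mu> w" unfolding w_def using h by (intro integrable_max) auto
  have w_int: "(LINT z|\<mu>. w z) \<le> A + \<eta>"
  proof -
    have "(LINT z|\<mu>. w z) \<le> (LINT z|\<mu>. cmod (h z) + \<eta>)"
      by (rule integral_mono) (use w h \<eta> in \<open>auto simp: w_def\<close>)
    also have "\<dots> = A + \<eta>" using h by (simp add: A_def circle_prob_UNIV)
    finally show ?thesis .
  qed
  obtain b where b: "b \<in> H2" and bw: "AE z in \<mu>. (cmod (rep_L2 b z))\<^sup>2 = w z"
    using analytic_modulus_exists[OF w \<eta>] by (auto simp: w_def)
  have norm_b: "norm b \<le> sqrt (A + \<eta>)"
  proof -
    have "(norm b)\<^sup>2 = (LINT z|\<mu>. w z)"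
      unfolding norm_sq_rep by (rule integral_cong_AE) (use bw w in auto)
    then show ?thesis using w_int by (simp add: real_le_rsqrt)
  qed
  define u where "u z = h z / rep_L2 b z" for z
  have [measurable]: "u \<in> borel_measurable \<mu>" unfolding u_def by simp
  have u_le: "AE z in \<mu>. (cmod (u z))\<^sup>2 \<le> cmod (h z)"
    using bw
  proof eventually_elim
    fix z assume z: "(cmod (rep_L2 b z))\<^sup>2 = w z"
    then have "(cmod (rep_L2 b z))\<^sup>2 > 0" "cmod (h z) \<le> (cmod (rep_L2 b z))\<^sup>2" using \<eta> by (auto simp: w_def)
    then show "(cmod (u z))\<^sup>2 \<le> cmod (h z)"
      by (simp add: u_def norm_divide power_divide pos_divide_le_eq power2_eq_square mult_left_mono del: zero_less_power2 zero_less_mult_iff)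
  qed
  have sq_u: "sq_integrable u"
    unfolding sq_integrable_def
  proof
    show "integrable \<mu> (\<lambda>z. (cmod (u z))\<^sup>2)"
      by (rule Bochner_Integration.integrable_bound[where f = h]) (use h u_le in \<open>auto elim: eventually_mono\<close>)
  qed simp
  define s where "s = abs_L2 u"
  have rep_s: "AE z in \<mu>. rep_L2 s z = u z" unfolding s_def by (rule rep_abs_L2[OF sq_u])
  have norm_s: "norm s \<le> sqrt A"
  proof -
    have "(norm s)\<^sup>2 \<le> A"
      unfolding s_def norm_sq_abs[OF sq_u] A_def
      by (rule integral_mono_AE) (use h u_le sq_integrable_int[OF sq_u] in auto)
    then show ?thesis by (simp add: real_le_rsqrt)
  qed
  define \<delta> where "\<delta> = \<epsilon> / (2 * (sqrt (A + \<eta>) + 1))"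
  have S: "sqrt (A + \<eta>) \<ge> 0" using A0 \<eta> by simp
  have \<delta>: "\<delta> > 0" using \<epsilon> S by (simp add: \<delta>_def add_nonneg_pos)
  obtain N q where N: "N \<ge> 1" and q: "q \<in> coH2" and Nq: "norm (zpow (- N) *\<^sub>L s - q) < \<delta>"
    using shift_approx_coH2[OF \<delta>] by blast
  let ?K = "model_space \<theta>"
  note Kc = closed_csubspace_model_space[of \<theta>]
  define k where "k = orth_proj ?K (zpow (- N) *\<^sub>L s)"
  have kK: "k \<in> ?K" unfolding k_def by (rule orth_proj_in[OF Kc])
  define f1 where "f1 = zpow (- N) *\<^sub>L s - k"
  have f1: "f1 \<in> model_perp \<theta>" unfolding f1_def k_def model_perp_def by (rule orth_proj_diff[OF Kc])
  have norm_f1: "norm f1 \<le> norm s"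
  proof -
    have "cinner f1 k = 0" using f1 kK unfolding model_perp_def by (rule orth_complD)
    from norm_add_sq_orth[OF this] have "(norm f1)\<^sup>2 \<le> (norm (zpow (- N) *\<^sub>L s))\<^sup>2" by (simp add: f1_def)
    then show ?thesis by (simp add: unimodular_norm[OF unimodular_zpow] power2_le_iff_abs_le)
  qed
  have norm_k: "norm k \<le> \<delta>"
  proof -
    have "orth_proj ?K q = 0"
      by (rule orth_proj_eqI[OF Kc closed_csubspaceD(1)[OF Kc]])
        (use coH2_model_perp[OF q] in \<open>simp add: model_perp_def\<close>)
    then have "k = orth_proj ?K (zpow (- N) *\<^sub>L s - q)"
      using orth_proj_add[OF Kc, of "zpow (- N) *\<^sub>L s - q" q] by (simp add: k_def)
    then show ?thesis using norm_orth_proj_le[OF Kc, of "zpow (- N) *\<^sub>L s - q"] Nq by simp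
  qed
  define g1 where "g1 = zpow (- N) *\<^sub>L conj_L2 b"
  define f2 where "f2 = conj_L2 \<theta> *\<^sub>L k"
  define g2 where "g2 = zpow (- N) *\<^sub>L conj_L2 (\<theta> *\<^sub>L b)"
  have g1: "g1 \<in> coH2" unfolding g1_def using N by (intro shift_conj_H2_in_coH2 b) simp
  have g2: "g2 \<in> coH2"
    unfolding g2_def using N by (intro shift_conj_H2_in_coH2 Hinf_mult_H2 inner_Hinf[OF \<theta>] b) simp
  have f2: "f2 \<in> coH2" unfolding f2_def by (rule conj_mult_model_space[OF \<theta> kK])
  note um = unimodular_norm[OF unimodular_zpow] unimodular_norm[OF inner_unimodular[OF \<theta>]]
    unimodular_norm[OF unimodular_conj[OF inner_unimodular[OF \<theta>]]]
  have norms: "norm g1 = norm b" "norm g2 = norm b" "norm f2 = norm k"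
    by (simp_all add: g1_def g2_def f2_def um)
  have b_nz: "AE z in \<mu>. rep_L2 b z \<noteq> 0"
    using bw
  proof eventually_elim
    fix z assume "(cmod (rep_L2 b z))\<^sup>2 = w z"
    moreover have "w z > 0" using \<eta> by (simp add: w_def less_max_iff_disj)
    ultimately show "rep_L2 b z \<noteq> 0" by auto
  qed
  note rg1 = rep_mult[OF zpow_Linf, of "- N" "conj_L2 b"] rep_conj[of b]
  note rg2 = rep_mult[OF zpow_Linf, of "- N" "conj_L2 (\<theta> *\<^sub>L b)"] rep_conj[of "\<theta> *\<^sub>L b"]
    rep_mult[OF inner_Linf[OF \<theta>], of b]
  note \<theta>1 = inner_unimodular[OF \<theta>, unfolded unimodular_AE]
  show ?thesis
  proof (rule that[of f1 f2 g1 g2])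
    show "f1 \<in> model_perp \<theta>" by (rule f1)
    show "f2 \<in> model_perp \<theta>" "g1 \<in> model_perp \<alpha>" "g2 \<in> model_perp \<alpha>"
      using f2 g1 g2 by (auto intro: coH2_model_perp)
    show "AE z in \<mu>. h z = rep_L2 f1 z * cnj (rep_L2 g1 z) + rep_L2 f2 z * cnj (rep_L2 g2 z)"
      using rg1 rg2 \<theta>1 b_nz rep_s rep_diff[of "zpow (- N) *\<^sub>L s" k] rep_mult[OF zpow_Linf, of "- N" s]
        rep_mult[OF conj_Linf[OF inner_Linf[OF \<theta>]], of k] rep_conj[of \<theta>]
        unimodular_zpow[of "- N", unfolded unimodular_AE]
      unfolding f1_def[symmetric] g1_def[symmetric] f2_def[symmetric] g2_def[symmetric]
    proof eventually_elim
      fix z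
      let ?t = "rep_L2 \<theta> z" and ?y = "rep_L2 (zpow (- N)) z" and ?b = "rep_L2 b z" and ?k = "rep_L2 k z"
      assume e: "rep_L2 g1 z = ?y * rep_L2 (conj_L2 b) z" "rep_L2 (conj_L2 b) z = cnj ?b"
        "rep_L2 g2 z = ?y * rep_L2 (conj_L2 (\<theta> *\<^sub>L b)) z" "rep_L2 (conj_L2 (\<theta> *\<^sub>L b)) z = cnj (rep_L2 (\<theta> *\<^sub>L b) z)"
        "rep_L2 (\<theta> *\<^sub>L b) z = ?t * ?b" "rep_L2 s z = u z" "rep_L2 f1 z = rep_L2 (zpow (- N) *\<^sub>L s) z - ?k"
        "rep_L2 (zpow (- N) *\<^sub>L s) z = ?y * rep_L2 s z" "rep_L2 f2 z = rep_L2 (conj_L2 \<theta>) z * ?k"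
        "rep_L2 (conj_L2 \<theta>) z = cnj ?t"
        and m: "cmod ?t = 1" "?b \<noteq> 0" "cmod ?y = 1"
      have tt: "cnj ?t * ?t = 1" and yy: "?y * cnj ?y = 1"
        using m complex_norm_square[of ?t] complex_norm_square[of ?y] by (simp_all add: mult.commute)
      have "rep_L2 f1 z * cnj (rep_L2 g1 z) + rep_L2 f2 z * cnj (rep_L2 g2 z) =
          (?y * cnj ?y) * (u z * ?b) - ?k * cnj ?y * ?b + (cnj ?t * ?t) * (?k * cnj ?y * ?b)"
        by (simp add: e algebra_simps)
      also have "\<dots> = u z * ?b" by (simp add: tt yy)
      also have "\<dots> = h z" using m by (simp add: u_def)
      finally show "h z = rep_L2 f1 z * cnj (rep_L2 g1 z) + rep_L2 f2 z * cnj (rep_L2 g2 z)" by simp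
    qed
    show "norm f1 * norm g1 + norm f2 * norm g2 \<le> (LINT z|\<mu>. cmod (h z)) + \<epsilon>"
    proof -
      have "norm f1 * norm g1 + norm f2 * norm g2 \<le> sqrt A * sqrt (A + \<eta>) + \<delta> * sqrt (A + \<eta>)"
        unfolding norms using norm_f1 norm_s norm_b norm_k A0 \<delta> by (intro add_mono mult_mono) auto
      also have "\<dots> \<le> sqrt (A + \<eta>) * sqrt (A + \<eta>) + \<delta> * (sqrt (A + \<eta>) + 1)"
        using \<eta> \<delta> S by (intro add_mono mult_right_mono mult_left_mono) auto
      also have "\<delta> * (sqrt (A + \<eta>) + 1) = \<epsilon> / 2"
      proof -
        have "\<epsilon> / (2 * x) * x = \<epsilon> / 2" if "x \<noteq> 0" for x :: real using that by simp
        moreover have "sqrt (A + \<eta>) + 1 \<noteq> 0" using S by linarith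
        ultimately show ?thesis unfolding \<delta>_def by blast
      qed
      also have "sqrt (A + \<eta>) * sqrt (A + \<eta>) = A + \<eta>" using A0 \<eta> by simp
      finally show ?thesis by (simp add: A_def \<eta>_def)
    qed
    show "g1 \<noteq> 0"
    proof
      assume "g1 = 0"
      then have "b = 0" using norms(1) by simp
      then have "AE z in \<mu>. rep_L2 b z = 0" using rep_zero by simp
      with b_nz have "AE z in \<mu>. False" by eventually_elim simp
      then show False by simp
    qed
    \<comment> \<open>Since \<open>b\<close> vanishes almost nowhere, proportionality would make \<open>\<theta>\<close> constant.\<close>
    show "g2 \<noteq> c *\<^sub>C g1" for c
    proof
      assume c: "g2 = c *\<^sub>C g1"
      have "AE z in \<mu>. rep_L2 \<theta> z = rep_L2 (cnj c *\<^sub>C zpow 0) z"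
        using rg1 rg2 b_nz unimodular_zpow[of "- N", unfolded unimodular_AE]
          rep_scaleC[of c g1] rep_scaleC[of "cnj c" "zpow 0"] rep_zpow[of 0]
        unfolding g1_def[symmetric] g2_def[symmetric] c
      proof eventually_elim
        fix z
        let ?y = "rep_L2 (zpow (- N)) z" and ?b = "rep_L2 b z"
        assume e: "rep_L2 g1 z = ?y * rep_L2 (conj_L2 b) z" "rep_L2 (conj_L2 b) z = cnj ?b"
          "rep_L2 (c *\<^sub>C g1) z = ?y * rep_L2 (conj_L2 (\<theta> *\<^sub>L b)) z"
          "rep_L2 (conj_L2 (\<theta> *\<^sub>L b)) z = cnj (rep_L2 (\<theta> *\<^sub>L b) z)"
          "rep_L2 (\<theta> *\<^sub>L b) z = rep_L2 \<theta> z * ?b" "rep_L2 (c *\<^sub>C g1) z = c * rep_L2 g1 z"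
          "rep_L2 (cnj c *\<^sub>C zpow 0) z = cnj c * rep_L2 (zpow 0) z" "rep_L2 (zpow 0) z = z powi 0"
          and m: "?b \<noteq> 0" "cmod ?y = 1"
        have "?y \<noteq> 0" using m by auto
        have "?y * cnj (rep_L2 \<theta> z * ?b) = c * (?y * cnj ?b)" using e by auto
        then have "cnj (rep_L2 \<theta> z) = c" using \<open>?y \<noteq> 0\<close> m(1) by auto
        then show "rep_L2 \<theta> z = rep_L2 (cnj c *\<^sub>C zpow 0) z" using e by auto
      qed
      then have "\<theta> = cnj c *\<^sub>C zpow 0" by (rule L2_eqI)
      then show False using nc by (auto simp: nonconstant_def)
    qed
  qed
qed

section \<open>Weak topologies\<close>

lemma topspace_weak_topology_on:
  assumes "F \<noteq> {}"
  shows "topspace (weak_topology_on X F) = X"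
proof -
  obtain \<phi> where "\<phi> \<in> F" using assms by blast
  then have "X \<in> {{x \<in> X. \<phi> x \<in> U} | \<phi> U. \<phi> \<in> F \<and> open U}"
    by (intro CollectI exI[of _ \<phi>] exI[of _ UNIV]) auto
  then show ?thesis unfolding weak_topology_on_def topology_generated_by_topspace by blast
qed

lemma openin_weak_topology_basic:
  "\<phi> \<in> F \<Longrightarrow> open U \<Longrightarrow> openin (weak_topology_on X F) {x \<in> X. \<phi> x \<in> U}"
  unfolding weak_topology_on_def by (intro topology_generated_by_Basis) blast

text \<open>The topology is given by a subbase; intersections of the resulting sets are controlled by
finitely many functionals.\<close>

lemma weak_topology_neighbourhood:
  assumes "openin (weak_topology_on X F) W" "x \<in> W"
  obtains F0 \<delta> where "finite F0" "F0 \<subseteq> F" "\<delta> > 0"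
    "\<And>y. y \<in> X \<Longrightarrow> (\<And>\<phi>. \<phi> \<in> F0 \<Longrightarrow> cmod (\<phi> y - \<phi> x) < \<delta>) \<Longrightarrow> y \<in> W"
proof -
  define B where "B = {{x \<in> X. \<phi> x \<in> U} | \<phi> U. \<phi> \<in> F \<and> open U}"
  have "generate_topology_on B W"
    using assms(1) by (simp add: weak_topology_on_def B_def openin_topology_generated_by_iff)
  then have "\<exists>F0 \<delta>. finite F0 \<and> F0 \<subseteq> F \<and> \<delta> > 0 \<and>
      (\<forall>y\<in>X. (\<forall>\<phi>\<in>F0. cmod (\<phi> y - \<phi> x) < \<delta>) \<longrightarrow> y \<in> W)"
    using assms(2)
  proof (induction)
    case (Int a b)
    then have "x \<in> a" "x \<in> b" by auto
    from Int.IH(1)[OF this(1)] obtain F1 d1 where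
      1: "finite F1" "F1 \<subseteq> F" "d1 > 0" "\<forall>y\<in>X. (\<forall>\<phi>\<in>F1. cmod (\<phi> y - \<phi> x) < d1) \<longrightarrow> y \<in> a"
      by (elim exE conjE)
    from Int.IH(2)[OF \<open>x \<in> b\<close>] obtain F2 d2 where
      2: "finite F2" "F2 \<subseteq> F" "d2 > 0" "\<forall>y\<in>X. (\<forall>\<phi>\<in>F2. cmod (\<phi> y - \<phi> x) < d2) \<longrightarrow> y \<in> b"
      by (elim exE conjE)
    from 1 2 show ?case
      by (intro exI[of _ "F1 \<union> F2"] exI[of _ "min d1 d2"] conjI) simp_all
  next
    case (UN K)
    then obtain k where k: "k \<in> K" "x \<in> k" by blast
    from UN.IH[OF this] obtain F0 d where
      "finite F0" "F0 \<subseteq> F" "d > 0" "\<forall>y\<in>X. (\<forall>\<phi>\<in>F0. cmod (\<phi> y - \<phi> x) < d) \<longrightarrow> y \<in> k"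
      by (elim exE conjE)
    then show ?case using k(1) by (intro exI[of _ F0] exI[of _ d] conjI) auto
  next
    case (Basis s)
    then obtain \<phi> U where s: "s = {x \<in> X. \<phi> x \<in> U}" "\<phi> \<in> F" "open U" by (auto simp: B_def)
    then have "\<phi> x \<in> U" using Basis.prems by simp
    then obtain d where d: "d > 0" "\<And>c. dist c (\<phi> x) < d \<Longrightarrow> c \<in> U" using s(3) unfolding open_dist by blast
    then show ?case using s by (intro exI[of _ "{\<phi>}"] exI[of _ d]) (auto simp: dist_norm)
  qed simp
  then obtain F0 \<delta> where "finite F0" "F0 \<subseteq> F" "\<delta> > 0"
    "\<forall>y\<in>X. (\<forall>\<phi>\<in>F0. cmod (\<phi> y - \<phi> x) < \<delta>) \<longrightarrow> y \<in> W" by (elim exE conjE)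
  then show ?thesis using that[of F0 \<delta>] by simp
qed

text \<open>Two facts of linear algebra behind the duality: a functional vanishing on the common kernel
of finitely many functionals is a combination of them, and a vector whose coordinates are attained
nowhere on a subspace is separated from it by such a combination.\<close>

definition linear_on_csubspace :: "'a::complex_inner set \<Rightarrow> ('a \<Rightarrow> complex) \<Rightarrow> bool" where
  "linear_on_csubspace W l \<longleftrightarrow> (\<forall>x\<in>W. \<forall>y\<in>W. l (x + y) = l x + l y) \<and> (\<forall>c. \<forall>x\<in>W. l (c *\<^sub>C x) = c * l x)"

lemma functional_combination:
  fixes W :: "'a::complex_inner set" and l :: "'i \<Rightarrow> 'a \<Rightarrow> complex"
  assumes "finite I" "csubspace W" "\<And>i. i \<in> I \<Longrightarrow> linear_on_csubspace W (l i)" "linear_on_csubspace W \<Lambda>"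
    and "\<And>x. x \<in> W \<Longrightarrow> (\<And>i. i \<in> I \<Longrightarrow> l i x = 0) \<Longrightarrow> \<Lambda> x = 0"
  shows "\<exists>c. \<forall>x\<in>W. \<Lambda> x = (\<Sum>i\<in>I. c i * l i x)"
  using assms
proof (induction I arbitrary: W rule: finite_induct)
  case empty
  then show ?case by auto
next
  case (insert j I)
  define W' where "W' = {x \<in> W. l j x = 0}"
  have lj: "linear_on_csubspace W (l j)" using insert.prems(2) by simp
  have W: "0 \<in> W" "\<And>x y. x \<in> W \<Longrightarrow> y \<in> W \<Longrightarrow> x + y \<in> W" "\<And>c x. x \<in> W \<Longrightarrow> c *\<^sub>C x \<in> W"
    using insert.prems(1) by (auto simp: complex_vector.subspace_def)
  have lj0: "l j 0 = 0" using lj W(1) unfolding linear_on_csubspace_def by (metis mult_zero_left scaleC_zero_right)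
  have "csubspace W'"
    using W lj lj0 by (auto simp: complex_vector.subspace_def W'_def linear_on_csubspace_def)
  moreover have "linear_on_csubspace W' m" if "linear_on_csubspace W m" for m
    using that by (auto simp: linear_on_csubspace_def W'_def)
  ultimately have "\<exists>c. \<forall>x\<in>W'. \<Lambda> x = (\<Sum>i\<in>I. c i * l i x)"
  proof (intro insert.IH)
    show "\<Lambda> x = 0" if "x \<in> W'" "\<And>i. i \<in> I \<Longrightarrow> l i x = 0" for x
      by (rule insert.prems(4)) (use that in \<open>auto simp: W'_def\<close>)
  qed (use insert.prems(2,3) in auto)
  then obtain c where c: "\<forall>x\<in>W'. \<Lambda> x = (\<Sum>i\<in>I. c i * l i x)" by blast
  show ?case
  proof (cases "\<exists>x0\<in>W. l j x0 \<noteq> 0")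
    case False
    then have "\<forall>x\<in>W. \<Lambda> x = (\<Sum>i\<in>insert j I. c i * l i x)" using c insert.hyps by (simp add: W'_def)
    then show ?thesis by blast
  next
    case True
    then obtain x1 where x1: "x1 \<in> W" "l j x1 \<noteq> 0" by blast
    define x0 where "x0 = (1 / l j x1) *\<^sub>C x1"
    have x0: "x0 \<in> W" "l j x0 = 1" using x1 W(3) lj by (simp_all add: x0_def linear_on_csubspace_def)
    define a where "a = \<Lambda> x0 - (\<Sum>i\<in>I. c i * l i x0)"
    have "\<Lambda> x = (\<Sum>i\<in>insert j I. (c(j := a)) i * l i x)" if x: "x \<in> W" for x
    proof -
      define y where "y = x + (- l j x) *\<^sub>C x0"
      have yW: "y \<in> W" unfolding y_def using x x0 W by blast
      have m: "m y = m x - l j x * m x0" if "linear_on_csubspace W m" for m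
        using that x x0(1) W(3)[OF x0(1)] unfolding y_def linear_on_csubspace_def by (metis diff_conv_add_uminus mult_minus_left)
      have "y \<in> W'" using yW m[OF lj] x0(2) by (simp add: W'_def)
      then have "\<Lambda> y = (\<Sum>i\<in>I. c i * l i y)" using c by blast
      moreover have "l i y = l i x - l j x * l i x0" if "i \<in> I" for i
        using m insert.prems(2) that by simp
      ultimately have "\<Lambda> x - l j x * \<Lambda> x0 = (\<Sum>i\<in>I. c i * (l i x - l j x * l i x0))"
        using m[OF insert.prems(3)] by simp
      also have "\<dots> = (\<Sum>i\<in>I. c i * l i x) - l j x * (\<Sum>i\<in>I. c i * l i x0)"
        by (simp add: right_diff_distrib sum_subtractf sum_distrib_left mult.left_commute)
      finally have "\<Lambda> x = a * l j x + (\<Sum>i\<in>I. c i * l i x)" by (simp add: a_def algebra_simps)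
      also have "(\<Sum>i\<in>I. c i * l i x) = (\<Sum>i\<in>I. (c(j := a)) i * l i x)"
        using insert.hyps by (intro sum.cong) auto
      finally show ?thesis using insert.hyps by simp
    qed
    then show ?thesis by blast
  qed
qed

lemma functional_separation:
  fixes W :: "'a::complex_inner set" and l :: "'i \<Rightarrow> 'a \<Rightarrow> complex"
  assumes "finite I" "csubspace W" "\<And>i. i \<in> I \<Longrightarrow> linear_on_csubspace W (l i)"
    and "\<And>y. y \<in> W \<Longrightarrow> \<exists>i\<in>I. l i y \<noteq> l i x"
  shows "\<exists>c. (\<forall>y\<in>W. (\<Sum>i\<in>I. c i * l i y) = 0) \<and> (\<Sum>i\<in>I. c i * l i x) \<noteq> 0"
  using assms
proof (induction I rule: finite_induct)
  case empty
  then show ?case by (auto simp: complex_vector.subspace_def)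
next
  case (insert j I)
  have upd: "(\<Sum>i\<in>insert j I. (c(j := a)) i * l i y) = a * l j y + (\<Sum>i\<in>I. c i * l i y)" for c a y
  proof -
    have "(\<Sum>i\<in>I. (c(j := a)) i * l i y) = (\<Sum>i\<in>I. c i * l i y)"
      using insert.hyps by (intro sum.cong) auto
    then show ?thesis using insert.hyps by simp
  qed
  show ?case
  proof (cases "\<forall>y\<in>W. \<exists>i\<in>I. l i y \<noteq> l i x")
    case True
    then obtain c where "(\<forall>y\<in>W. (\<Sum>i\<in>I. c i * l i y) = 0) \<and> (\<Sum>i\<in>I. c i * l i x) \<noteq> 0"
      using insert.IH insert.prems by auto
    then show ?thesis using upd[of c 0] by (intro exI[of _ "c(j := 0)"]) simp
  next
    case False
    then obtain y0 where y0: "y0 \<in> W" "\<And>i. i \<in> I \<Longrightarrow> l i y0 = l i x" by blast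
    have W: "\<And>x y. x \<in> W \<Longrightarrow> y \<in> W \<Longrightarrow> x + y \<in> W" "\<And>c x. x \<in> W \<Longrightarrow> c *\<^sub>C x \<in> W"
      using insert.prems(1) by (auto simp: complex_vector.subspace_def)
    have lin: "l i (a + b) = l i a + l i b" "l i (c *\<^sub>C a) = c * l i a" if "i \<in> insert j I" "a \<in> W" "b \<in> W" for i a b c
      using insert.prems(2)[OF that(1)] that by (auto simp: linear_on_csubspace_def)
    have ne: "l j y0 \<noteq> l j x" using insert.prems(3)[OF y0(1)] y0(2) by auto
    have "l j w = 0" if w: "w \<in> W" "\<And>i. i \<in> I \<Longrightarrow> l i w = 0" for w
    proof (rule ccontr)
      assume nz: "l j w \<noteq> 0"
      define v where "v = ((l j x - l j y0) / l j w) *\<^sub>C w"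
      have v: "v \<in> W" unfolding v_def by (rule W(2)[OF w(1)])
      have "l i (y0 + v) = l i x" if "i \<in> insert j I" for i
        using that y0(2) w(2) nz lin(1)[OF that y0(1) v] lin(2)[OF that w(1) w(1)] by (auto simp: v_def)
      then show False using insert.prems(3)[OF W(1)[OF y0(1) v]] by blast
    qed
    then obtain c where c: "\<forall>x\<in>W. l j x = (\<Sum>i\<in>I. c i * l i x)"
      using functional_combination[OF insert.hyps(1) insert.prems(1), of l "l j"] insert.prems(2) by auto
    have "(\<Sum>i\<in>I. c i * l i x) = l j y0" using c y0 by simp
    then have "1 * l j x + (\<Sum>i\<in>I. (- c i) * l i x) \<noteq> 0" using ne by (simp add: sum_negf)
    moreover have "\<forall>y\<in>W. 1 * l j y + (\<Sum>i\<in>I. (- c i) * l i y) = 0" using c by (simp add: sum_negf)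
    ultimately show ?thesis using upd[of "\<lambda>i. - c i" 1] by (intro exI[of _ "(\<lambda>i. - c i)(j := 1)"]) simp
  qed
qed

section \<open>The weak* topology of the operators\<close>

lemma rank_two_trace_class:
  fixes H K :: "'a::{complex_inner, complete_space} set"
  assumes "closed_csubspace H" "closed_csubspace K" "f\<^sub>1 \<in> H" "f\<^sub>2 \<in> H" "g\<^sub>1 \<in> K" "g\<^sub>2 \<in> K"
  shows "rank_two K f\<^sub>1 g\<^sub>1 f\<^sub>2 g\<^sub>2 \<in> trace_class K H"
  using rank_two_in_rank_le_ops[OF assms] by (simp add: rank_le_ops_def)

lemma topspace_weak_star:
  fixes H K :: "'a::{complex_inner, complete_space} set"
  assumes "closed_csubspace H" "closed_csubspace K"
  shows "topspace (weak_star H K) = bounded_ops H K"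
proof -
  have "rank_two K 0 0 0 0 \<in> trace_class K H"
    using assms closed_csubspaceD(1) by (intro rank_two_trace_class) blast+
  then show ?thesis unfolding weak_star_def by (intro topspace_weak_topology_on) blast
qed

lemma closedin_annihilator:
  fixes H K :: "'a::{complex_inner, complete_space} set"
  assumes H: "closed_csubspace H" and K: "closed_csubspace K" and M: "M \<subseteq> trace_class K H"
  shows "closedin (weak_star H K) (annihilator H K M)"
proof -
  have "topspace (weak_star H K) - annihilator H K M =
      (\<Union>t\<in>M. {T \<in> bounded_ops H K. pairing H K T t \<in> - {0}})"
    by (auto simp: topspace_weak_star[OF H K] annihilator_def)
  moreover have "openin (weak_star H K) {T \<in> bounded_ops H K. pairing H K T t \<in> - {0}}" if "t \<in> M" for t
    unfolding weak_star_def using that M by (intro openin_weak_topology_basic) auto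
  ultimately have "openin (weak_star H K) (topspace (weak_star H K) - annihilator H K M)" by auto
  moreover have "annihilator H K M \<subseteq> topspace (weak_star H K)"
    by (auto simp: topspace_weak_star[OF H K] annihilator_def)
  ultimately show ?thesis by (simp add: closedin_def)
qed

lemma bounded_ops_eqI:
  fixes H K :: "'a::{complex_inner, complete_space} set"
  assumes H: "closed_csubspace H" and T: "T \<in> bounded_ops H K" and U: "U \<in> bounded_ops H K"
    and X: "X \<subseteq> H" "H \<inter> orth_compl X \<subseteq> {0}" and eq: "\<And>x. x \<in> X \<Longrightarrow> T x = U x"
  shows "T = U"
proof -
  let ?M = "{x \<in> H. T x = U x}"
  have "closed_csubspace ?M"
    unfolding closed_csubspace_def
  proof (intro conjI ballI allI)
    show "0 \<in> ?M" using closed_csubspaceD(1)[OF H] bounded_ops_zero[OF T H] bounded_ops_zero[OF U H] by simp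
    show "x + y \<in> ?M" if "x \<in> ?M" "y \<in> ?M" for x y
      using that closed_csubspaceD(2)[OF H] by (simp add: bounded_opsD(3)[OF T] bounded_opsD(3)[OF U])
    show "c *\<^sub>C x \<in> ?M" if "x \<in> ?M" for c x
      using that closed_csubspaceD(3)[OF H] by (simp add: bounded_opsD(4)[OF T] bounded_opsD(4)[OF U])
    show "closed ?M"
      unfolding closed_sequential_limits
    proof (intro allI impI, elim conjE)
      fix f x assume f: "\<forall>n. f n \<in> ?M" and lim: "f \<longlonglongrightarrow> x"
      then have fH: "f n \<in> H" for n by simp
      have x: "x \<in> H" by (rule closed_sequentially[OF closed_csubspaceD(5)[OF H] fH lim])
      have "(\<lambda>n. T (f n)) = (\<lambda>n. U (f n))" using f by auto
      then have "T x = U x"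
        using LIMSEQ_unique[OF bounded_ops_tendsto[OF T H fH lim]] bounded_ops_tendsto[OF U H fH lim] by simp
      then show "x \<in> ?M" using x by simp
    qed
  qed
  then have "?M = H"
    by (rule closed_csubspace_total[OF _ H, where X = X]) (use X eq in auto)
  then show ?thesis using bounded_opsD(1)[OF T] bounded_opsD(1)[OF U] by (intro ext) (metis (mono_tags, lifting) mem_Collect_eq)
qed

text \<open>An identity for one matrix coefficient is a closed linear condition, so that it can be checked on
a total set.\<close>

lemma closed_csubspace_coefficient_eq:
  fixes H K :: "'a::{complex_inner, complete_space} set"
  assumes H: "closed_csubspace H" and T: "T \<in> bounded_ops H K"
  shows "closed_csubspace {x \<in> H. cinner (T x) g = cinner x y}"
  unfolding closed_csubspace_def
proof (intro conjI ballI allI)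
  let ?M = "{x \<in> H. cinner (T x) g = cinner x y}"
  show "0 \<in> ?M" using closed_csubspaceD(1)[OF H] bounded_ops_zero[OF T H] by simp
  show "x + x' \<in> ?M" if "x \<in> ?M" "x' \<in> ?M" for x x'
    using that closed_csubspaceD(2)[OF H] by (simp add: bounded_opsD(3)[OF T] cinner_add_left)
  show "c *\<^sub>C x \<in> ?M" if "x \<in> ?M" for c x
    using that closed_csubspaceD(3)[OF H] by (simp add: bounded_opsD(4)[OF T] cinner_scaleC_left)
  show "closed ?M"
    unfolding closed_sequential_limits
  proof (intro allI impI, elim conjE)
    fix f x assume f: "\<forall>n. f n \<in> ?M" and lim: "f \<longlonglongrightarrow> x"
    then have fH: "f n \<in> H" for n by simp
    have x: "x \<in> H" by (rule closed_sequentially[OF closed_csubspaceD(5)[OF H] fH lim])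
    have "(\<lambda>n. cinner (T (f n)) g) \<longlonglongrightarrow> cinner (T x) g"
      by (rule bounded_linear.tendsto[OF bounded_linear_cinner_left bounded_ops_tendsto[OF T H fH lim]])
    moreover have "(\<lambda>n. cinner (f n) y) \<longlonglongrightarrow> cinner x y"
      by (rule bounded_linear.tendsto[OF bounded_linear_cinner_left lim])
    moreover have "(\<lambda>n. cinner (T (f n)) g) = (\<lambda>n. cinner (f n) y)" using f by auto
    ultimately have "cinner (T x) g = cinner x y" using LIMSEQ_unique by metis
    then show "x \<in> ?M" using x by simp
  qed
qed

section \<open>Dual truncated Toeplitz operators\<close>

text \<open>For a bounded symbol the formula \<open>f \<mapsto> P(\<phi> f)\<close> makes sense on the whole space.\<close>

definition toeplitz :: "L2 \<Rightarrow> L2 \<Rightarrow> L2 \<Rightarrow> L2 \<Rightarrow> L2" where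
  "toeplitz \<theta> \<alpha> \<phi> f = (if f \<in> model_perp \<theta> then orth_proj (model_perp \<alpha>) (\<phi> *\<^sub>L f) else 0)"

lemma toeplitz_norm_le:
  assumes "\<phi> \<in> Linf" "f \<in> model_perp \<theta>"
  shows "norm (toeplitz \<theta> \<alpha> \<phi> f) \<le> Linf_norm \<phi> * norm f"
  using norm_orth_proj_le[OF closed_csubspace_model_perp, of \<alpha> "\<phi> *\<^sub>L f"] norm_mult_le[OF assms(1), of f] assms(2)
  by (simp add: toeplitz_def)

lemma toeplitz_bounded_ops:
  assumes \<phi>: "\<phi> \<in> Linf"
  shows "toeplitz \<theta> \<alpha> \<phi> \<in> bounded_ops (model_perp \<theta>) (model_perp \<alpha>)"
proof (rule bounded_opsI)
  note H = closed_csubspace_model_perp[of \<theta>] and K = closed_csubspace_model_perp[of \<alpha>]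
  show "toeplitz \<theta> \<alpha> \<phi> x \<in> model_perp \<alpha>" if "x \<in> model_perp \<theta>" for x
    using that orth_proj_in[OF K] by (simp add: toeplitz_def)
  show "toeplitz \<theta> \<alpha> \<phi> (x + y) = toeplitz \<theta> \<alpha> \<phi> x + toeplitz \<theta> \<alpha> \<phi> y"
    if "x \<in> model_perp \<theta>" "y \<in> model_perp \<theta>" for x y
    using that closed_csubspaceD(2)[OF H that]
    by (simp add: toeplitz_def mult_add_right[OF \<phi>] orth_proj_add[OF K])
  show "toeplitz \<theta> \<alpha> \<phi> (c *\<^sub>C x) = c *\<^sub>C toeplitz \<theta> \<alpha> \<phi> x" if "x \<in> model_perp \<theta>" for c x
    using that closed_csubspaceD(3)[OF H that]
    by (simp add: toeplitz_def mult_scaleC_right[OF \<phi>] orth_proj_scaleC[OF K])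
  show "norm (toeplitz \<theta> \<alpha> \<phi> x) \<le> Linf_norm \<phi> * norm x" if "x \<in> model_perp \<theta>" for x
    by (rule toeplitz_norm_le[OF \<phi> that])
qed (simp add: toeplitz_def)

lemma toeplitz_ext: "\<phi> \<in> Linf \<Longrightarrow> dual_toeplitz_ext \<theta> \<alpha> \<phi> (toeplitz \<theta> \<alpha> \<phi>)"
  unfolding dual_toeplitz_ext_def by (simp add: toeplitz_bounded_ops) (simp add: toeplitz_def)

lemma dual_toeplitz_ext_unique:
  assumes \<theta>: "inner_function \<theta>" and T: "dual_toeplitz_ext \<theta> \<alpha> \<phi> T" and U: "dual_toeplitz_ext \<theta> \<alpha> \<phi> U"
  shows "T = U"
proof (rule bounded_ops_eqI[OF closed_csubspace_model_perp])
  show "T \<in> bounded_ops (model_perp \<theta>) (model_perp \<alpha>)" "U \<in> bounded_ops (model_perp \<theta>) (model_perp \<alpha>)"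
    using T U by (auto simp: dual_toeplitz_ext_def)
  show "model_perp_gens \<theta> \<subseteq> model_perp \<theta>" using model_perp_gens_subset[OF \<theta>] by blast
  show "model_perp \<theta> \<inter> orth_compl (model_perp_gens \<theta>) \<subseteq> {0}" by (rule model_perp_gens_total[OF \<theta>])
  show "T x = U x" if "x \<in> model_perp_gens \<theta>" for x
    using T U subsetD[OF model_perp_gens_subset[OF \<theta>] that] by (simp add: dual_toeplitz_ext_def)
qed

lemma dual_toeplitz_eq:
  assumes "inner_function \<theta>" "\<phi> \<in> Linf"
  shows "dual_toeplitz \<theta> \<alpha> \<phi> = toeplitz \<theta> \<alpha> \<phi>"
  unfolding dual_toeplitz_def
  using toeplitz_ext[OF assms(2)] dual_toeplitz_ext_unique[OF assms(1)] by (intro the_equality) blast+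

lemma cinner_toeplitz:
  assumes "f \<in> model_perp \<theta>" "g \<in> model_perp \<alpha>"
  shows "cinner (toeplitz \<theta> \<alpha> \<phi> f) g = cinner (\<phi> *\<^sub>L f) g"
  using assms by (simp add: toeplitz_def cinner_orth_proj[OF closed_csubspace_model_perp])

lemma toeplitz_add:
  assumes p: "\<phi> \<in> Linf" and q: "\<psi> \<in> Linf"
  shows "toeplitz \<theta> \<alpha> (\<phi> + \<psi>) = (\<lambda>f. toeplitz \<theta> \<alpha> \<phi> f + toeplitz \<theta> \<alpha> \<psi> f)"
  by (rule ext) (simp add: toeplitz_def mult_add_left[OF p q] orth_proj_add[OF closed_csubspace_model_perp])

lemma toeplitz_scaleC:
  assumes p: "\<phi> \<in> Linf"
  shows "toeplitz \<theta> \<alpha> (c *\<^sub>C \<phi>) = (\<lambda>f. c *\<^sub>C toeplitz \<theta> \<alpha> \<phi> f)"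
  by (rule ext) (simp add: toeplitz_def mult_scaleC_left[OF p] orth_proj_scaleC[OF closed_csubspace_model_perp])

text \<open>Here \<open>\<phi>\<close> may be unbounded, in which case its product with \<open>p\<close> makes sense because \<open>p\<close> is
bounded.\<close>

lemma cinner_symbol:
  assumes q: "q \<in> Linf" and bdd: "p \<in> Linf \<or> \<phi> \<in> Linf"
  shows "cinner (\<phi> *\<^sub>L p) q = cinner p (q *\<^sub>L conj_L2 \<phi>)"
proof (rule cinner_AE_eqI)
  have "AE z in \<mu>. rep_L2 (\<phi> *\<^sub>L p) z = rep_L2 \<phi> z * rep_L2 p z"
    using bdd rep_mult rep_mult' by blast
  then show "AE z in \<mu>. rep_L2 (\<phi> *\<^sub>L p) z * cnj (rep_L2 q z) = rep_L2 p z * cnj (rep_L2 (q *\<^sub>L conj_L2 \<phi>) z)"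
    using rep_mult[OF q, of "conj_L2 \<phi>"] rep_conj[of \<phi>] by eventually_elim simp
qed

text \<open>The symbol is bounded by the norm of the operator: since \<open>z\<^sup>-\<^sup>N p\<close> and \<open>z\<^sup>-\<^sup>N q\<close> lie in both
spaces for trigonometric polynomials \<open>p, q\<close> and large \<open>N\<close>, the operator bounds the sesquilinear form
\<open>\<langle>\<phi> p, q\<rangle>\<close>, first for these and then by density for all \<open>p\<close> and bounded \<open>q\<close>; for \<open>q\<close> the indicator
function of \<open>{|\<phi>| > C}\<close> this says that the set is null.\<close>

lemma symbol_bound:
  assumes T: "dual_toeplitz_ext \<theta> \<alpha> \<phi> T" and C: "C = op_norm (model_perp \<theta>) T"
  shows "AE z in \<mu>. cmod (rep_L2 \<phi> z) \<le> C"
proof -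
  let ?H = "model_perp \<theta>"
  have Tb: "T \<in> bounded_ops ?H (model_perp \<alpha>)" using T by (simp add: dual_toeplitz_ext_def)
  have bound: "norm (T x) \<le> C * norm x" if "x \<in> ?H" for x
    unfolding C by (rule norm_le_op_norm[OF Tb closed_csubspace_model_perp that])
  have C0: "C \<ge> 0"
  proof -
    have "0 \<le> norm (T (zpow (-1)))" by simp
    also have "\<dots> \<le> C * norm (zpow (-1))" by (intro bound coH2_model_perp zpow_coH2) simp
    also have "norm (zpow (-1)) = 1"
    proof -
      have "(norm (zpow (-1)))\<^sup>2 = 1" using cinner_zpow_zpow[of "-1" "-1"] by (simp add: norm_sq_cinner)
      then show ?thesis by (simp add: power2_eq_1_iff) (use norm_ge_zero[of "zpow (-1)"] in linarith)
    qed
    finally show ?thesis by simp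
  qed
  have 1: "cmod (cinner (\<phi> *\<^sub>L p) q) \<le> C * norm p * norm q" if p: "p \<in> eventually_coH2" and q: "q \<in> eventually_coH2" for p q
  proof -
    obtain N1 N2 where N1: "\<And>N. N \<ge> N1 \<Longrightarrow> zpow (- N) *\<^sub>L p \<in> coH2" and N2: "\<And>N. N \<ge> N2 \<Longrightarrow> zpow (- N) *\<^sub>L q \<in> coH2"
      using p q unfolding eventually_coH2_def by blast
    define N where "N = max N1 N2"
    have pc: "zpow (- N) *\<^sub>L p \<in> coH2" and qc: "zpow (- N) *\<^sub>L q \<in> coH2" using N1 N2 by (simp_all add: N_def)
    have pL: "p \<in> Linf" using p by (simp add: eventually_coH2_def)
    have "\<phi> *\<^sub>L (zpow (- N) *\<^sub>L p) = zpow (- N) *\<^sub>L (\<phi> *\<^sub>L p)"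
      by (metis L2_mult_commute mult_assoc[OF zpow_Linf pL])
    then have "cinner (\<phi> *\<^sub>L (zpow (- N) *\<^sub>L p)) (zpow (- N) *\<^sub>L q) = cinner (\<phi> *\<^sub>L p) q"
      by (simp add: cinner_shift shift_shift)
    moreover have "T (zpow (- N) *\<^sub>L p) = orth_proj (model_perp \<alpha>) (\<phi> *\<^sub>L (zpow (- N) *\<^sub>L p))"
      using T coH2_model_perp[OF pc] Linf_mult[OF zpow_Linf pL] by (auto simp: dual_toeplitz_ext_def)
    ultimately have "cinner (\<phi> *\<^sub>L p) q = cinner (T (zpow (- N) *\<^sub>L p)) (zpow (- N) *\<^sub>L q)"
      using cinner_orth_proj(1)[OF closed_csubspace_model_perp coH2_model_perp[OF qc]] by simp
    then have "cmod (cinner (\<phi> *\<^sub>L p) q) \<le> norm (T (zpow (- N) *\<^sub>L p)) * norm (zpow (- N) *\<^sub>L q)"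
      using norm_cinner_le by simp
    also have "\<dots> \<le> (C * norm (zpow (- N) *\<^sub>L p)) * norm (zpow (- N) *\<^sub>L q)"
      by (intro mult_right_mono bound coH2_model_perp pc) simp
    finally show ?thesis by (simp add: unimodular_norm[OF unimodular_zpow])
  qed
  have approx: "\<exists>f. (\<forall>n. f n \<in> eventually_coH2) \<and> f \<longlonglongrightarrow> x" for x
  proof -
    have "\<exists>p. p \<in> eventually_coH2 \<and> norm (x - p) < inverse (real (Suc n))" for n
      using eventually_coH2_dense[of "inverse (real (Suc n))" x] by auto
    then obtain f where f: "\<And>n. f n \<in> eventually_coH2" "\<And>n. norm (x - f n) < inverse (real (Suc n))" by metis
    have "(\<lambda>n. f n - x) \<longlonglongrightarrow> 0"
      by (rule Lim_null_comparison[OF _ LIMSEQ_inverse_real_of_nat])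
        (use f(2) in \<open>auto simp: norm_minus_commute less_imp_le\<close>)
    then show ?thesis using f(1) LIM_zero_cancel by blast
  qed
  have 2: "cmod (cinner (\<phi> *\<^sub>L p) q) \<le> C * norm p * norm q" if p: "p \<in> eventually_coH2" for p q
  proof -
    obtain f where f: "\<And>n. f n \<in> eventually_coH2" "f \<longlonglongrightarrow> q" using approx by blast
    show ?thesis
    proof (rule LIMSEQ_le)
      show "(\<lambda>n. cmod (cinner (\<phi> *\<^sub>L p) (f n))) \<longlonglongrightarrow> cmod (cinner (\<phi> *\<^sub>L p) q)"
        by (intro tendsto_norm bounded_linear.tendsto[OF bounded_linear_cinner_right f(2)])
      show "(\<lambda>n. C * norm p * norm (f n)) \<longlonglongrightarrow> C * norm p * norm q" by (intro tendsto_intros f(2))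
    qed (use 1 p f(1) in blast)
  qed
  have 3: "cmod (cinner p (q *\<^sub>L conj_L2 \<phi>)) \<le> C * norm p * norm q" if q: "q \<in> Linf" for p q
  proof -
    obtain f where f: "\<And>n. f n \<in> eventually_coH2" "f \<longlonglongrightarrow> p" using approx by blast
    show ?thesis
    proof (rule LIMSEQ_le)
      show "(\<lambda>n. cmod (cinner (f n) (q *\<^sub>L conj_L2 \<phi>))) \<longlonglongrightarrow> cmod (cinner p (q *\<^sub>L conj_L2 \<phi>))"
        by (intro tendsto_norm bounded_linear.tendsto[OF bounded_linear_cinner_left f(2)])
      show "(\<lambda>n. C * norm (f n) * norm q) \<longlonglongrightarrow> C * norm p * norm q" by (intro tendsto_intros f(2))
      have "cinner (f n) (q *\<^sub>L conj_L2 \<phi>) = cinner (\<phi> *\<^sub>L f n) q" for n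
        using f(1)[of n] cinner_symbol[OF q, of "f n" \<phi>] by (simp add: eventually_coH2_def)
      then show "\<exists>N. \<forall>n\<ge>N. cmod (cinner (f n) (q *\<^sub>L conj_L2 \<phi>)) \<le> C * norm (f n) * norm q"
        using 2 f(1) by auto
    qed
  qed
  \<comment> \<open>With \<open>q\<close> the indicator function of \<open>E\<close> and \<open>p\<close> its product with the conjugate of \<open>\<phi>\<close>, the
    bound says that \<open>|\<phi>|\<^sup>2 - C\<^sup>2\<close>, which is positive on \<open>E\<close>, has a nonpositive integral over \<open>E\<close>.\<close>
  define E where "E = {z. cmod (rep_L2 \<phi> z) > C}"
  have E [measurable]: "E \<in> sets \<mu>"
  proof -
    have "{z \<in> space \<mu>. cmod (rep_L2 \<phi> z) > C} \<in> sets \<mu>" by measurable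
    then show ?thesis by (simp add: E_def)
  qed
  have sqE: "sq_integrable (indicator E :: complex \<Rightarrow> complex)"
    unfolding sq_integrable_def
    by (intro conjI circle.integrable_const_bound[where B = 1]) (auto simp: indicator_def)
  define q where "q = abs_L2 (indicator E)"
  have rep_q: "AE z in \<mu>. rep_L2 q z = indicator E z" unfolding q_def by (rule rep_abs_L2[OF sqE])
  have qL: "q \<in> Linf"
    by (rule LinfI(1)[where C = 1]) (use rep_q in \<open>eventually_elim, simp add: indicator_def\<close>)
  let ?p = "q *\<^sub>L conj_L2 \<phi>"
  have "(norm ?p)\<^sup>2 \<le> C * norm ?p * norm q" using 3[OF qL, of ?p] by (simp add: cinner_self norm_power)
  then have "norm ?p \<le> C * norm q"
    using C0 by (cases "norm ?p = 0") (auto simp: power2_eq_square)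
  then have "(norm ?p)\<^sup>2 \<le> C\<^sup>2 * (norm q)\<^sup>2" using power_mono[of "norm ?p" "C * norm q" 2] by (simp add: power_mult_distrib)
  then have le: "(norm ?p)\<^sup>2 - C\<^sup>2 * (norm q)\<^sup>2 \<le> 0" by simp
  define v where "v z = (cmod (rep_L2 ?p z))\<^sup>2 - C\<^sup>2 * (cmod (rep_L2 q z))\<^sup>2" for z
  have vi: "integrable \<mu> v" unfolding v_def by (simp add: sq_integrable_int)
  have v_int: "(LINT z|\<mu>. v z) \<le> 0"
    using le unfolding v_def norm_sq_rep by (simp add: sq_integrable_int)
  have v_eq: "AE z in \<mu>. v z = indicator E z * ((cmod (rep_L2 \<phi> z))\<^sup>2 - C\<^sup>2)"
    using rep_q rep_mult[OF qL, of "conj_L2 \<phi>"] rep_conj[of \<phi>]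
    by eventually_elim (simp add: v_def indicator_def)
  have pos: "0 < (cmod (rep_L2 \<phi> z))\<^sup>2 - C\<^sup>2" if "z \<in> E" for z
    using that C0 power_strict_mono[of C "cmod (rep_L2 \<phi> z)" 2] by (simp add: E_def)
  have v0: "AE z in \<mu>. 0 \<le> v z"
    using v_eq by eventually_elim (use pos in \<open>auto simp: indicator_def less_imp_le\<close>)
  then have "(LINT z|\<mu>. v z) = 0" using v_int integral_nonneg_AE[OF v0] by simp
  then have "AE z in \<mu>. v z = 0" using integral_nonneg_eq_0_iff_AE[OF vi v0] by simp
  then show ?thesis
    using v_eq
  proof eventually_elim
    fix z assume "v z = 0" "v z = indicator E z * ((cmod (rep_L2 \<phi> z))\<^sup>2 - C\<^sup>2)"
    then have "z \<notin> E" using pos[of z] by auto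
    then show "cmod (rep_L2 \<phi> z) \<le> C" by (simp add: E_def)
  qed
qed

lemma toeplitz_op_norm:
  assumes \<phi>: "\<phi> \<in> Linf"
  shows "op_norm (model_perp \<theta>) (toeplitz \<theta> \<alpha> \<phi>) = Linf_norm \<phi>"
proof (rule antisym)
  show "op_norm (model_perp \<theta>) (toeplitz \<theta> \<alpha> \<phi>) \<le> Linf_norm \<phi>"
    by (rule op_norm_le[OF closed_csubspace_model_perp Linf_norm_nonneg[OF \<phi>] toeplitz_norm_le[OF \<phi>]])
  show "Linf_norm \<phi> \<le> op_norm (model_perp \<theta>) (toeplitz \<theta> \<alpha> \<phi>)"
    by (rule LinfI(2)[OF symbol_bound[OF toeplitz_ext[OF \<phi>] refl]])
qed

lemma dual_toeplitz_ops_eq: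
  assumes \<theta>: "inner_function \<theta>"
  shows "dual_toeplitz_ops \<theta> \<alpha> = toeplitz \<theta> \<alpha> ` Linf"
proof
  show "dual_toeplitz_ops \<theta> \<alpha> \<subseteq> toeplitz \<theta> \<alpha> ` Linf"
  proof
    fix T assume "T \<in> dual_toeplitz_ops \<theta> \<alpha>"
    then obtain \<phi> where T: "dual_toeplitz_ext \<theta> \<alpha> \<phi> T" by (auto simp: dual_toeplitz_ops_def)
    have "\<phi> \<in> Linf" by (rule LinfI(1)[OF symbol_bound[OF T refl]])
    then show "T \<in> toeplitz \<theta> \<alpha> ` Linf" using dual_toeplitz_ext_unique[OF \<theta> T toeplitz_ext] by blast
  qed
qed (use toeplitz_ext in \<open>auto simp: dual_toeplitz_ops_def\<close>)

lemma toeplitz_inj: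
  assumes "\<phi> \<in> Linf" "\<psi> \<in> Linf" "toeplitz \<theta> \<alpha> \<phi> = toeplitz \<theta> \<alpha> \<psi>"
  shows "\<phi> = \<psi>"
proof -
  define d where "d = \<phi> + (-1) *\<^sub>C \<psi>"
  have d: "d \<in> Linf" unfolding d_def using assms by (intro Linf_add Linf_scaleC)
  have "toeplitz \<theta> \<alpha> d = (\<lambda>f. 0)"
    unfolding d_def toeplitz_add[OF assms(1) Linf_scaleC[OF assms(2)]] toeplitz_scaleC[OF assms(2)]
    by (simp add: assms(3) scaleC_minus1)
  then have "op_norm (model_perp \<theta>) (toeplitz \<theta> \<alpha> d) \<le> 0"
    by (intro op_norm_le[OF closed_csubspace_model_perp]) auto
  then have "Linf_norm d \<le> 0" by (simp add: toeplitz_op_norm[OF d])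
  have "AE z in \<mu>. rep_L2 d z = rep_L2 0 z"
    using AE_le_Linf_norm[OF d] rep_zero
    by eventually_elim (metis \<open>Linf_norm d \<le> 0\<close> norm_le_zero_iff order_trans)
  then have "d = 0" by (rule L2_eqI)
  then show ?thesis by (simp add: d_def scaleC_minus1)
qed

section \<open>The duality with \<open>L\<^sup>1\<close>\<close>

lemma Linf_L1_pairing_eq:
  "h \<in> borel_measurable \<mu> \<Longrightarrow>
    Linf_L1_pairing h \<phi> = (LINT z|\<mu>. rep_L2 \<phi> z * h z)"
  by (simp add: Linf_L1_pairing.rep_eq)

lemma integrable_Linf_L1:
  assumes \<phi>: "\<phi> \<in> Linf" and h: "integrable \<mu> h"
  shows "integrable \<mu> (\<lambda>z. rep_L2 \<phi> z * h z)"
  by (rule bounded_mult_integrable[OF _ AE_le_Linf_norm[OF \<phi>] h])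
    (use rep_L2_measurable[of \<phi>] in \<open>simp cong: measurable_cong_sets\<close>)

lemma Linf_L1_pairing_add:
  assumes "\<phi> \<in> Linf" "\<psi> \<in> Linf" "integrable \<mu> h"
  shows "Linf_L1_pairing h (\<phi> + \<psi>) = Linf_L1_pairing h \<phi> + Linf_L1_pairing h \<psi>"
proof -
  note [measurable] = borel_measurable_integrable[OF assms(3)]
  have "(LINT z|\<mu>. rep_L2 (\<phi> + \<psi>) z * h z) =
      (LINT z|\<mu>. rep_L2 \<phi> z * h z + rep_L2 \<psi> z * h z)"
  proof (rule integral_cong_AE)
    show "AE z in \<mu>. rep_L2 (\<phi> + \<psi>) z * h z = rep_L2 \<phi> z * h z + rep_L2 \<psi> z * h z"
      using rep_plus[of \<phi> \<psi>] by eventually_elim (simp add: algebra_simps)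
  qed simp_all
  then show ?thesis using assms by (simp add: Linf_L1_pairing_eq integrable_Linf_L1)
qed

lemma Linf_L1_pairing_scaleC:
  assumes "integrable \<mu> h"
  shows "Linf_L1_pairing h (c *\<^sub>C \<phi>) = c * Linf_L1_pairing h \<phi>"
proof -
  note [measurable] = borel_measurable_integrable[OF assms]
  have "(LINT z|\<mu>. rep_L2 (c *\<^sub>C \<phi>) z * h z) = (LINT z|\<mu>. c * (rep_L2 \<phi> z * h z))"
  proof (rule integral_cong_AE)
    show "AE z in \<mu>. rep_L2 (c *\<^sub>C \<phi>) z * h z = c * (rep_L2 \<phi> z * h z)"
      using rep_scaleC[of c \<phi>] by eventually_elim simp
  qed simp_all
  then show ?thesis by (simp add: Linf_L1_pairing_eq)
qed

lemma Linf_L1_pairing_comb: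
  assumes \<phi>: "\<phi> \<in> Linf" and h: "\<And>i. i \<in> I \<Longrightarrow> integrable \<mu> (h i)"
  shows "Linf_L1_pairing (\<lambda>z. \<Sum>i\<in>I. c i * h i z) \<phi> = (\<Sum>i\<in>I. c i * Linf_L1_pairing (h i) \<phi>)"
proof -
  have i: "integrable \<mu> (\<lambda>z. c i * h i z)" if "i \<in> I" for i using h[OF that] by simp
  then have "integrable \<mu> (\<lambda>z. \<Sum>i\<in>I. c i * h i z)" by simp
  then have "Linf_L1_pairing (\<lambda>z. \<Sum>i\<in>I. c i * h i z) \<phi> =
      (LINT z|\<mu>. (\<Sum>i\<in>I. c i * (rep_L2 \<phi> z * h i z)))"
    by (simp add: Linf_L1_pairing_eq borel_measurable_integrable sum_distrib_left mult.left_commute)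
  also have "\<dots> = (\<Sum>i\<in>I. c i * (LINT z|\<mu>. rep_L2 \<phi> z * h i z))"
    using integrable_Linf_L1[OF \<phi> h] by (subst Bochner_Integration.integral_sum) auto
  also have "\<dots> = (\<Sum>i\<in>I. c i * Linf_L1_pairing (h i) \<phi>)"
    using h by (intro sum.cong refl) (simp add: Linf_L1_pairing_eq borel_measurable_integrable)
  finally show ?thesis .
qed

lemma cinner_toeplitz_integral:
  assumes \<phi>: "\<phi> \<in> Linf" and f: "f \<in> model_perp \<theta>" and g: "g \<in> model_perp \<alpha>"
  shows "cinner (toeplitz \<theta> \<alpha> \<phi> f) g =
    (LINT z|\<mu>. rep_L2 \<phi> z * (rep_L2 f z * cnj (rep_L2 g z)))"
  unfolding cinner_toeplitz[OF f g]
  by (rule cinner_AE_eq_integral)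
    (use rep_mult[OF \<phi>, of f] in \<open>simp, eventually_elim, simp add: mult.assoc\<close>)

text \<open>On Toeplitz operators the functional given by \<open>t = \<Sum> f\<^sub>n \<otimes> g\<^sub>n\<close> is integration of the symbol
against \<open>h = \<Sum> f\<^sub>n g\<^sub>n\<^sup>*\<close>, a series that converges in \<open>L\<^sup>1\<close>.\<close>

lemma pairing_toeplitz_L1:
  assumes "t \<in> trace_class (model_perp \<alpha>) (model_perp \<theta>)"
  obtains h where "integrable \<mu> h"
    "\<And>\<phi>. \<phi> \<in> Linf \<Longrightarrow>
      pairing (model_perp \<theta>) (model_perp \<alpha>) (toeplitz \<theta> \<alpha> \<phi>) t = Linf_L1_pairing h \<phi>"
proof -
  let ?H = "model_perp \<theta>" and ?K = "model_perp \<alpha>"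
  obtain f g where t: "tensor_series ?H ?K t f g" using assms by (auto simp: trace_class_def)
  define u where "u n z = rep_L2 (f n) z * cnj (rep_L2 (g n) z)" for n z
  have ui: "integrable \<mu> (u n)" for n unfolding u_def by (rule integrable_rep_prod)
  note [measurable] = borel_measurable_integrable[OF ui]
  have u_norm: "(LINT z|\<mu>. norm (u n z)) \<le> norm (f n) * norm (g n)" for n
  proof -
    have sqa: "sq_integrable (\<lambda>z. complex_of_real (cmod (rep_L2 x z)))" for x
      using sq_integrable_int[OF sq_integrable_rep, of x] by (simp add: sq_integrable_def)
    have na: "norm (abs_L2 (\<lambda>z. complex_of_real (cmod (rep_L2 x z)))) = norm x" for x
      using sqa[of x] norm_sq_abs[OF sqa, of x] norm_sq_rep[of x]
      by (auto intro: power2_eq_imp_eq)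
    have "cinner (abs_L2 (\<lambda>z. complex_of_real (cmod (rep_L2 (f n) z)))) (abs_L2 (\<lambda>z. complex_of_real (cmod (rep_L2 (g n) z)))) =
        complex_of_real (LINT z|\<mu>. norm (u n z))"
      using sqa by (simp add: cinner_L2.abs_eq u_def norm_mult flip: of_real_mult)
    then have "cmod (complex_of_real (LINT z|\<mu>. norm (u n z))) \<le> norm (f n) * norm (g n)"
      using norm_cinner_le[of "abs_L2 (\<lambda>z. complex_of_real (cmod (rep_L2 (f n) z)))"
          "abs_L2 (\<lambda>z. complex_of_real (cmod (rep_L2 (g n) z)))"] by (simp add: na)
    then show ?thesis by simp
  qed
  have u_sum: "summable (\<lambda>n. LINT z|\<mu>. norm (u n z))"
    by (rule summable_comparison_test'[OF tensor_series_summable[OF t]]) (use u_norm in simp)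
  note u_AE = AE_summable_of_integrals[OF ui u_sum]
  define h where "h z = (\<Sum>n. u n z)" for z
  have hi: "integrable \<mu> h" unfolding h_def by (rule integrable_suminf[OF ui u_AE u_sum])
  have "pairing ?H ?K (toeplitz \<theta> \<alpha> \<phi>) t = Linf_L1_pairing h \<phi>" if \<phi>: "\<phi> \<in> Linf" for \<phi>
  proof -
    have s1: "(\<lambda>n. cinner (toeplitz \<theta> \<alpha> \<phi> (f n)) (g n)) sums pairing ?H ?K (toeplitz \<theta> \<alpha> \<phi>) t"
      by (rule pairing_sums[OF closed_csubspace_model_perp closed_csubspace_model_perp toeplitz_bounded_ops[OF \<phi>] t])
    let ?v = "\<lambda>n z. rep_L2 \<phi> z * u n z"
    have vi: "integrable \<mu> (?v n)" for n by (rule integrable_Linf_L1[OF \<phi> ui])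
    have v_AE: "AE z in \<mu>. summable (\<lambda>n. norm (?v n z))"
      using u_AE by eventually_elim (simp add: norm_mult summable_mult)
    have v_sum: "summable (\<lambda>n. LINT z|\<mu>. norm (?v n z))"
    proof (rule summable_comparison_test'[OF summable_mult[OF u_sum, of "Linf_norm \<phi>"]])
      fix n
      have "(LINT z|\<mu>. norm (?v n z)) \<le> (LINT z|\<mu>. Linf_norm \<phi> * norm (u n z))"
      proof (rule integral_mono_AE)
        show "AE z in \<mu>. norm (?v n z) \<le> Linf_norm \<phi> * norm (u n z)"
          using AE_le_Linf_norm[OF \<phi>] by eventually_elim (simp add: norm_mult mult_right_mono)
      qed (use vi ui in auto)
      then show "norm (LINT z|\<mu>. norm (?v n z)) \<le> Linf_norm \<phi> * (LINT z|\<mu>. norm (u n z))"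
        by simp
    qed
    have "(\<lambda>n. LINT z|\<mu>. ?v n z) sums (LINT z|\<mu>. (\<Sum>n. ?v n z))"
      by (rule sums_integral[OF vi v_AE v_sum])
    moreover have "(LINT z|\<mu>. (\<Sum>n. ?v n z)) = (LINT z|\<mu>. rep_L2 \<phi> z * h z)"
    proof (rule integral_cong_AE)
      show "AE z in \<mu>. (\<Sum>n. ?v n z) = rep_L2 \<phi> z * h z"
        using u_AE by eventually_elim (auto simp: h_def intro: suminf_mult dest: summable_norm_cancel)
      show "(\<lambda>z. \<Sum>n. ?v n z) \<in> borel_measurable \<mu>" by simp
      show "(\<lambda>z. rep_L2 \<phi> z * h z) \<in> borel_measurable \<mu>"
        using integrable_Linf_L1[OF \<phi> hi] by (rule borel_measurable_integrable)
    qed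
    moreover have "(LINT z|\<mu>. ?v n z) = cinner (toeplitz \<theta> \<alpha> \<phi> (f n)) (g n)" for n
      using cinner_toeplitz_integral[OF \<phi> tensor_seriesD(1,2)[OF t]] by (simp add: u_def)
    ultimately show ?thesis
      using sums_unique2[OF s1] hi by (simp add: Linf_L1_pairing_eq borel_measurable_integrable)
  qed
  then show ?thesis using that[OF hi] by blast
qed

lemma pairing_toeplitz_rank_two:
  assumes \<phi>: "\<phi> \<in> Linf" and h: "integrable \<mu> h"
    and f: "f\<^sub>1 \<in> model_perp \<theta>" "f\<^sub>2 \<in> model_perp \<theta>" and g: "g\<^sub>1 \<in> model_perp \<alpha>" "g\<^sub>2 \<in> model_perp \<alpha>"
    and eq: "AE z in \<mu>. h z = rep_L2 f\<^sub>1 z * cnj (rep_L2 g\<^sub>1 z) + rep_L2 f\<^sub>2 z * cnj (rep_L2 g\<^sub>2 z)"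
  shows "pairing (model_perp \<theta>) (model_perp \<alpha>) (toeplitz \<theta> \<alpha> \<phi>) (rank_two (model_perp \<alpha>) f\<^sub>1 g\<^sub>1 f\<^sub>2 g\<^sub>2) =
    Linf_L1_pairing h \<phi>"
proof -
  note [measurable] = borel_measurable_integrable[OF h]
  have i: "integrable \<mu> (\<lambda>z. rep_L2 \<phi> z * (rep_L2 x z * cnj (rep_L2 y z)))" for x y
    by (rule integrable_Linf_L1[OF \<phi> integrable_rep_prod])
  have "pairing (model_perp \<theta>) (model_perp \<alpha>) (toeplitz \<theta> \<alpha> \<phi>) (rank_two (model_perp \<alpha>) f\<^sub>1 g\<^sub>1 f\<^sub>2 g\<^sub>2) =
      (LINT z|\<mu>. rep_L2 \<phi> z * (rep_L2 f\<^sub>1 z * cnj (rep_L2 g\<^sub>1 z)) + rep_L2 \<phi> z * (rep_L2 f\<^sub>2 z * cnj (rep_L2 g\<^sub>2 z)))"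
    using f g i
    by (simp add: pairing_rank_two[OF closed_csubspace_model_perp closed_csubspace_model_perp f g toeplitz_bounded_ops[OF \<phi>]]
        cinner_toeplitz_integral[OF \<phi>])
  also have "\<dots> = (LINT z|\<mu>. rep_L2 \<phi> z * h z)"
  proof (rule integral_cong_AE)
    show "AE z in \<mu>. rep_L2 \<phi> z * (rep_L2 f\<^sub>1 z * cnj (rep_L2 g\<^sub>1 z)) +
        rep_L2 \<phi> z * (rep_L2 f\<^sub>2 z * cnj (rep_L2 g\<^sub>2 z)) = rep_L2 \<phi> z * h z"
      using eq by eventually_elim (simp add: algebra_simps)
  qed simp_all
  finally show ?thesis by (simp add: Linf_L1_pairing_eq)
qed

text \<open>The extremal function is the conjugate of \<open>h / |h|\<close>, which is \<open>0\<close> where \<open>h\<close> vanishes by the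
convention for division by zero.\<close>

lemma L1_norm_attained:
  assumes h: "integrable \<mu> h"
  obtains \<phi> where "\<phi> \<in> Linf" "Linf_norm \<phi> \<le> 1"
    "Linf_L1_pairing h \<phi> = complex_of_real (LINT z|\<mu>. cmod (h z))"
proof -
  note [measurable] = borel_measurable_integrable[OF h]
  define u where "u z = cnj (h z) / complex_of_real (cmod (h z))" for z
  have u1: "cmod (u z) \<le> 1" for z by (simp add: u_def norm_divide)
  have um: "u \<in> borel_measurable borel" unfolding u_def using borel_measurable_integrable[OF h] by (simp cong: measurable_cong_sets)
  have sq: "sq_integrable u" by (rule sq_integrable_bounded[OF um, of 1]) (simp add: u1)
  have rep: "AE z in \<mu>. rep_L2 (abs_L2 u) z = u z" by (rule rep_abs_L2[OF sq])
  have b: "AE z in \<mu>. cmod (rep_L2 (abs_L2 u) z) \<le> 1" using rep by eventually_elim (simp add: u1)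
  have "Linf_L1_pairing h (abs_L2 u) = (LINT z|\<mu>. complex_of_real (cmod (h z)))"
    unfolding Linf_L1_pairing_eq[OF borel_measurable_integrable[OF h]]
  proof (rule integral_cong_AE)
    show "AE z in \<mu>. rep_L2 (abs_L2 u) z * h z = complex_of_real (cmod (h z))"
      using rep
    proof eventually_elim
      fix z assume r: "rep_L2 (abs_L2 u) z = u z"
      have "u z * h z = h z * cnj (h z) / complex_of_real (cmod (h z))" by (simp add: u_def mult.commute)
      also have "\<dots> = complex_of_real (cmod (h z))"
        unfolding complex_norm_square[symmetric] by (cases "h z = 0") (simp_all add: power2_eq_square)
      finally show "rep_L2 (abs_L2 u) z * h z = complex_of_real (cmod (h z))" using r by simp
    qed
  qed simp_all
  then have "Linf_L1_pairing h (abs_L2 u) = complex_of_real (LINT z|\<mu>. cmod (h z))" by simp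
  then show ?thesis using that LinfI[OF b] by blast
qed

lemma Linf_L1_pairing_le:
  assumes \<phi>: "\<phi> \<in> Linf" and h: "integrable \<mu> h"
  shows "cmod (Linf_L1_pairing h \<phi>) \<le> Linf_norm \<phi> * (LINT z|\<mu>. cmod (h z))"
proof -
  have "cmod (Linf_L1_pairing h \<phi>) \<le> (LINT z|\<mu>. cmod (rep_L2 \<phi> z * h z))"
    unfolding Linf_L1_pairing_eq[OF borel_measurable_integrable[OF h]] by (rule integral_norm_bound)
  also have "\<dots> \<le> (LINT z|\<mu>. Linf_norm \<phi> * cmod (h z))"
  proof (rule integral_mono_AE)
    show "AE z in \<mu>. cmod (rep_L2 \<phi> z * h z) \<le> Linf_norm \<phi> * cmod (h z)"
      using AE_le_Linf_norm[OF \<phi>] by eventually_elim (simp add: norm_mult mult_right_mono)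
  qed (use integrable_Linf_L1[OF \<phi> h] h in auto)
  finally show ?thesis by simp
qed

section \<open>Toeplitz operators are determined by annihilators of rank two\<close>

text \<open>Square summable Fourier coefficients belong to a function, by completeness of \<open>L\<^sup>2\<close>.\<close>

lemma fourier_series_exists:
  fixes c :: "int \<Rightarrow> complex"
  assumes "\<And>F. finite F \<Longrightarrow> (\<Sum>m\<in>F. (cmod (c m))\<^sup>2) \<le> B"
  obtains \<phi> where "\<And>m. cinner \<phi> (zpow m) = c m"
proof -
  define I where "I n = {- int n..int n}" for n :: nat
  define S where "S n = (\<Sum>m\<in>I n. c m *\<^sub>C zpow m)" for n
  define a where "a n = (\<Sum>m\<in>I n. (cmod (c m))\<^sup>2)" for n
  have fin: "finite (I n)" for n by (simp add: I_def)
  have mono: "I n \<subseteq> I k" if "n \<le> k" for n k using that by (auto simp: I_def)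
  have norm_sum: "(norm (\<Sum>m\<in>F. c m *\<^sub>C zpow m))\<^sup>2 = (\<Sum>m\<in>F. (cmod (c m))\<^sup>2)" if "finite F" for F
  proof -
    have "cinner (\<Sum>m\<in>F. c m *\<^sub>C zpow m) (\<Sum>m\<in>F. c m *\<^sub>C zpow m) =
      (\<Sum>m\<in>F. \<Sum>k\<in>F. c m * (cnj (c k) * (if m = k then 1 else 0)))"
      unfolding cinner_sum_left cinner_sum_right
      by (intro sum.cong refl) (simp add: cinner_scaleC_left cinner_scaleC_right cinner_zpow_zpow)
    also have "\<dots> = (\<Sum>m\<in>F. c m * cnj (c m))"
      by (intro sum.cong refl) (simp add: that if_distrib sum.delta cong: if_cong)
    also have "\<dots> = complex_of_real (\<Sum>m\<in>F. (cmod (c m))\<^sup>2)" by (simp add: complex_norm_square[symmetric])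
    finally show ?thesis by (simp add: norm_sq_cinner)
  qed
  have diff: "(norm (S k - S n))\<^sup>2 = a k - a n" if "n \<le> k" for n k
  proof -
    have "S k - S n = (\<Sum>m\<in>I k - I n. c m *\<^sub>C zpow m)" "a k - a n = (\<Sum>m\<in>I k - I n. (cmod (c m))\<^sup>2)"
      unfolding S_def a_def by (rule sum_diff[OF fin mono[OF that], symmetric])+
    then show ?thesis using norm_sum[of "I k - I n"] fin by simp
  qed
  have "incseq a" 
  proof (rule incseq_SucI)
    fix n
    have "0 \<le> (norm (S (Suc n) - S n))\<^sup>2" by simp
    then show "a n \<le> a (Suc n)" using diff[of n "Suc n"] by simp
  qed
  moreover have "a n \<le> B" for n unfolding a_def by (rule assms[OF fin])
  ultimately obtain L where "a \<longlonglongrightarrow> L" using incseq_convergent[of a B] by blast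
  then have "convergent a" by (rule convergentI)
  then have "Cauchy a" by (rule convergent_Cauchy)
  have "Cauchy S"
  proof (rule metric_CauchyI)
    fix e :: real assume e: "e > 0"
    then obtain M where M: "\<And>m n. m \<ge> M \<Longrightarrow> n \<ge> M \<Longrightarrow> norm (a m - a n) < e\<^sup>2"
      using CauchyD[OF \<open>Cauchy a\<close>, of "e\<^sup>2"] by (meson zero_less_power)
    have *: "norm (S k - S n) < e" if "n \<le> k" "M \<le> n" for n k
    proof (rule power2_less_imp_less)
      show "(norm (S k - S n))\<^sup>2 < e\<^sup>2" using M[of k n] that diff[OF that(1)] by simp
    qed (use e in simp)
    have "dist (S m) (S n) < e" if "m \<ge> M" "n \<ge> M" for m n
      using *[of m n] *[of n m] that by (cases "m \<le> n") (auto simp: dist_norm norm_minus_commute)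
    then show "\<exists>M. \<forall>m\<ge>M. \<forall>n\<ge>M. dist (S m) (S n) < e" by blast
  qed
  then obtain \<phi> where \<phi>: "S \<longlonglongrightarrow> \<phi>" using Cauchy_convergent convergent_def by blast
  have "cinner \<phi> (zpow m) = c m" for m
  proof -
    have "cinner (S n) (zpow m) = c m" if "n \<ge> nat \<bar>m\<bar>" for n
    proof -
      have "m \<in> I n" using that by (auto simp: I_def)
      have "cinner (S n) (zpow m) = (\<Sum>k\<in>I n. c k * (if k = m then 1 else 0))"
        unfolding S_def cinner_sum_left by (simp add: cinner_scaleC_left cinner_zpow_zpow)
      also have "\<dots> = c m" using \<open>m \<in> I n\<close> fin by (simp add: if_distrib sum.delta cong: if_cong)
      finally show ?thesis .
    qed
    then have "\<forall>\<^sub>F n in sequentially. cinner (S n) (zpow m) = c m" by (auto simp: eventually_sequentially)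
    then have "(\<lambda>n. cinner (S n) (zpow m)) \<longlonglongrightarrow> c m" by (rule tendsto_eventually)
    then show ?thesis
      using LIMSEQ_unique bounded_linear.tendsto[OF bounded_linear_cinner_left \<phi>] by blast
  qed
  then show ?thesis using that by blast
qed

text \<open>An operator that does not distinguish the pairs \<open>f, g\<close> with the same product \<open>f g\<^sup>*\<close> is a
Toeplitz operator. The Fourier coefficients of the symbol \<open>\<phi>\<close> are read off from
\<open>\<langle>T z\<^sup>-\<^sup>N, z\<^sup>m\<^sup>-\<^sup>N\<rangle>\<close>, which does not depend on \<open>N\<close>. By density \<open>\<langle>T f, g\<rangle> = \<langle>\<phi> f, g\<rangle>\<close> holds for all
\<open>f, g\<close> in \<open>coH2\<close> with \<open>g\<close> bounded, and the remaining products of generators of the two spaces are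
also products of functions in \<open>coH2\<close>.\<close>

lemma toeplitz_if_product_dependent:
  assumes \<theta>: "inner_function \<theta>" and \<alpha>: "inner_function \<alpha>"
    and T: "T \<in> bounded_ops (model_perp \<theta>) (model_perp \<alpha>)"
    and dep: "\<And>f f' g g'. f \<in> model_perp \<theta> \<Longrightarrow> f' \<in> model_perp \<theta> \<Longrightarrow> g \<in> model_perp \<alpha> \<Longrightarrow> g' \<in> model_perp \<alpha> \<Longrightarrow>
      AE z in \<mu>. rep_L2 f z * cnj (rep_L2 g z) = rep_L2 f' z * cnj (rep_L2 g' z) \<Longrightarrow>
      cinner (T f) g = cinner (T f') g'"
  shows "T \<in> dual_toeplitz_ops \<theta> \<alpha>"
proof -
  let ?H = "model_perp \<theta>" and ?K = "model_perp \<alpha>"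
  note H = closed_csubspace_model_perp[of \<theta>] and K = closed_csubspace_model_perp[of \<alpha>]
  obtain C where C: "C \<ge> 0" "\<And>x. x \<in> ?H \<Longrightarrow> norm (T x) \<le> C * norm x" using bounded_ops_bound[OF T] by blast
  have zH: "zpow n \<in> ?H" and zK: "zpow n \<in> ?K" if "n < 0" for n
    using that zpow_coH2 coH2_model_perp by auto
  have norm_zpow: "norm (zpow n) = 1" for n
    using unimodular_norm[OF unimodular_zpow, of n "zpow 0"] cinner_zpow_zpow[of 0 0]
    by (simp add: zpow_mult cinner_self complex_eq_iff power2_eq_1_iff del: of_real_power)
      (metis L2_mult_commute one_mult norm_ge_zero not_one_le_zero neg_0_le_iff_le)
  have zdep: "cinner (T (zpow i)) (zpow j) = cinner (T (zpow i')) (zpow j')"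
    if "i < 0" "j < 0" "i' < 0" "j' < 0" "i - j = i' - j'" for i j i' j'
  proof (rule dep)
    show "AE z in \<mu>. rep_L2 (zpow i) z * cnj (rep_L2 (zpow j) z) = rep_L2 (zpow i') z * cnj (rep_L2 (zpow j') z)"
      using rep_zpow_cnj[of i j] rep_zpow_cnj[of i' j'] by eventually_elim (simp add: that(5))
  qed (use that zH zK in auto)
  define c where "c m = cinner (T (zpow (- \<bar>m\<bar> - 1))) (zpow (m - \<bar>m\<bar> - 1))" for m :: int
  have c_eq: "cinner (T (zpow i)) (zpow j) = c (j - i)" if "i < 0" "j < 0" for i j
    unfolding c_def by (rule zdep) (use that in auto)
  have "(\<Sum>m\<in>F. (cmod (c m))\<^sup>2) \<le> C\<^sup>2" if F: "finite F" for F
  proof -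
    define N where "N = Max (insert 0 F) + 1"
    have N: "m < N" if "m \<in> F" for m
    proof -
      have "m \<le> Max (insert 0 F)" using F that by (intro Max_ge) auto
      then show ?thesis by (simp add: N_def)
    qed
    have "0 \<le> Max (insert 0 F)" using F by (intro Max_ge) auto
    then have N0: "- N < 0" by (simp add: N_def)
    have inj: "inj_on (\<lambda>m. zpow (m - N)) F"
      by (rule inj_onI) (metis cinner_zpow_zpow diff_add_cancel zero_neq_one)
    have "(\<Sum>m\<in>F. (cmod (c m))\<^sup>2) = (\<Sum>m\<in>F. (cmod (cinner (T (zpow (- N))) (zpow (m - N))))\<^sup>2)"
      using N N0 by (intro sum.cong refl) (simp add: c_eq)
    also have "\<dots> = (\<Sum>e\<in>(\<lambda>m. zpow (m - N)) ` F. (cmod (cinner (T (zpow (- N))) e))\<^sup>2)"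
      by (simp add: sum.reindex[OF inj])
    also have "\<dots> \<le> (norm (T (zpow (- N))))\<^sup>2"
      by (rule bessel_finite[where E = "range zpow"])
        (use zpow_onb F in \<open>auto simp: is_onb_def orthonormal_def\<close>)
    also have "\<dots> \<le> C\<^sup>2" using C(2)[OF zH[OF N0]] by (intro power_mono) (auto simp: norm_zpow)
    finally show ?thesis .
  qed
  then obtain \<phi> where \<phi>: "\<And>m. cinner \<phi> (zpow m) = c m" using fourier_series_exists[of c "C\<^sup>2"] by blast
  \<comment> \<open>The difference of \<open>T z\<^sup>i\<close> and \<open>\<phi> z\<^sup>i\<close> has no negative frequencies.\<close>
  have 1: "cinner (T (zpow i)) g = cinner (\<phi> *\<^sub>L zpow i) g" if i: "i < 0" and g: "g \<in> coH2" for i g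
  proof -
    have "cinner (T (zpow i) - \<phi> *\<^sub>L zpow i) (zpow j) = 0" if j: "j < 0" for j
    proof -
      have "cinner (\<phi> *\<^sub>L zpow i) (zpow j) = cinner \<phi> (zpow (j - i))"
        by (simp add: L2_mult_commute[of \<phi>] cinner_shift zpow_mult)
      then show ?thesis by (simp add: cinner_diff_left c_eq[OF i j] \<phi>)
    qed
    then have "T (zpow i) - \<phi> *\<^sub>L zpow i \<in> H2" by (simp add: H2_def)
    from H2_orth_coH2[OF this g] show ?thesis by (simp add: cinner_diff_left)
  qed
  have 2: "cinner (T f) g = cinner f (g *\<^sub>L conj_L2 \<phi>)" if f: "f \<in> coH2" and g: "g \<in> coH2" "g \<in> Linf" for f g
  proof -
    let ?M = "{x \<in> ?H. cinner (T x) g = cinner x (g *\<^sub>L conj_L2 \<phi>)} \<inter> coH2"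
    have "?M = coH2"
    proof (rule closed_csubspace_total[OF _ closed_csubspace_coH2])
      show "closed_csubspace ?M"
        by (intro closed_csubspace_Int closed_csubspace_coefficient_eq[OF H T] closed_csubspace_coH2)
      show "zpow ` {..<0} \<subseteq> ?M"
        using 1[OF _ g(1)] zH zpow_coH2 by (auto simp: cinner_symbol[OF g(2)])
      show "coH2 \<inter> orth_compl (zpow ` {..<0}) \<subseteq> {0}"
      proof
        fix x assume x: "x \<in> coH2 \<inter> orth_compl (zpow ` {..<0})"
        then have "x \<in> H2" by (auto simp: H2_def orth_compl_def)
        then have "cinner x x = 0" using x coH2_orth_H2 by blast
        then show "x \<in> {0}" by simp
      qed
    qed auto
    then show ?thesis using f by blast
  qed
  have gens: "\<exists>t n. t \<in> Hinf \<and> f = t *\<^sub>L zpow n" if "f \<in> model_perp_gens \<beta>" "inner_function \<beta>" for f \<beta>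
    using that inner_Hinf[OF that(2)] zpow_Hinf[of 0] one_mult unfolding model_perp_gens_def by force
  have 3: "cinner (T f) g = cinner f (g *\<^sub>L conj_L2 \<phi>)" if f: "f \<in> model_perp_gens \<theta>" and g: "g \<in> model_perp_gens \<alpha>" for f g
  proof -
    obtain t n where t: "t \<in> Hinf" "f = t *\<^sub>L zpow n" using gens[OF f \<theta>] by blast
    obtain a m where a: "a \<in> Hinf" "g = a *\<^sub>L zpow m" using gens[OF g \<alpha>] by blast
    have fH: "f \<in> ?H" "f \<in> Linf" and gK: "g \<in> ?K" "g \<in> Linf"
      using f g model_perp_gens_subset[OF \<theta>] model_perp_gens_subset[OF \<alpha>] by auto
    \<comment> \<open>Large enough for both frequencies \<open>- N\<close> and \<open>m - n - N\<close> to be negative.\<close>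
    define N where "N = max 1 (m - n + 1)"
    define f' where "f' = conj_L2 a *\<^sub>L zpow (- N)"
    define g' where "g' = conj_L2 t *\<^sub>L zpow (m - n - N)"
    have f': "f' \<in> coH2" unfolding f'_def by (intro conj_Hinf_mult_coH2 a zpow_coH2) (simp add: N_def)
    have g': "g' \<in> coH2" "g' \<in> Linf"
    proof -
      show "g' \<in> coH2" unfolding g'_def by (intro conj_Hinf_mult_coH2 t zpow_coH2) (simp add: N_def)
      show "g' \<in> Linf" unfolding g'_def by (intro Linf_mult conj_Linf Hinf_Linf t zpow_Linf)
    qed
    note aL = Hinf_Linf[OF a(1)] and tL = Hinf_Linf[OF t(1)]
    have eq: "AE z in \<mu>. rep_L2 f z * cnj (rep_L2 g z) = rep_L2 f' z * cnj (rep_L2 g' z)"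
      using rep_mult[OF aL, of "zpow m"] rep_mult[OF tL, of "zpow n"] rep_mult[OF conj_Linf[OF aL], of "zpow (- N)"]
        rep_mult[OF conj_Linf[OF tL], of "zpow (m - n - N)"] rep_conj[of a] rep_conj[of t]
        rep_zpow_cnj[of n m] rep_zpow_cnj[of "- N" "m - n - N"]
      unfolding f'_def g'_def t(2) a(2)
    proof eventually_elim
      fix z
      assume e: "rep_L2 (a *\<^sub>L zpow m) z = rep_L2 a z * rep_L2 (zpow m) z"
        "rep_L2 (t *\<^sub>L zpow n) z = rep_L2 t z * rep_L2 (zpow n) z"
        "rep_L2 (conj_L2 a *\<^sub>L zpow (- N)) z = rep_L2 (conj_L2 a) z * rep_L2 (zpow (- N)) z"
        "rep_L2 (conj_L2 t *\<^sub>L zpow (m - n - N)) z = rep_L2 (conj_L2 t) z * rep_L2 (zpow (m - n - N)) z"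
        "rep_L2 (conj_L2 a) z = cnj (rep_L2 a z)" "rep_L2 (conj_L2 t) z = cnj (rep_L2 t z)"
        and p: "rep_L2 (zpow n) z * cnj (rep_L2 (zpow m) z) = z powi (n - m)"
        "rep_L2 (zpow (- N)) z * cnj (rep_L2 (zpow (m - n - N)) z) = z powi (- N - (m - n - N))"
      have "rep_L2 (t *\<^sub>L zpow n) z * cnj (rep_L2 (a *\<^sub>L zpow m) z) =
          (rep_L2 t z * cnj (rep_L2 a z)) * (rep_L2 (zpow n) z * cnj (rep_L2 (zpow m) z))"
        by (simp add: e mult_ac)
      also have "\<dots> = (rep_L2 t z * cnj (rep_L2 a z)) * (rep_L2 (zpow (- N)) z * cnj (rep_L2 (zpow (m - n - N)) z))"
        unfolding p by simp
      also have "\<dots> = rep_L2 (conj_L2 a *\<^sub>L zpow (- N)) z * cnj (rep_L2 (conj_L2 t *\<^sub>L zpow (m - n - N)) z)"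
        by (simp add: e mult_ac)
      finally show "rep_L2 (t *\<^sub>L zpow n) z * cnj (rep_L2 (a *\<^sub>L zpow m) z) =
        rep_L2 (conj_L2 a *\<^sub>L zpow (- N)) z * cnj (rep_L2 (conj_L2 t *\<^sub>L zpow (m - n - N)) z)" .
    qed
    have "cinner (T f) g = cinner (T f') g'"
      using eq f' g' fH gK by (intro dep) (auto intro: coH2_model_perp)
    also have "\<dots> = cinner f' (g' *\<^sub>L conj_L2 \<phi>)" by (rule 2[OF f' g'])
    also have "\<dots> = cinner f (g *\<^sub>L conj_L2 \<phi>)"
    proof (rule cinner_AE_eqI)
      show "AE z in \<mu>. rep_L2 f' z * cnj (rep_L2 (g' *\<^sub>L conj_L2 \<phi>) z) = rep_L2 f z * cnj (rep_L2 (g *\<^sub>L conj_L2 \<phi>) z)"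
        using eq rep_mult[OF g'(2), of "conj_L2 \<phi>"] rep_mult[OF gK(2), of "conj_L2 \<phi>"]
      proof eventually_elim
        fix z assume e: "rep_L2 f z * cnj (rep_L2 g z) = rep_L2 f' z * cnj (rep_L2 g' z)"
          "rep_L2 (g' *\<^sub>L conj_L2 \<phi>) z = rep_L2 g' z * rep_L2 (conj_L2 \<phi>) z"
          "rep_L2 (g *\<^sub>L conj_L2 \<phi>) z = rep_L2 g z * rep_L2 (conj_L2 \<phi>) z"
        show "rep_L2 f' z * cnj (rep_L2 (g' *\<^sub>L conj_L2 \<phi>) z) = rep_L2 f z * cnj (rep_L2 (g *\<^sub>L conj_L2 \<phi>) z)"
          unfolding e(2,3) complex_cnj_mult mult.assoc[symmetric] e(1) ..
      qed
    qed
    finally show ?thesis .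
  qed
  have 4: "cinner (T f) g = cinner f (g *\<^sub>L conj_L2 \<phi>)" if f: "f \<in> ?H" and g: "g \<in> model_perp_gens \<alpha>" for f g
  proof -
    have "{x \<in> ?H. cinner (T x) g = cinner x (g *\<^sub>L conj_L2 \<phi>)} = ?H"
      by (rule closed_csubspace_total[OF closed_csubspace_coefficient_eq[OF H T] H, where X = "model_perp_gens \<theta>"])
        (use 3[OF _ g] model_perp_gens_subset[OF \<theta>] model_perp_gens_total[OF \<theta>] in auto)
    then show ?thesis using f by blast
  qed
  have "dual_toeplitz_ext \<theta> \<alpha> \<phi> T"
    unfolding dual_toeplitz_ext_def
  proof (intro conjI T ballI)
    fix f assume f: "f \<in> ?H \<inter> Linf"
    let ?d = "T f - orth_proj ?K (\<phi> *\<^sub>L f)"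
    have "?d \<in> ?K" using f by (intro closed_csubspaceD(4)[OF K] bounded_opsD(2)[OF T] orth_proj_in[OF K]) auto
    moreover have "cinner ?d g = 0" if g: "g \<in> model_perp_gens \<alpha>" for g
    proof -
      have gK: "g \<in> ?K" "g \<in> Linf" using g model_perp_gens_subset[OF \<alpha>] by auto
      have "cinner (T f) g = cinner (\<phi> *\<^sub>L f) g" using 4[OF _ g] f by (simp add: cinner_symbol[OF gK(2)])
      then show ?thesis by (simp add: cinner_diff_left cinner_orth_proj[OF K gK(1)])
    qed
    ultimately have "?d \<in> ?K \<inter> orth_compl (model_perp_gens \<alpha>)" by (simp add: orth_compl_def)
    then have "?d = 0" using model_perp_gens_total[OF \<alpha>] by blast
    then show "T f = orth_proj ?K (\<phi> *\<^sub>L f)" by simp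
  qed
  then show ?thesis by (auto simp: dual_toeplitz_ops_def)
qed

text \<open>If \<open>f\<^sub>1 g\<^sub>1\<^sup>* = f\<^sub>2 g\<^sub>2\<^sup>*\<close> then \<open>f\<^sub>1 \<otimes> g\<^sub>1 - f\<^sub>2 \<otimes> g\<^sub>2\<close> annihilates all Toeplitz operators.\<close>

lemma dual_toeplitz_ops_2_reflexive:
  assumes \<theta>: "inner_function \<theta>" and \<alpha>: "inner_function \<alpha>"
  shows "annihilator (model_perp \<theta>) (model_perp \<alpha>)
      (pre_annihilator (model_perp \<theta>) (model_perp \<alpha>) (dual_toeplitz_ops \<theta> \<alpha>) \<inter>
        rank_le_ops 2 (model_perp \<alpha>) (model_perp \<theta>)) = dual_toeplitz_ops \<theta> \<alpha>"
    (is "annihilator ?H ?K (pre_annihilator ?H ?K ?T \<inter> ?F) = ?T")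
proof
  note H = closed_csubspace_model_perp[of \<theta>] and K = closed_csubspace_model_perp[of \<alpha>]
  show "?T \<subseteq> annihilator ?H ?K (pre_annihilator ?H ?K ?T \<inter> ?F)"
    using toeplitz_bounded_ops by (auto simp: annihilator_def pre_annihilator_def dual_toeplitz_ops_eq[OF \<theta>])
  show "annihilator ?H ?K (pre_annihilator ?H ?K ?T \<inter> ?F) \<subseteq> ?T"
  proof
    fix T assume T: "T \<in> annihilator ?H ?K (pre_annihilator ?H ?K ?T \<inter> ?F)"
    then have Tb: "T \<in> bounded_ops ?H ?K" by (simp add: annihilator_def)
    show "T \<in> ?T"
    proof (rule toeplitz_if_product_dependent[OF \<theta> \<alpha> Tb])
      fix f f' g g'
      assume f: "f \<in> ?H" "f' \<in> ?H" and g: "g \<in> ?K" "g' \<in> ?K"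
        and eq: "AE z in \<mu>. rep_L2 f z * cnj (rep_L2 g z) = rep_L2 f' z * cnj (rep_L2 g' z)"
      define m where "m = (- 1) *\<^sub>C f'"
      have m: "m \<in> ?H" unfolding m_def by (rule closed_csubspaceD(3)[OF H f(2)])
      let ?t = "rank_two ?K f g m g'"
      have "pairing ?H ?K (toeplitz \<theta> \<alpha> \<phi>) ?t = Linf_L1_pairing (\<lambda>z. 0) \<phi>" if "\<phi> \<in> Linf" for \<phi>
      proof (rule pairing_toeplitz_rank_two[OF that _ f(1) m g])
        show "AE z in \<mu>. 0 = rep_L2 f z * cnj (rep_L2 g z) + rep_L2 m z * cnj (rep_L2 g' z)"
          using eq rep_scaleC[of "- 1" f'] unfolding m_def by eventually_elim simp
      qed simp
      then have "?t \<in> pre_annihilator ?H ?K ?T"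
        using rank_two_trace_class[OF H K f(1) m g]
        by (auto simp: pre_annihilator_def dual_toeplitz_ops_eq[OF \<theta>] Linf_L1_pairing_eq)
      then have "pairing ?H ?K T ?t = 0"
        using T rank_two_in_rank_le_ops[OF H K f(1) m g] by (simp add: annihilator_def)
      then have "cinner (T f) g + cinner (T m) g' = 0"
        by (simp only: pairing_rank_two[OF H K f(1) m g Tb])
      moreover have "cinner (T m) g' = - cinner (T f') g'"
        unfolding m_def bounded_opsD(4)[OF Tb f(2)] cinner_scaleC_left by simp
      ultimately show "cinner (T f) g = cinner (T f') g'" by simp
    qed
  qed
qed

section \<open>Functionals on spaces of Toeplitz operators\<close>

lemma op_subspace_toeplitz:
  assumes W: "csubspace W" "W \<subseteq> Linf"
  shows "op_subspace (toeplitz \<theta> \<alpha> ` W)"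
proof -
  have "(\<lambda>x. 0) = toeplitz \<theta> \<alpha> 0"
    using toeplitz_scaleC[OF Linf_zero, of \<theta> \<alpha> 0] by simp
  moreover have "0 \<in> W" "\<And>x y. x \<in> W \<Longrightarrow> y \<in> W \<Longrightarrow> x + y \<in> W" "\<And>c x. x \<in> W \<Longrightarrow> c *\<^sub>C x \<in> W"
    using W(1) by (auto simp: complex_vector.subspace_def)
  moreover have "toeplitz \<theta> \<alpha> (x + y) = (\<lambda>f. toeplitz \<theta> \<alpha> x f + toeplitz \<theta> \<alpha> y f)"
    "toeplitz \<theta> \<alpha> (c *\<^sub>C x) = (\<lambda>f. c *\<^sub>C toeplitz \<theta> \<alpha> x f)" if "x \<in> W" "y \<in> W" for x y c
    using that W(2) by (auto simp: toeplitz_add toeplitz_scaleC subset_iff)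
  ultimately show ?thesis unfolding op_subspace_def by (auto simp: image_iff) metis+
qed

lemma symbols_csubspace:
  assumes S: "op_subspace S"
  shows "csubspace {\<phi> \<in> Linf. toeplitz \<theta> \<alpha> \<phi> \<in> S}"
proof -
  have "toeplitz \<theta> \<alpha> 0 = (\<lambda>x. 0)" using toeplitz_scaleC[OF Linf_zero, of \<theta> \<alpha> 0] by simp
  then show ?thesis
    using S by (simp add: complex_vector.subspace_def op_subspace_def Linf_zero Linf_add Linf_scaleC toeplitz_add toeplitz_scaleC)
qed

lemma linear_on_csubspace_L1_pairing:
  assumes "W \<subseteq> Linf" "integrable \<mu> h"
  shows "linear_on_csubspace W (Linf_L1_pairing h)"
  using assms by (auto simp: linear_on_csubspace_def Linf_L1_pairing_add Linf_L1_pairing_scaleC subset_iff)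

lemma weak_star_symbol_functionals:
  assumes "F0 \<subseteq> {\<lambda>T. pairing (model_perp \<theta>) (model_perp \<alpha>) T t | t. t \<in> trace_class (model_perp \<alpha>) (model_perp \<theta>)}"
  obtains h where "\<And>l. l \<in> F0 \<Longrightarrow> integrable \<mu> (h l)"
    "\<And>l \<phi>. l \<in> F0 \<Longrightarrow> \<phi> \<in> Linf \<Longrightarrow> l (toeplitz \<theta> \<alpha> \<phi>) = Linf_L1_pairing (h l) \<phi>"
proof -
  have "\<exists>h. integrable \<mu> h \<and> (\<forall>\<phi>\<in>Linf. l (toeplitz \<theta> \<alpha> \<phi>) = Linf_L1_pairing h \<phi>)" if l: "l \<in> F0" for l
  proof -
    obtain t where t: "t \<in> trace_class (model_perp \<alpha>) (model_perp \<theta>)" "l = (\<lambda>T. pairing (model_perp \<theta>) (model_perp \<alpha>) T t)"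
      using assms l by blast
    obtain h where "integrable \<mu> h"
      "\<And>\<phi>. \<phi> \<in> Linf \<Longrightarrow> pairing (model_perp \<theta>) (model_perp \<alpha>) (toeplitz \<theta> \<alpha> \<phi>) t = Linf_L1_pairing h \<phi>"
      by (rule pairing_toeplitz_L1[OF t(1)]) (rule that)
    then show ?thesis unfolding t(2) by (intro exI[of _ h]) simp
  qed
  then obtain h where "\<forall>l\<in>F0. integrable \<mu> (h l) \<and> (\<forall>\<phi>\<in>Linf. l (toeplitz \<theta> \<alpha> \<phi>) = Linf_L1_pairing (h l) \<phi>)"
    by metis
  then show ?thesis using that[of h] by blast
qed

text \<open>A weak* continuous functional is bounded on a neighbourhood of zero that is given by finitely
many trace class operators, so it vanishes on their common kernel and is a combination of the
corresponding functionals, each of which is given by an integrable function.\<close>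

lemma weak_star_functional_L1:
  assumes \<theta>: "inner_function \<theta>" and S: "op_subspace S" "S \<subseteq> dual_toeplitz_ops \<theta> \<alpha>"
    and \<Lambda>: "weak_star_functional (model_perp \<theta>) (model_perp \<alpha>) S \<Lambda>"
  obtains h where "integrable \<mu> h"
    "\<And>\<phi>. \<phi> \<in> Linf \<Longrightarrow> toeplitz \<theta> \<alpha> \<phi> \<in> S \<Longrightarrow> \<Lambda> (toeplitz \<theta> \<alpha> \<phi>) = Linf_L1_pairing h \<phi>"
proof -
  let ?H = "model_perp \<theta>" and ?K = "model_perp \<alpha>"
  note H = closed_csubspace_model_perp[of \<theta>] and K = closed_csubspace_model_perp[of \<alpha>]
  have lin: "\<And>T U. T \<in> S \<Longrightarrow> U \<in> S \<Longrightarrow> \<Lambda> (\<lambda>x. T x + U x) = \<Lambda> T + \<Lambda> U"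
    "\<And>c T. T \<in> S \<Longrightarrow> \<Lambda> (\<lambda>x. c *\<^sub>C T x) = c * \<Lambda> T"
    and cont: "continuous_map (subtopology (weak_star ?H ?K) S) euclidean \<Lambda>"
    using \<Lambda> by (auto simp: weak_star_functional_def)
  have Sb: "S \<subseteq> bounded_ops ?H ?K"
    using S(2) toeplitz_bounded_ops unfolding dual_toeplitz_ops_eq[OF \<theta>] by blast
  have S0: "(\<lambda>x. 0) \<in> S" using S(1) by (simp add: op_subspace_def)
  have \<Lambda>0: "\<Lambda> (\<lambda>x. 0) = 0" using lin(2)[OF S0, of 0] by simp
  have t0: "toeplitz \<theta> \<alpha> 0 = (\<lambda>x. 0)" using toeplitz_scaleC[OF Linf_zero, of \<theta> \<alpha> 0] by simp
  have "topspace (subtopology (weak_star ?H ?K) S) = S"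
    using Sb by (auto simp: topspace_weak_star[OF H K])
  then have "openin (subtopology (weak_star ?H ?K) S) {T \<in> S. \<Lambda> T \<in> ball 0 1}"
    using openin_continuous_map_preimage[OF cont, of "ball 0 1"] by simp
  then obtain V where V: "openin (weak_star ?H ?K) V" "{T \<in> S. \<Lambda> T \<in> ball 0 1} = V \<inter> S"
    unfolding openin_subtopology by blast
  have "(\<lambda>x. 0) \<in> {T \<in> S. \<Lambda> T \<in> ball 0 1}" using S0 \<Lambda>0 by simp
  then have "(\<lambda>x. 0) \<in> V" using V(2) by blast
  from weak_topology_neighbourhood[OF V(1)[unfolded weak_star_def] this]
  obtain F0 \<delta> where F0: "finite F0"
      "F0 \<subseteq> {\<lambda>T. pairing ?H ?K T t | t. t \<in> trace_class ?K ?H}" and \<delta>: "\<delta> > 0"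
    and nb: "\<And>T. T \<in> bounded_ops ?H ?K \<Longrightarrow> (\<And>l. l \<in> F0 \<Longrightarrow> cmod (l T - l (\<lambda>x. 0)) < \<delta>) \<Longrightarrow> T \<in> V"
    by blast
  obtain h where hi: "\<And>l. l \<in> F0 \<Longrightarrow> integrable \<mu> (h l)"
    and h: "\<And>l \<phi>. l \<in> F0 \<Longrightarrow> \<phi> \<in> Linf \<Longrightarrow> l (toeplitz \<theta> \<alpha> \<phi>) = Linf_L1_pairing (h l) \<phi>"
    by (rule weak_star_symbol_functionals[OF F0(2)]) (rule that)
  define W where "W = {\<phi> \<in> Linf. toeplitz \<theta> \<alpha> \<phi> \<in> S}"
  have WL: "W \<subseteq> Linf" by (auto simp: W_def)
  have W: "csubspace W" unfolding W_def by (rule symbols_csubspace[OF S(1)])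
  have ker: "\<Lambda> (toeplitz \<theta> \<alpha> \<phi>) = 0"
    if \<phi>: "\<phi> \<in> W" and z: "\<And>l. l \<in> F0 \<Longrightarrow> Linf_L1_pairing (h l) \<phi> = 0" for \<phi>
  proof (rule ccontr)
    assume nz: "\<Lambda> (toeplitz \<theta> \<alpha> \<phi>) \<noteq> 0"
    define a where "a = 1 / \<Lambda> (toeplitz \<theta> \<alpha> \<phi>)"
    have \<phi>L: "\<phi> \<in> Linf" using \<phi> WL by blast
    have "a *\<^sub>C \<phi> \<in> W" using W \<phi> by (simp add: complex_vector.subspace_def)
    then have aS: "toeplitz \<theta> \<alpha> (a *\<^sub>C \<phi>) \<in> S" by (simp add: W_def)
    have "toeplitz \<theta> \<alpha> (a *\<^sub>C \<phi>) \<in> V"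
    proof (rule nb)
      show "toeplitz \<theta> \<alpha> (a *\<^sub>C \<phi>) \<in> bounded_ops ?H ?K" by (rule toeplitz_bounded_ops[OF Linf_scaleC[OF \<phi>L]])
      fix l assume l: "l \<in> F0"
      have "l (toeplitz \<theta> \<alpha> (a *\<^sub>C \<phi>)) = 0"
        using h[OF l Linf_scaleC[OF \<phi>L]] z[OF l] by (simp add: Linf_L1_pairing_scaleC[OF hi[OF l]])
      moreover have "l (\<lambda>x. 0) = 0"
        using h[OF l Linf_zero] Linf_L1_pairing_scaleC[OF hi[OF l], of 0 0] by (simp add: t0)
      ultimately show "cmod (l (toeplitz \<theta> \<alpha> (a *\<^sub>C \<phi>)) - l (\<lambda>x. 0)) < \<delta>" using \<delta> by simp
    qed
    then have "toeplitz \<theta> \<alpha> (a *\<^sub>C \<phi>) \<in> {T \<in> S. \<Lambda> T \<in> ball 0 1}" using V(2) aS by blast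
    moreover have "\<Lambda> (toeplitz \<theta> \<alpha> (a *\<^sub>C \<phi>)) = 1"
      using \<phi> nz by (simp add: toeplitz_scaleC[OF \<phi>L] lin(2) W_def a_def)
    ultimately show False by simp
  qed
  have "linear_on_csubspace W (\<lambda>\<phi>. \<Lambda> (toeplitz \<theta> \<alpha> \<phi>))"
    by (simp add: linear_on_csubspace_def W_def toeplitz_add toeplitz_scaleC lin)
  then have "\<exists>c. \<forall>\<phi>\<in>W. \<Lambda> (toeplitz \<theta> \<alpha> \<phi>) = (\<Sum>l\<in>F0. c l * Linf_L1_pairing (h l) \<phi>)"
    using functional_combination[OF F0(1) W, where l = "\<lambda>l. Linf_L1_pairing (h l)"
        and \<Lambda> = "\<lambda>\<phi>. \<Lambda> (toeplitz \<theta> \<alpha> \<phi>)"] linear_on_csubspace_L1_pairing[OF WL hi] ker by presburger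
  then obtain c where c: "\<forall>\<phi>\<in>W. \<Lambda> (toeplitz \<theta> \<alpha> \<phi>) = (\<Sum>l\<in>F0. c l * Linf_L1_pairing (h l) \<phi>)" by blast
  show ?thesis
  proof (rule that[of "\<lambda>z. \<Sum>l\<in>F0. c l * h l z"])
    show "integrable \<mu> (\<lambda>z. \<Sum>l\<in>F0. c l * h l z)" using hi by simp
    show "\<Lambda> (toeplitz \<theta> \<alpha> \<phi>) = Linf_L1_pairing (\<lambda>z. \<Sum>l\<in>F0. c l * h l z) \<phi>"
      if "\<phi> \<in> Linf" "toeplitz \<theta> \<alpha> \<phi> \<in> S" for \<phi>
      using c that by (simp add: Linf_L1_pairing_comb[OF that(1) hi] W_def)
  qed
qed

text \<open>The Hahn--Banach separation of a Toeplitz operator from a weak* closed space of such operators;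
the separating functional is again given by an integrable function.\<close>

lemma weak_star_separation_L1:
  assumes \<theta>: "inner_function \<theta>" and S: "op_subspace S" "closedin (weak_star (model_perp \<theta>) (model_perp \<alpha>)) S"
    and \<phi>0: "\<phi>\<^sub>0 \<in> Linf" "toeplitz \<theta> \<alpha> \<phi>\<^sub>0 \<notin> S"
  obtains h where "integrable \<mu> h" "Linf_L1_pairing h \<phi>\<^sub>0 \<noteq> 0"
    "\<And>\<phi>. \<phi> \<in> Linf \<Longrightarrow> toeplitz \<theta> \<alpha> \<phi> \<in> S \<Longrightarrow> Linf_L1_pairing h \<phi> = 0"
proof -
  let ?H = "model_perp \<theta>" and ?K = "model_perp \<alpha>"
  note H = closed_csubspace_model_perp[of \<theta>] and K = closed_csubspace_model_perp[of \<alpha>]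
  define V where "V = topspace (weak_star ?H ?K) - S"
  have V: "openin (weak_star ?H ?K) V" using S(2) by (simp add: closedin_def V_def)
  have "toeplitz \<theta> \<alpha> \<phi>\<^sub>0 \<in> V"
    using \<phi>0 toeplitz_bounded_ops[OF \<phi>0(1)] by (simp add: V_def topspace_weak_star[OF H K])
  from weak_topology_neighbourhood[OF V[unfolded weak_star_def] this]
  obtain F0 \<delta> where F0: "finite F0"
      "F0 \<subseteq> {\<lambda>T. pairing ?H ?K T t | t. t \<in> trace_class ?K ?H}" and \<delta>: "\<delta> > 0"
    and nb: "\<And>T. T \<in> bounded_ops ?H ?K \<Longrightarrow> (\<And>l. l \<in> F0 \<Longrightarrow> cmod (l T - l (toeplitz \<theta> \<alpha> \<phi>\<^sub>0)) < \<delta>) \<Longrightarrow> T \<in> V"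
    by blast
  obtain h where hi: "\<And>l. l \<in> F0 \<Longrightarrow> integrable \<mu> (h l)"
    and h: "\<And>l \<phi>. l \<in> F0 \<Longrightarrow> \<phi> \<in> Linf \<Longrightarrow> l (toeplitz \<theta> \<alpha> \<phi>) = Linf_L1_pairing (h l) \<phi>"
    by (rule weak_star_symbol_functionals[OF F0(2)]) (rule that)
  define W where "W = {\<phi> \<in> Linf. toeplitz \<theta> \<alpha> \<phi> \<in> S}"
  have WL: "W \<subseteq> Linf" by (auto simp: W_def)
  have W: "csubspace W" unfolding W_def by (rule symbols_csubspace[OF S(1)])
  have ne: "\<exists>l\<in>F0. Linf_L1_pairing (h l) \<phi> \<noteq> Linf_L1_pairing (h l) \<phi>\<^sub>0" if \<phi>: "\<phi> \<in> W" for \<phi>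
  proof (rule ccontr)
    assume "\<not> (\<exists>l\<in>F0. Linf_L1_pairing (h l) \<phi> \<noteq> Linf_L1_pairing (h l) \<phi>\<^sub>0)"
    moreover have \<phi>L: "\<phi> \<in> Linf" using \<phi> WL by blast
    ultimately have "toeplitz \<theta> \<alpha> \<phi> \<in> V"
      using \<delta> h[OF _ \<phi>L] h[OF _ \<phi>0(1)] by (intro nb toeplitz_bounded_ops) auto
    then show False using \<phi> by (simp add: V_def W_def)
  qed
  have "\<exists>c. (\<forall>\<phi>\<in>W. (\<Sum>l\<in>F0. c l * Linf_L1_pairing (h l) \<phi>) = 0) \<and>
      (\<Sum>l\<in>F0. c l * Linf_L1_pairing (h l) \<phi>\<^sub>0) \<noteq> 0"
    by (rule functional_separation[OF F0(1) W, where l = "\<lambda>l. Linf_L1_pairing (h l)"])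
      (use linear_on_csubspace_L1_pairing[OF WL hi] ne in blast)+
  then obtain c where c: "\<forall>\<phi>\<in>W. (\<Sum>l\<in>F0. c l * Linf_L1_pairing (h l) \<phi>) = 0"
    "(\<Sum>l\<in>F0. c l * Linf_L1_pairing (h l) \<phi>\<^sub>0) \<noteq> 0" by blast
  show ?thesis
  proof (rule that[of "\<lambda>z. \<Sum>l\<in>F0. c l * h l z"])
    show "integrable \<mu> (\<lambda>z. \<Sum>l\<in>F0. c l * h l z)" using hi by simp
    show "Linf_L1_pairing (\<lambda>z. \<Sum>l\<in>F0. c l * h l z) \<phi>\<^sub>0 \<noteq> 0"
      using c(2) by (simp add: Linf_L1_pairing_comb[OF \<phi>0(1) hi])
    show "Linf_L1_pairing (\<lambda>z. \<Sum>l\<in>F0. c l * h l z) \<phi> = 0" if "\<phi> \<in> Linf" "toeplitz \<theta> \<alpha> \<phi> \<in> S" for \<phi>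
      using c(1) that by (simp add: Linf_L1_pairing_comb[OF that(1) hi] W_def)
  qed
qed

section \<open>Weak* closed spaces of Toeplitz operators\<close>

text \<open>Each functional \<open>T \<mapsto> \<langle>T, t\<rangle>\<close> becomes integration against an \<open>L\<^sup>1\<close> function.\<close>

lemma toeplitz_weak_star_continuous:
  assumes \<theta>: "inner_function \<theta>"
  shows "continuous_map Linf_weak_star
    (subtopology (weak_star (model_perp \<theta>) (model_perp \<alpha>)) (dual_toeplitz_ops \<theta> \<alpha>)) (dual_toeplitz \<theta> \<alpha>)"
proof -
  let ?H = "model_perp \<theta>" and ?K = "model_perp \<alpha>"
  note H = closed_csubspace_model_perp[of \<theta>] and K = closed_csubspace_model_perp[of \<alpha>]
  have "integrable \<mu> (\<lambda>z. 0 :: complex)" by simp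
  then have "{Linf_L1_pairing h | h. integrable \<mu> h} \<noteq> {}" by blast
  then have top: "topspace Linf_weak_star = Linf"
    unfolding Linf_weak_star_def by (rule topspace_weak_topology_on)
  have "continuous_map Linf_weak_star (weak_star ?H ?K) (dual_toeplitz \<theta> \<alpha>)"
    unfolding weak_star_def weak_topology_on_def
  proof (rule continuous_on_generated_topo)
    fix U assume "U \<in> {{x \<in> bounded_ops ?H ?K. \<phi> x \<in> U} |\<phi> U.
        \<phi> \<in> {\<lambda>T. pairing ?H ?K T t | t. t \<in> trace_class ?K ?H} \<and> open U}"
    then obtain t U' where t: "t \<in> trace_class ?K ?H" and U': "open U'"
      and U: "U = {T \<in> bounded_ops ?H ?K. pairing ?H ?K T t \<in> U'}" by blast
    obtain h where hi: "integrable \<mu> h"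
      and h: "\<And>\<phi>. \<phi> \<in> Linf \<Longrightarrow> pairing ?H ?K (toeplitz \<theta> \<alpha> \<phi>) t = Linf_L1_pairing h \<phi>"
      by (rule pairing_toeplitz_L1[OF t]) (rule that)
    have "dual_toeplitz \<theta> \<alpha> -` U \<inter> topspace Linf_weak_star = {\<phi> \<in> Linf. Linf_L1_pairing h \<phi> \<in> U'}"
      unfolding top U using h toeplitz_bounded_ops by (auto simp: dual_toeplitz_eq[OF \<theta>])
    moreover have "openin Linf_weak_star {\<phi> \<in> Linf. Linf_L1_pairing h \<phi> \<in> U'}"
      unfolding Linf_weak_star_def using hi by (intro openin_weak_topology_basic U') blast
    ultimately show "openin Linf_weak_star (dual_toeplitz \<theta> \<alpha> -` U \<inter> topspace Linf_weak_star)" by simp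
  next
    have "topspace (weak_star ?H ?K) = \<Union> {{x \<in> bounded_ops ?H ?K. \<phi> x \<in> U} |\<phi> U.
        \<phi> \<in> {\<lambda>T. pairing ?H ?K T t | t. t \<in> trace_class ?K ?H} \<and> open U}"
      unfolding weak_star_def weak_topology_on_def by (rule topology_generated_by_topspace)
    moreover have "dual_toeplitz \<theta> \<alpha> ` topspace Linf_weak_star \<subseteq> topspace (weak_star ?H ?K)"
      unfolding top topspace_weak_star[OF H K] using toeplitz_bounded_ops by (auto simp: dual_toeplitz_eq[OF \<theta>])
    ultimately show "dual_toeplitz \<theta> \<alpha> ` topspace Linf_weak_star \<subseteq> \<Union> {{x \<in> bounded_ops ?H ?K. \<phi> x \<in> U} |\<phi> U.
        \<phi> \<in> {\<lambda>T. pairing ?H ?K T t | t. t \<in> trace_class ?K ?H} \<and> open U}" by simp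
  qed
  moreover have "dual_toeplitz \<theta> \<alpha> \<in> topspace Linf_weak_star \<rightarrow> dual_toeplitz_ops \<theta> \<alpha>"
    unfolding top dual_toeplitz_ops_eq[OF \<theta>] by (auto simp: dual_toeplitz_eq[OF \<theta>])
  ultimately show ?thesis by (auto simp: continuous_map_in_subtopology)
qed

lemma dual_toeplitz_ops_closed:
  assumes \<theta>: "inner_function \<theta>" and \<alpha>: "inner_function \<alpha>"
  shows "closedin (weak_star (model_perp \<theta>) (model_perp \<alpha>)) (dual_toeplitz_ops \<theta> \<alpha>)"
  using closedin_annihilator[OF closed_csubspace_model_perp closed_csubspace_model_perp,
      of "pre_annihilator (model_perp \<theta>) (model_perp \<alpha>) (dual_toeplitz_ops \<theta> \<alpha>) \<inter>
        rank_le_ops 2 (model_perp \<alpha>) (model_perp \<theta>)" \<alpha> \<theta>]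
  by (simp add: dual_toeplitz_ops_2_reflexive[OF \<theta> \<alpha>]) (auto simp: pre_annihilator_def)

lemma Linf_csubspace: "csubspace Linf"
  by (simp add: complex_vector.subspace_def Linf_zero Linf_add Linf_scaleC)

text \<open>A functional is integration of the symbol against some \<open>h\<close>, and its norm is the \<open>L\<^sup>1\<close> norm of
\<open>h\<close> because the symbol map is isometric; the factorisation of \<open>h\<close> gives an operator of rank two
whose trace norm is at most \<open>(1 + \<epsilon>)\<close> times that norm. For \<open>h = 0\<close> there is no room for an error,
and the zero operator is used.\<close>

lemma property_A_dual_toeplitz_ops:
  assumes \<theta>: "inner_function \<theta>" and nc: "nonconstant \<theta>" and \<alpha>: "inner_function \<alpha>"
  shows "property_A_const 2 1 (model_perp \<theta>) (model_perp \<alpha>) (dual_toeplitz_ops \<theta> \<alpha>)"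
proof -
  let ?H = "model_perp \<theta>" and ?K = "model_perp \<alpha>" and ?T = "dual_toeplitz_ops \<theta> \<alpha>"
  note H = closed_csubspace_model_perp[of \<theta>] and K = closed_csubspace_model_perp[of \<alpha>]
  note Teq = dual_toeplitz_ops_eq[OF \<theta>, of \<alpha>]
  have sub: "op_subspace ?T" unfolding Teq by (rule op_subspace_toeplitz[OF Linf_csubspace order_refl])
  have key: "\<exists>g\<in>rank_le_ops 2 ?K ?H. (\<forall>T\<in>?T. \<Lambda> T = pairing ?H ?K T g) \<and>
      trace_norm ?K g \<le> (1 + \<epsilon>) * functional_norm ?H ?T \<Lambda>"
    if \<Lambda>: "weak_star_functional ?H ?K ?T \<Lambda>" and \<epsilon>: "\<epsilon> > 0" for \<Lambda> \<epsilon>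
  proof -
    obtain h where hi: "integrable \<mu> h"
      and "\<And>\<phi>. \<phi> \<in> Linf \<Longrightarrow> toeplitz \<theta> \<alpha> \<phi> \<in> ?T \<Longrightarrow> \<Lambda> (toeplitz \<theta> \<alpha> \<phi>) = Linf_L1_pairing h \<phi>"
      by (rule weak_star_functional_L1[OF \<theta> sub order_refl \<Lambda>]) (rule that)
    then have h: "\<Lambda> (toeplitz \<theta> \<alpha> \<phi>) = Linf_L1_pairing h \<phi>" if "\<phi> \<in> Linf" for \<phi>
      using that by (simp add: Teq)
    define A where "A = (LINT z|\<mu>. cmod (h z))"
    have A0: "A \<ge> 0" by (simp add: A_def)
    have fn: "A \<le> functional_norm ?H ?T \<Lambda>"
    proof -
      obtain \<phi> where \<phi>: "\<phi> \<in> Linf" "Linf_norm \<phi> \<le> 1" "Linf_L1_pairing h \<phi> = complex_of_real A"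
        using L1_norm_attained[OF hi] unfolding A_def by blast
      have "bdd_above ((\<lambda>T. cmod (\<Lambda> T)) ` {T \<in> ?T. op_norm ?H T \<le> 1})"
      proof (rule bdd_aboveI2)
        fix T assume "T \<in> {T \<in> ?T. op_norm ?H T \<le> 1}"
        then obtain \<psi> where \<psi>: "\<psi> \<in> Linf" "T = toeplitz \<theta> \<alpha> \<psi>" "Linf_norm \<psi> \<le> 1"
          unfolding Teq by (auto simp: toeplitz_op_norm)
        have "cmod (\<Lambda> T) \<le> Linf_norm \<psi> * A"
          using Linf_L1_pairing_le[OF \<psi>(1) hi] h[OF \<psi>(1)] by (simp add: \<psi>(2) A_def)
        also have "\<dots> \<le> 1 * A" using \<psi>(3) A0 by (intro mult_right_mono)
        finally show "cmod (\<Lambda> T) \<le> 1 * A" .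
      qed
      then have "cmod (\<Lambda> (toeplitz \<theta> \<alpha> \<phi>)) \<le> functional_norm ?H ?T \<Lambda>"
        unfolding functional_norm_def using \<phi> by (intro cSUP_upper) (auto simp: Teq toeplitz_op_norm)
      then show ?thesis using A0 by (simp add: h[OF \<phi>(1)] \<phi>(3))
    qed
    show ?thesis
    proof (cases "A = 0")
      case True
      then have "AE z in \<mu>. cmod (h z) = 0"
        using hi integral_nonneg_eq_0_iff_AE[of \<mu> "\<lambda>z. cmod (h z)"] by (simp add: A_def)
      then have h0: "AE z in \<mu>. h z = rep_L2 0 z * cnj (rep_L2 (zpow (-1)) z) + rep_L2 0 z * cnj (rep_L2 (zpow (-2)) z)"
        using rep_zero by eventually_elim simp
      have z: "zpow (-1) \<in> ?K" "zpow (-2) \<in> ?K" by (simp_all add: coH2_model_perp zpow_coH2)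
      note zero = closed_csubspaceD(1)[OF H]
      let ?g = "rank_two ?K 0 (zpow (-1)) 0 (zpow (-2))"
      have ne: "zpow (-1) \<noteq> 0" "zpow (-2) \<noteq> c *\<^sub>C zpow (-1)" for c
      proof -
        show "zpow (-1) \<noteq> 0" using cinner_zpow_zpow[of "-1" "-1"] by auto
        show "zpow (-2) \<noteq> c *\<^sub>C zpow (-1)"
        proof
          assume "zpow (-2) = c *\<^sub>C zpow (-1)"
          then have "cinner (zpow (-2)) (zpow (-2)) = c * cinner (zpow (-1)) (zpow (-2))"
            by (metis cinner_scaleC_left)
          then show False by (simp add: cinner_zpow_zpow)
        qed
      qed
      have "trace_norm ?K ?g \<le> 0"
        using trace_norm_rank_two_le[OF K z ne, of 0 0] by simp
      also have "0 \<le> (1 + \<epsilon>) * functional_norm ?H ?T \<Lambda>" using fn A0 \<epsilon> by simp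
      finally have "trace_norm ?K ?g \<le> (1 + \<epsilon>) * functional_norm ?H ?T \<Lambda>" .
      moreover have "\<forall>T\<in>?T. \<Lambda> T = pairing ?H ?K T ?g"
        unfolding Teq using pairing_toeplitz_rank_two[OF _ hi zero zero z h0] h by auto
      ultimately show ?thesis using rank_two_in_rank_le_ops[OF H K zero zero z] by blast
    next
      case False
      then have "\<epsilon> * A > 0" using A0 \<epsilon> by simp
      note fact = L1_factorization[OF \<theta> nc hi this, of \<alpha>, folded A_def]
      obtain f1 g1 f2 g2 where f: "f1 \<in> ?H" "f2 \<in> ?H" and g: "g1 \<in> ?K" "g2 \<in> ?K"
        and eq: "AE z in \<mu>. h z = rep_L2 f1 z * cnj (rep_L2 g1 z) + rep_L2 f2 z * cnj (rep_L2 g2 z)"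
        and le: "norm f1 * norm g1 + norm f2 * norm g2 \<le> A + \<epsilon> * A"
        and ne: "g1 \<noteq> 0" "\<And>c. g2 \<noteq> c *\<^sub>C g1"
        by (rule fact) (rule that)
      let ?g = "rank_two ?K f1 g1 f2 g2"
      have "trace_norm ?K ?g \<le> (1 + \<epsilon>) * A"
        using trace_norm_rank_two_le[OF K g ne, of f1 f2] le by (simp add: algebra_simps)
      also have "\<dots> \<le> (1 + \<epsilon>) * functional_norm ?H ?T \<Lambda>" using fn \<epsilon> by (intro mult_left_mono) auto
      finally have "trace_norm ?K ?g \<le> (1 + \<epsilon>) * functional_norm ?H ?T \<Lambda>" .
      moreover have "\<forall>T\<in>?T. \<Lambda> T = pairing ?H ?K T ?g"
        unfolding Teq using pairing_toeplitz_rank_two[OF _ hi f g eq] h by auto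
      ultimately show ?thesis using rank_two_in_rank_le_ops[OF H K f g] by blast
    qed
  qed
  have "property_A 2 ?H ?K ?T"
    unfolding property_A_def using sub dual_toeplitz_ops_closed[OF \<theta> \<alpha>] key[of _ 1] zero_less_one by blast
  then show ?thesis unfolding property_A_const_def using key by blast
qed

text \<open>A Toeplitz operator outside \<open>S\<close> is separated from \<open>S\<close> by an integrable function, and by the
factorisation of that function this is an annihilator of rank two.\<close>

lemma weak_star_closed_2_reflexive:
  assumes \<theta>: "inner_function \<theta>" and nc: "nonconstant \<theta>" and \<alpha>: "inner_function \<alpha>"
    and S: "S \<subseteq> dual_toeplitz_ops \<theta> \<alpha>" "op_subspace S" "closedin (weak_star (model_perp \<theta>) (model_perp \<alpha>)) S"
  shows "k_reflexive 2 (model_perp \<theta>) (model_perp \<alpha>) S"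
proof -
  let ?H = "model_perp \<theta>" and ?K = "model_perp \<alpha>" and ?T = "dual_toeplitz_ops \<theta> \<alpha>"
  let ?F = "rank_le_ops 2 ?K ?H"
  note H = closed_csubspace_model_perp[of \<theta>] and K = closed_csubspace_model_perp[of \<alpha>]
  note Teq = dual_toeplitz_ops_eq[OF \<theta>, of \<alpha>]
  have "S \<subseteq> annihilator ?H ?K (pre_annihilator ?H ?K S \<inter> ?F)"
    using S(1) toeplitz_bounded_ops unfolding Teq by (auto simp: annihilator_def pre_annihilator_def)
  moreover have "annihilator ?H ?K (pre_annihilator ?H ?K S \<inter> ?F) \<subseteq> S"
  proof
    fix T assume T: "T \<in> annihilator ?H ?K (pre_annihilator ?H ?K S \<inter> ?F)"
    then have "T \<in> annihilator ?H ?K (pre_annihilator ?H ?K ?T \<inter> ?F)"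
      using S(1) by (auto simp: annihilator_def pre_annihilator_def)
    then have "T \<in> ?T" by (simp add: dual_toeplitz_ops_2_reflexive[OF \<theta> \<alpha>])
    then obtain \<phi>0 where \<phi>0: "\<phi>0 \<in> Linf" "T = toeplitz \<theta> \<alpha> \<phi>0" unfolding Teq by blast
    show "T \<in> S"
    proof (rule ccontr)
      assume "T \<notin> S"
      with \<phi>0 have no: "toeplitz \<theta> \<alpha> \<phi>0 \<notin> S" by simp
      obtain h where hi: "integrable \<mu> h" and h0: "Linf_L1_pairing h \<phi>0 \<noteq> 0"
        and h: "\<And>\<phi>. \<phi> \<in> Linf \<Longrightarrow> toeplitz \<theta> \<alpha> \<phi> \<in> S \<Longrightarrow> Linf_L1_pairing h \<phi> = 0"
        by (rule weak_star_separation_L1[OF \<theta> S(2,3) \<phi>0(1) no]) (rule that)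
      obtain f1 g1 f2 g2 where f: "f1 \<in> ?H" "f2 \<in> ?H" and g: "g1 \<in> ?K" "g2 \<in> ?K"
        and eq: "AE z in \<mu>. h z = rep_L2 f1 z * cnj (rep_L2 g1 z) + rep_L2 f2 z * cnj (rep_L2 g2 z)"
        by (rule L1_factorization[OF \<theta> nc hi zero_less_one, of \<alpha>]) (rule that)
      let ?t = "rank_two ?K f1 g1 f2 g2"
      note pr = pairing_toeplitz_rank_two[OF _ hi f g eq]
      have "?t \<in> pre_annihilator ?H ?K S"
        using rank_two_trace_class[OF H K f g] S(1) pr h unfolding Teq pre_annihilator_def by auto
      then have "pairing ?H ?K T ?t = 0"
        using T rank_two_in_rank_le_ops[OF H K f g] by (auto simp: annihilator_def)
      then show False using pr[OF \<phi>0(1)] h0 by (simp add: \<phi>0(2))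
    qed
  qed
  ultimately show ?thesis using S by (auto simp: k_reflexive_def)
qed

lemma analytic_dual_toeplitz_ops_eq:
  assumes "inner_function \<theta>"
  shows "analytic_dual_toeplitz_ops \<theta> \<alpha> = toeplitz \<theta> \<alpha> ` Hinf"
  unfolding analytic_dual_toeplitz_ops_def
  by (intro image_cong refl dual_toeplitz_eq[OF assms] Hinf_Linf)

text \<open>The negative Fourier coefficients of the symbol are pairings with
\<open>z\<^sup>-\<^sup>1 \<otimes> z\<^sup>n\<^sup>-\<^sup>1\<close>, \<open>n < 0\<close>.\<close>

lemma analytic_dual_toeplitz_ops_closed:
  assumes \<theta>: "inner_function \<theta>" and \<alpha>: "inner_function \<alpha>"
  shows "closedin (weak_star (model_perp \<theta>) (model_perp \<alpha>)) (analytic_dual_toeplitz_ops \<theta> \<alpha>)"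
proof -
  let ?H = "model_perp \<theta>" and ?K = "model_perp \<alpha>"
  note H = closed_csubspace_model_perp[of \<theta>] and K = closed_csubspace_model_perp[of \<alpha>]
  have z: "zpow n \<in> ?H" "zpow n \<in> ?K" if "n < 0" for n
    using that by (simp_all add: coH2_model_perp zpow_coH2)
  note zero = closed_csubspaceD(1)[OF H] closed_csubspaceD(1)[OF K]
  define t where "t n = rank_two ?K (zpow (-1)) (zpow (n - 1)) 0 0" for n
  have t: "t n \<in> trace_class ?K ?H" if "n < 0" for n
    unfolding t_def using that z zero by (intro rank_two_trace_class[OF H K]) auto
  have pt: "pairing ?H ?K (toeplitz \<theta> \<alpha> \<phi>) (t n) = cinner \<phi> (zpow n)" if n: "n < 0" and \<phi>: "\<phi> \<in> Linf" for n \<phi>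
  proof -
    have "pairing ?H ?K (toeplitz \<theta> \<alpha> \<phi>) (t n) = cinner (toeplitz \<theta> \<alpha> \<phi> (zpow (-1))) (zpow (n - 1))"
      unfolding t_def using n z zero by (subst pairing_rank_two[OF H K _ _ _ _ toeplitz_bounded_ops[OF \<phi>]]) auto
    also have "\<dots> = cinner (\<phi> *\<^sub>L zpow (-1)) (zpow (n - 1))" using n by (intro cinner_toeplitz z) auto
    also have "\<dots> = cinner \<phi> (zpow n)" by (simp add: L2_mult_commute[of \<phi>] cinner_shift zpow_mult)
    finally show ?thesis .
  qed
  have "analytic_dual_toeplitz_ops \<theta> \<alpha> = dual_toeplitz_ops \<theta> \<alpha> \<inter> annihilator ?H ?K (t ` {..<0})"
  proof
    show "analytic_dual_toeplitz_ops \<theta> \<alpha> \<subseteq> dual_toeplitz_ops \<theta> \<alpha> \<inter> annihilator ?H ?K (t ` {..<0})"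
      unfolding analytic_dual_toeplitz_ops_eq[OF \<theta>] dual_toeplitz_ops_eq[OF \<theta>]
      using pt toeplitz_bounded_ops by (auto simp: annihilator_def Hinf_def H2_def)
    show "dual_toeplitz_ops \<theta> \<alpha> \<inter> annihilator ?H ?K (t ` {..<0}) \<subseteq> analytic_dual_toeplitz_ops \<theta> \<alpha>"
    proof
      fix T assume T: "T \<in> dual_toeplitz_ops \<theta> \<alpha> \<inter> annihilator ?H ?K (t ` {..<0})"
      then obtain \<phi> where \<phi>: "\<phi> \<in> Linf" "T = toeplitz \<theta> \<alpha> \<phi>" unfolding dual_toeplitz_ops_eq[OF \<theta>] by blast
      have "cinner \<phi> (zpow n) = 0" if "n < 0" for n
        using T pt[OF that \<phi>(1)] that by (simp add: annihilator_def \<phi>(2))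
      then have "\<phi> \<in> Hinf" using \<phi>(1) by (simp add: Hinf_def H2_def)
      then show "T \<in> analytic_dual_toeplitz_ops \<theta> \<alpha>" unfolding analytic_dual_toeplitz_ops_eq[OF \<theta>] \<phi>(2) by (rule imageI)
    qed
  qed
  moreover have "closedin (weak_star ?H ?K) (annihilator ?H ?K (t ` {..<0}))"
    by (rule closedin_annihilator[OF H K]) (use t in auto)
  ultimately show ?thesis using dual_toeplitz_ops_closed[OF \<theta> \<alpha>] by (simp add: closedin_Int)
qed

lemma Hinf_csubspace: "csubspace Hinf"
  using closed_csubspaceD(1-3)[OF closed_csubspace_H2]
  by (simp add: Hinf_def complex_vector.subspace_def Linf_zero Linf_add Linf_scaleC)

theorem theorem6p3:
  fixes \<theta> \<alpha> :: L2 and H K :: "L2 set"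
    and \<Phi> :: "L2 \<Rightarrow> L2 \<Rightarrow> L2" and \<T> \<A> :: "(L2 \<Rightarrow> L2) set"
  assumes "inner_function \<theta>" and "nonconstant \<theta>"
    and "inner_function \<alpha>" and "nonconstant \<alpha>"
    and "H = model_perp \<theta>" and "K = model_perp \<alpha>"
    and "\<Phi> = dual_toeplitz \<theta> \<alpha>"
    and "\<T> = dual_toeplitz_ops \<theta> \<alpha>"
    and "\<A> = analytic_dual_toeplitz_ops \<theta> \<alpha>"
  shows "((\<forall>\<phi>\<in>Linf. \<forall>\<psi>\<in>Linf. \<Phi> (\<phi> + \<psi>) = (\<lambda>f. \<Phi> \<phi> f + \<Phi> \<psi> f)) \<and>
          (\<forall>c. \<forall>\<phi>\<in>Linf. \<Phi> (c *\<^sub>C \<phi>) = (\<lambda>f. c *\<^sub>C \<Phi> \<phi> f)) \<and>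
          (\<forall>\<phi>\<in>Linf. op_norm H (\<Phi> \<phi>) = Linf_norm \<phi>) \<and>
          \<Phi> ` Linf = \<T>) \<and>
         continuous_map Linf_weak_star (subtopology (weak_star H K) \<T>) \<Phi> \<and>
         bij_betw \<Phi> Hinf \<A> \<and>
         property_A_const 2 1 H K \<T> \<and>
         (\<forall>S. S \<subseteq> \<T> \<and> op_subspace S \<and> closedin (weak_star H K) S \<longrightarrow> k_reflexive 2 H K S) \<and>
         (closedin (weak_star H K) \<A> \<and> k_reflexive 2 H K \<A>)"
proof -
  note \<theta> = assms(1) and nc = assms(2) and \<alpha> = assms(3)
  have HK: "H = model_perp \<theta>" "K = model_perp \<alpha>" by fact+
  have \<Phi>: "\<Phi> \<phi> = toeplitz \<theta> \<alpha> \<phi>" if "\<phi> \<in> Linf" for \<phi>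
    using dual_toeplitz_eq[OF \<theta> that] assms(7) by simp
  have \<T>: "\<T> = toeplitz \<theta> \<alpha> ` Linf" using dual_toeplitz_ops_eq[OF \<theta>] assms(8) by simp
  have \<A>: "\<A> = toeplitz \<theta> \<alpha> ` Hinf" using analytic_dual_toeplitz_ops_eq[OF \<theta>] assms(9) by simp
  have Hinf_sub: "Hinf \<subseteq> Linf" using Hinf_Linf by blast
  have reflexive: "k_reflexive 2 H K S" if "S \<subseteq> \<T>" "op_subspace S" "closedin (weak_star H K) S" for S
    using weak_star_closed_2_reflexive[OF \<theta> nc \<alpha>] that unfolding HK assms(8) by blast
  have \<A>_closed: "closedin (weak_star H K) \<A>"
    using analytic_dual_toeplitz_ops_closed[OF \<theta> \<alpha>] unfolding HK assms(9) .
  show ?thesis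
  proof (intro conjI)
    show "\<forall>\<phi>\<in>Linf. \<forall>\<psi>\<in>Linf. \<Phi> (\<phi> + \<psi>) = (\<lambda>f. \<Phi> \<phi> f + \<Phi> \<psi> f)"
      by (simp add: \<Phi> Linf_add toeplitz_add)
    show "\<forall>c. \<forall>\<phi>\<in>Linf. \<Phi> (c *\<^sub>C \<phi>) = (\<lambda>f. c *\<^sub>C \<Phi> \<phi> f)"
      by (simp add: \<Phi> Linf_scaleC toeplitz_scaleC)
    show "\<forall>\<phi>\<in>Linf. op_norm H (\<Phi> \<phi>) = Linf_norm \<phi>"
      by (simp add: \<Phi> HK toeplitz_op_norm)
    show "\<Phi> ` Linf = \<T>"
      unfolding \<T> by (intro image_cong refl \<Phi>)
    show "continuous_map Linf_weak_star (subtopology (weak_star H K) \<T>) \<Phi>"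
      using toeplitz_weak_star_continuous[OF \<theta>] unfolding HK assms(7,8) .
    show "bij_betw \<Phi> Hinf \<A>"
      unfolding bij_betw_def
    proof
      show "inj_on \<Phi> Hinf"
      proof (rule inj_onI)
        fix \<phi> \<psi> assume "\<phi> \<in> Hinf" "\<psi> \<in> Hinf" "\<Phi> \<phi> = \<Phi> \<psi>"
        then show "\<phi> = \<psi>" using toeplitz_inj Hinf_sub by (metis \<Phi> subsetD)
      qed
      show "\<Phi> ` Hinf = \<A>" unfolding \<A> by (intro image_cong refl \<Phi> Hinf_Linf)
    qed
    show "property_A_const 2 1 H K \<T>"
      using property_A_dual_toeplitz_ops[OF \<theta> nc \<alpha>] unfolding HK assms(8) .
    show "\<forall>S. S \<subseteq> \<T> \<and> op_subspace S \<and> closedin (weak_star H K) S \<longrightarrow> k_reflexive 2 H K S"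
      using reflexive by blast
    show "closedin (weak_star H K) \<A>" by (rule \<A>_closed)
    show "k_reflexive 2 H K \<A>"
    proof (rule reflexive)
      show "\<A> \<subseteq> \<T>" unfolding \<A> \<T> using Hinf_sub by blast
      show "op_subspace \<A>" unfolding \<A> by (rule op_subspace_toeplitz[OF Hinf_csubspace Hinf_sub])
    qed (rule \<A>_closed)
  qed
qed

end
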